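(* Fix an integer $\Delta\ge2$. For a $\Delta$-regular graph $G=(V,E)$ on $n$ vertices, consider the quantum annealing evolution with Hamiltonian $\mathbf H(t)=(1-u(t))\mathbf B+u(t)\mathbf C$, $t\in[0,T]$, where $\mathbf C=-\frac12\sum_{(i,j)\in E}(\mathbf I-\mathbf Z_i\mathbf Z_j)$, $\mathbf B=-\sum_{k\in V}\mathbf X_k$, and $u:[0,T]\to[0,1]$ is a control function with $u(0)=0$, $u(T)=1$, started from $|\psi_0\rangle=|+\rangle^{\otimes n}$, with final state $|\psi_T\rangle=\mathbf U(T)|\psi_0\rangle$. Suppose $$T\le\frac{\kappa}{16\log(\Delta)\,\Delta^{1+4/\kappa}}\log n$$ for some $0<\kappa<1$. Then for any $\nu>0$ and sufficiently large $n$, the expected cut size obtained by applying this algorithm (measuring $|\psi_T\rangle$ in the computational basis) to a uniformly random $\Delta$-regular bipartite graph on $n$ vertices, i.e. $\mathbb E_G\big[-\langle\psi_T|\mathbf C|\psi_T\rangle\big]$, is at most $$\Big(\frac{\Delta}{4}+O(\sqrt\Delta)+2\nu\Big)n.$$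
   Context: $\mathbf X_k,\mathbf Z_k$ are Pauli operators on the qubit at vertex $k$; $|+\rangle=(|0\rangle+|1\rangle)/\sqrt2$. $\mathbf U(t)$ solves $i\frac{d}{dt}\mathbf U(t)=\mathbf H(t)\mathbf U(t)$, $\mathbf U(0)=\mathbf I$. The cut associated with $\mathbf x\in\{0,1\}^n$ has size $-\langle\mathbf x|\mathbf C|\mathbf x\rangle$ (number of edges whose endpoints receive different bits). Logarithms are natural. *)

theory Defs
  imports "HOL-Analysis.Analysis"
begin

text \<open>n-qubit operators on vertex set {0..<n}. A computational basis state x in {0,1}^n is
  encoded as the set of vertices carrying bit 1, i.e. an element of Pow {..<n}.
  An operator is given by its matrix entries indexed by basis states.\<close>

type_synonym qop = "nat set \<Rightarrow> nat set \<Rightarrow> complex"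
type_synonym qstate = "nat set \<Rightarrow> complex"

definition basis :: "nat \<Rightarrow> nat set set" where
  "basis n = Pow {..<n}"

definition idop :: qop where
  "idop x y = (if x = y then 1 else 0)"

definition mmul :: "nat \<Rightarrow> qop \<Rightarrow> qop \<Rightarrow> qop" where
  "mmul n A B = (\<lambda>x y. \<Sum>z\<in>basis n. A x z * B z y)"

definition apply_op :: "nat \<Rightarrow> qop \<Rightarrow> qstate \<Rightarrow> qstate" where
  "apply_op n A \<psi> = (\<lambda>x. \<Sum>y\<in>basis n. A x y * \<psi> y)"

definition pauliZ :: "nat \<Rightarrow> qop" where
  "pauliZ k x y = (if x = y then (if k \<in> x then -1 else 1) else 0)"

definition pauliX :: "nat \<Rightarrow> qop" where
  "pauliX k x y = (if y = (if k \<in> x then x - {k} else insert k x) then 1 else 0)"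

text \<open>Graphs on vertex set {0..<n}: each undirected edge {i,j} is stored once as (i,j) with i<j.\<close>
definition is_graph :: "nat \<Rightarrow> (nat \<times> nat) set \<Rightarrow> bool" where
  "is_graph n E \<longleftrightarrow> E \<subseteq> {(i,j). i < j \<and> j < n}"

definition degree :: "(nat \<times> nat) set \<Rightarrow> nat \<Rightarrow> nat" where
  "degree E v = card {(i,j)\<in>E. i = v \<or> j = v}"

definition regular :: "nat \<Rightarrow> nat \<Rightarrow> (nat \<times> nat) set \<Rightarrow> bool" where
  "regular n d E \<longleftrightarrow> (\<forall>v<n. degree E v = d)"

definition bipartite :: "(nat \<times> nat) set \<Rightarrow> bool" where
  "bipartite E \<longleftrightarrow> (\<exists>A. \<forall>(i,j)\<in>E. (i \<in> A \<longleftrightarrow> j \<notin> A))"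

text \<open>The (finite) set of labelled d-regular bipartite graphs on {0..<n};
  the uniformly random graph is uniform on this set.\<close>
definition reg_bip_graphs :: "nat \<Rightarrow> nat \<Rightarrow> (nat \<times> nat) set set" where
  "reg_bip_graphs n d = {E. is_graph n E \<and> regular n d E \<and> bipartite E}"

definition costH :: "nat \<Rightarrow> (nat \<times> nat) set \<Rightarrow> qop" where
  "costH n E = (\<lambda>x y. - (1/2) * (\<Sum>(i,j)\<in>E. idop x y - mmul n (pauliZ i) (pauliZ j) x y))"

definition mixH :: "nat \<Rightarrow> qop" where
  "mixH n = (\<lambda>x y. - (\<Sum>k<n. pauliX k x y))"

definition annealH :: "nat \<Rightarrow> (nat \<times> nat) set \<Rightarrow> (real \<Rightarrow> real) \<Rightarrow> real \<Rightarrow> qop" where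
  "annealH n E u t = (\<lambda>x y. complex_of_real (1 - u t) * mixH n x y + complex_of_real (u t) * costH n E x y)"

text \<open>U solves i U'(t) = H(t) U(t), U(0) = I on [0,T], stated in integral (Caratheodory) form
  U(t) = I - i \<integral>_0^t H(s) U(s) ds, which allows merely measurable controls u.\<close>
definition is_propagator :: "nat \<Rightarrow> (real \<Rightarrow> qop) \<Rightarrow> real \<Rightarrow> (real \<Rightarrow> qop) \<Rightarrow> bool" where
  "is_propagator n H T U \<longleftrightarrow>
     (\<forall>t\<in>{0..T}. \<forall>x\<in>basis n. \<forall>y\<in>basis n.
        ((\<lambda>s. mmul n (H s) (U s) x y) has_integral (\<i> * (U t x y - idop x y))) {0..t})"

definition plus_state :: "nat \<Rightarrow> qstate" where
  "plus_state n = (\<lambda>x. if x \<in> basis n then complex_of_real (1 / sqrt (2 ^ n)) else 0)"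

definition neg_expect :: "nat \<Rightarrow> qop \<Rightarrow> qstate \<Rightarrow> real" where
  "neg_expect n A \<psi> = - Re (\<Sum>x\<in>basis n. \<Sum>y\<in>basis n. cnj (\<psi> x) * A x y * \<psi> y)"

end

(*
  Write z_i for the vertex spins and M_ij = <psi_T| Z_i Z_j |psi_T>, so that the expected cut is
  Delta n / 4 - (1/2) sum_E M_ij.  In the Heisenberg picture M is the Gram matrix of the vectors
  a_i = U^* Z_i U |+...+>.  Expand a_i in the eigenbasis of the X operators, with coefficients
  a_i(S) for sets S of flipped vertices.  A Lieb-Robinson bound shows that a_i(S) is negligible
  unless S lies in the ball of radius r ~ log n / (5 log Delta) around i, and the global spin flip
  symmetry gives a_i({}) = 0.  Hence for fixed S, containing some vertex s, the function
  i |-> a_i(S) lives on the ball of radius r around s.  If that ball is a tree, its adjacency form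
  is at least -2 sqrt(Delta), and summing over S gives sum_E M_ij >= -sqrt(Delta) n.  A switching
  argument bounds the average number of vertices near a short cycle by o(n).
  Small Delta is covered by the trivial bound Delta n / 2.
*)
theory Submission
  imports Defs "HOL-Real_Asymp.Real_Asymp"
begin

section \<open>Products of indefinite integrals\<close>


text \<open>A Delta-regular bipartite graph has adjacency eigenvalue -Delta, so no global spectral
  bound can yield the leading term Delta/4; only functions confined to small balls are under
  control. A nonempty layer S provides the centre of such a ball, the empty layer does not, and this
  is why it has to vanish by symmetry. The evolution is given by an integral equation with a control
  of low regularity, so U need not be differentiable everywhere and the equations of motion stay in
  integral form. The 5 in the radius balances two errors. Since 1 + 4/kappa >= 5, the weight of a_i
  on sets containing one given vertex outside the ball is at most n^(-6/5); summed over n vertices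
  and after a square root, n^(-1/10) remains. On the other side, the ball size (Delta+1)^r times the
  average number of non-treelike vertices, about (4 Delta)^(2r), stays below Delta^(4r) <= n^(4/5),
  up to constants and logarithms. The latter is safe from Delta = 32 on; the case split is at 64,
  where Delta/2 = Delta/4 + 2 sqrt(Delta).\<close>

lemma constant_of_quadratic_increments:
  fixes \<Phi> :: "real \<Rightarrow> complex"
  assumes inc: "\<And>s t. 0 \<le> s \<Longrightarrow> s \<le> t \<Longrightarrow> t \<le> T \<Longrightarrow> norm (\<Phi> t - \<Phi> s) \<le> C * (t - s)^2"
    and t: "t \<in> {0..T}"
  shows "\<Phi> t = \<Phi> 0"
proof -
  have inc': "norm (\<Phi> y - \<Phi> x) \<le> C * norm (y - x)^2" if "x \<in> {0..T}" "y \<in> {0..T}" for x y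
  proof (cases "x \<le> y")
    case True then show ?thesis using inc[of x y] that by auto
  next
    case False then show ?thesis using inc[of y x] that
      by (simp add: norm_minus_commute power2_commute)
  qed
  have "(\<Phi> has_derivative (\<lambda>h. 0)) (at x within {0..T})" if x: "x \<in> {0..T}" for x
    unfolding has_derivative_within_alt
  proof (intro conjI allI impI)
    show "bounded_linear (\<lambda>h::real. 0::complex)" by simp
    fix e :: real assume e: "e > 0"
    show "\<exists>d>0. \<forall>y\<in>{0..T}. norm (y - x) < d \<longrightarrow> norm (\<Phi> y - \<Phi> x - 0) \<le> e * norm (y - x)"
    \<comment> \<open>\<open>C\<close> may be zero or negative, hence the absolute value and the
      added 1.\<close>
    proof (intro exI[of _ "e / (\<bar>C\<bar> + 1)"] conjI ballI impI)
      show "0 < e / (\<bar>C\<bar> + 1)" using e by simp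
      fix y assume y: "y \<in> {0..T}" "norm (y - x) < e / (\<bar>C\<bar> + 1)"
      have "norm (y - x) * (\<bar>C\<bar> + 1) \<le> e"
        using y(2) by (simp add: pos_less_divide_eq)
      then have "norm (y - x) * (norm (y - x) * (\<bar>C\<bar> + 1)) \<le> norm (y - x) * e"
        by (intro mult_left_mono) auto
      moreover have "C * norm (y - x)^2 \<le> norm (y - x) * (norm (y - x) * (\<bar>C\<bar> + 1))"
      proof -
        have "C * d^2 \<le> d * (d * (\<bar>C\<bar> + 1))" for d :: real
          using mult_right_mono[of C "\<bar>C\<bar> + 1" "d^2"] by (simp add: power2_eq_square mult_ac)
        then show ?thesis .
      qed
      ultimately show "norm (\<Phi> y - \<Phi> x - 0) \<le> e * norm (y - x)"
        using inc'[OF x y(1)] by (simp only: diff_zero mult.commute[of e])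
    qed
  qed
  then have "\<exists>c. \<forall>x\<in>{0..T}. \<Phi> x = c"
    by (intro has_derivative_zero_constant) auto
  then obtain c where "\<And>x. x \<in> {0..T} \<Longrightarrow> \<Phi> x = c" by blast
  then show ?thesis using t by (metis atLeastAtMost_iff order_trans order_refl)
qed

lemma continuous_on_indefinite_integral:
  fixes h H :: "real \<Rightarrow> complex"
  assumes h: "\<And>t. t \<in> {0..T} \<Longrightarrow> (h has_integral (H t - H 0)) {0..t}"
  shows "continuous_on {0..T} H"
proof (cases "0 \<le> T")
  case True
  then have "h integrable_on {0..T}" using h[of T] by (auto simp: has_integral_integrable)
  then have "continuous_on {0..T} (\<lambda>x. H 0 + integral {0..x} h)"
    by (intro continuous_intros indefinite_integral_continuous_1)
  moreover have "H 0 + integral {0..x} h = H x" if "x \<in> {0..T}" for x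
    using integral_unique[OF h[OF that]] by simp
  ultimately show ?thesis
    using continuous_on_cong[of "{0..T}" "{0..T}" "\<lambda>x. H 0 + integral {0..x} h" H] by simp
qed simp

text \<open>\<open>F\<close> and \<open>G\<close> are Lipschitz but need not be differentiable at
  every point, so derivatives are avoided. Freezing \<open>F\<close> and \<open>G\<close> at the
  left end of [x, y] changes the integral of the claimed integrand by O((y - x)^2), and so does
  neglecting the product of the two increments. Hence \<open>F * G\<close> minus the integral has
  quadratic increments and is constant.\<close>

lemma has_integral_product_rule:
  fixes f g F G :: "real \<Rightarrow> complex"
  assumes f: "\<And>t. t \<in> {0..T} \<Longrightarrow> (f has_integral (F t - F 0)) {0..t}"
    and g: "\<And>t. t \<in> {0..T} \<Longrightarrow> (g has_integral (G t - G 0)) {0..t}"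
    and fb: "\<And>t. t \<in> {0..T} \<Longrightarrow> norm (f t) \<le> K"
    and gb: "\<And>t. t \<in> {0..T} \<Longrightarrow> norm (g t) \<le> K"
    and t: "t \<in> {0..T}"
  shows "((\<lambda>s. f s * G s + F s * g s) has_integral (F t * G t - F 0 * G 0)) {0..t}"
proof -
  have T: "0 \<le> T" using t by auto
  have K: "0 \<le> K" using fb[of t] t norm_ge_zero order_trans by blast
  have sub: "(h has_integral (H y - H x)) {x..y}"
    if h: "\<And>t. t \<in> {0..T} \<Longrightarrow> (h has_integral (H t - H 0)) {0..t}"
      and xy: "0 \<le> x" "x \<le> y" "y \<le> T" for h H :: "real \<Rightarrow> complex" and x y
  proof -
    have i: "h integrable_on {0..y}" using h[of y] xy by (auto simp: has_integral_integrable)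
    have "integral {0..x} h + integral {x..y} h = integral {0..y} h"
      using i xy by (intro Henstock_Kurzweil_Integration.integral_combine) auto
    moreover have "integral {0..x} h = H x - H 0" "integral {0..y} h = H y - H 0"
      using integral_unique[OF h[of x]] integral_unique[OF h[of y]] xy by auto
    ultimately have "integral {x..y} h = H y - H x" by (simp add: algebra_simps)
    moreover have "h integrable_on {x..y}"
      using integrable_on_subinterval[OF i, of x y] xy by auto
    ultimately show ?thesis by (simp add: has_integral_iff)
  qed
  have lip: "norm (H y - H x) \<le> K * (y - x)"
    if h: "\<And>t. t \<in> {0..T} \<Longrightarrow> (h has_integral (H t - H 0)) {0..t}"
      and hb: "\<And>t. t \<in> {0..T} \<Longrightarrow> norm (h t) \<le> K"
      and xy: "0 \<le> x" "x \<le> y" "y \<le> T" for h H :: "real \<Rightarrow> complex" and x y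
    using has_integral_bound_real[OF K, of "{}" h "H y - H x" x y] sub[OF h xy] hb xy by auto
  \<comment> \<open>A gauge-integrable function times a continuous one need not be integrable.
    Boundedness makes \<open>h\<close> absolutely integrable, and then the product is
    harmless.\<close>
  have prod: "(\<lambda>s. h s * L s) integrable_on {0..T}"
    if h: "h integrable_on {0..T}" and hb: "\<And>t. t \<in> {0..T} \<Longrightarrow> norm (h t) \<le> K"
      and L: "continuous_on {0..T} L" for h L :: "real \<Rightarrow> complex"
  proof -
    have "h absolutely_integrable_on {0..T}"
      using h hb by (intro absolutely_integrable_integrable_bound[of _ _ "\<lambda>_. K"]) auto
    moreover have "L \<in> borel_measurable (lebesgue_on {0..T})"
      using L by (intro continuous_imp_measurable_on_sets_lebesgue) auto
    moreover have "bounded (L ` {0..T})"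
      using L by (intro compact_imp_bounded compact_continuous_image) auto
    ultimately have "(\<lambda>s. L s * h s) absolutely_integrable_on {0..T}"
      by (intro absolutely_integrable_bounded_measurable_product[where h="(*)"])
        (simp_all add: bilinear_conv_bounded_bilinear[symmetric] bounded_bilinear_mult bilinear_times)
    then show ?thesis
      using set_lebesgue_integral_eq_integral(1) by (simp add: mult.commute)
  qed
  have Fc: "continuous_on {0..T} F" and Gc: "continuous_on {0..T} G"
    using continuous_on_indefinite_integral[OF f] continuous_on_indefinite_integral[OF g] by auto
  define k where "k = (\<lambda>s. f s * G s + F s * g s)"
  have fi: "f integrable_on {0..T}" and gi: "g integrable_on {0..T}"
    using f[of T] g[of T] T by (auto simp: has_integral_integrable)
  have ki: "k integrable_on {0..T}"
    unfolding k_def using prod[OF fi fb Gc] prod[OF gi gb Fc]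
    by (intro integrable_add) (auto simp: mult.commute)
  define \<Phi> where "\<Phi> = (\<lambda>t. F t * G t - integral {0..t} k)"
  have "norm (\<Phi> y - \<Phi> x) \<le> (3 * K * K) * (y - x)^2" if xy: "0 \<le> x" "x \<le> y" "y \<le> T" for x y
  proof -
    have kxy: "k integrable_on {x..y}" "k integrable_on {0..y}"
      using integrable_on_subinterval[OF ki] xy by auto
    have ik: "integral {0..y} k - integral {0..x} k = integral {x..y} k"
      using Henstock_Kurzweil_Integration.integral_combine[of 0 x y k] kxy xy by (auto simp: algebra_simps)
    have "((\<lambda>s. f s * G x + F x * g s) has_integral (F y - F x) * G x + F x * (G y - G x)) {x..y}"
      using sub[OF f xy] sub[OF g xy]
      by (intro has_integral_add has_integral_mult_left has_integral_mult_right)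
    then have "((\<lambda>s. k s - (f s * G x + F x * g s)) has_integral
        (integral {x..y} k - ((F y - F x) * G x + F x * (G y - G x)))) {x..y}"
      using kxy(1) by (intro has_integral_diff) auto
    moreover have "norm (k s - (f s * G x + F x * g s)) \<le> 2 * K * (K * (y - x))" if s: "s \<in> {x..y}" for s
    proof -
      have "k s - (f s * G x + F x * g s) = f s * (G s - G x) + (F s - F x) * g s"
        by (simp add: k_def algebra_simps)
      also have "norm \<dots> \<le> norm (f s) * norm (G s - G x) + norm (F s - F x) * norm (g s)"
        by (metis norm_mult norm_triangle_ineq)
      also have "\<dots> \<le> K * (K * (s - x)) + (K * (s - x)) * K"
        using lip[OF f fb, of x s] lip[OF g gb, of x s] fb[of s] gb[of s] s xy K
        by (intro add_mono mult_mono) auto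
      also have "\<dots> \<le> K * (K * (y - x)) + (K * (y - x)) * K"
        using s K by (intro add_mono mult_mono mult_left_mono) auto
      finally show ?thesis by (simp add: algebra_simps)
    qed
    ultimately have 1: "norm (integral {x..y} k - ((F y - F x) * G x + F x * (G y - G x)))
        \<le> 2 * K * (K * (y - x)) * (y - x)"
      using has_integral_bound_real[of "2 * K * (K * (y - x))" "{}" "\<lambda>s. k s - (f s * G x + F x * g s)" _ x y] K xy
      by auto
    have 2: "norm ((F y - F x) * (G y - G x)) \<le> (K * (y - x)) * (K * (y - x))"
      unfolding norm_mult using lip[OF f fb xy] lip[OF g gb xy] by (intro mult_mono) (use K xy in auto)
    have "\<Phi> y - \<Phi> x = (F y - F x) * (G y - G x) - (integral {x..y} k - ((F y - F x) * G x + F x * (G y - G x)))"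
      unfolding \<Phi>_def ik[symmetric] by (simp add: algebra_simps)
    also have "norm \<dots> \<le> (K * (y - x)) * (K * (y - x)) + 2 * K * (K * (y - x)) * (y - x)"
      by (rule order_trans[OF norm_triangle_ineq4 add_mono[OF 2 1]])
    also have "\<dots> = (3 * K * K) * (y - x)^2" by (simp add: power2_eq_square algebra_simps)
    finally show ?thesis .
  qed
  then have "\<Phi> t = \<Phi> 0" using constant_of_quadratic_increments[of T \<Phi> "3 * K * K" t] t by auto
  then have "integral {0..t} k = F t * G t - F 0 * G 0" unfolding \<Phi>_def by (simp add: algebra_simps)
  moreover have "k integrable_on {0..t}" using t
    using integrable_on_subinterval[OF ki, of 0 t] by auto
  ultimately show ?thesis unfolding k_def[symmetric] by (simp add: has_integral_iff)
qed

section \<open>States and Pauli operators\<close>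


definition inn :: "nat \<Rightarrow> qstate \<Rightarrow> qstate \<Rightarrow> complex" where
  "inn n \<phi> \<psi> = (\<Sum>x\<in>basis n. cnj (\<phi> x) * \<psi> x)"

definition nrm :: "nat \<Rightarrow> qstate \<Rightarrow> real" where
  "nrm n \<psi> = L2_set (\<lambda>x. cmod (\<psi> x)) (basis n)"

definition zs :: "nat \<Rightarrow> nat set \<Rightarrow> complex" where
  "zs k x = (if k \<in> x then -1 else 1)"

definition flip :: "nat \<Rightarrow> nat set \<Rightarrow> nat set" where
  "flip k x = (if k \<in> x then x - {k} else insert k x)"

definition opZ :: "nat \<Rightarrow> qstate \<Rightarrow> qstate" where
  "opZ k \<psi> = (\<lambda>x. zs k x * \<psi> x)"

definition opX :: "nat \<Rightarrow> qstate \<Rightarrow> qstate" where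
  "opX k \<psi> = (\<lambda>x. \<psi> (flip k x))"

lemma finite_basis [simp]: "finite (basis n)"
  by (simp add: basis_def)

lemma card_basis: "card (basis n) = 2 ^ n"
  by (simp add: basis_def card_Pow)

lemma flip_flip [simp]: "flip k (flip k x) = x"
  by (auto simp: flip_def)

lemma flip_commute: "flip k (flip l x) = flip l (flip k x)"
  by (auto simp: flip_def)

lemma flip_in_basis [simp]: "k < n \<Longrightarrow> flip k x \<in> basis n \<longleftrightarrow> x \<in> basis n"
  by (auto simp: flip_def basis_def)

lemma zs_flip: "zs k (flip l x) = (if k = l then - zs k x else zs k x)"
proof -
  have "k \<in> flip l x \<longleftrightarrow> (if k = l then k \<notin> x else k \<in> x)"
    by (auto simp: flip_def)
  then show ?thesis by (cases "k \<in> x") (simp_all add: zs_def)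
qed

lemma zs_square [simp]: "zs k x * zs k x = 1" "zs k x * (zs k x * c) = c"
  by (auto simp: zs_def)

lemma cnj_zs [simp]: "cnj (zs k x) = zs k x"
  by (simp add: zs_def)

lemma sum_flip:
  assumes "k < n"
  shows "(\<Sum>x\<in>basis n. f (flip k x)) = (\<Sum>x\<in>basis n. f x)"
  by (rule sum.reindex_bij_witness[of _ "flip k" "flip k"]) (use assms in auto)

lemma inn_cong:
  "(\<And>x. x \<in> basis n \<Longrightarrow> \<phi> x = \<phi>' x) \<Longrightarrow> (\<And>x. x \<in> basis n \<Longrightarrow> \<psi> x = \<psi>' x)
    \<Longrightarrow> inn n \<phi> \<psi> = inn n \<phi>' \<psi>'"
  by (simp add: inn_def)

lemma nrm_cong: "(\<And>x. x \<in> basis n \<Longrightarrow> \<phi> x = \<phi>' x) \<Longrightarrow> nrm n \<phi> = nrm n \<phi>'"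
  by (simp add: nrm_def cong: L2_set_cong)

lemma inn_self: "inn n \<psi> \<psi> = of_real ((nrm n \<psi>)\<^sup>2)"
  by (simp add: inn_def nrm_def L2_set_def sum_nonneg complex_norm_square mult.commute del: of_real_power)

lemma nrm_nonneg [simp]: "0 \<le> nrm n \<psi>"
  by (simp add: nrm_def)

lemma nrm_eq_of_inn: "inn n \<phi> \<phi> = inn n \<psi> \<psi> \<Longrightarrow> nrm n \<phi> = nrm n \<psi>"
  unfolding inn_self of_real_eq_iff by (simp add: power2_eq_iff_nonneg)

lemma inn_cauchy_schwarz: "cmod (inn n \<phi> \<psi>) \<le> nrm n \<phi> * nrm n \<psi>"
proof -
  have "cmod (inn n \<phi> \<psi>) \<le> (\<Sum>x\<in>basis n. \<bar>cmod (\<phi> x)\<bar> * \<bar>cmod (\<psi> x)\<bar>)"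
    unfolding inn_def by (rule order_trans[OF norm_sum]) (simp add: norm_mult)
  also have "\<dots> \<le> nrm n \<phi> * nrm n \<psi>"
    unfolding nrm_def by (rule L2_set_mult_ineq)
  finally show ?thesis .
qed

lemma inn_diff_right: "inn n \<phi> (\<lambda>x. \<psi> x - \<xi> x) = inn n \<phi> \<psi> - inn n \<phi> \<xi>"
  by (simp add: inn_def right_diff_distrib sum_subtractf)

lemma inn_scale_right: "inn n \<phi> (\<lambda>x. c * \<psi> x) = c * inn n \<phi> \<psi>"
  by (simp add: inn_def sum_distrib_left mult_ac)

lemma inn_sum_right: "inn n \<phi> (\<lambda>x. \<Sum>j\<in>J. \<psi> j x) = (\<Sum>j\<in>J. inn n \<phi> (\<psi> j))"
  unfolding inn_def sum_distrib_left by (rule sum.swap)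

text \<open>Self-adjoint isometries are the common shape of the Pauli operators, so the commutator
  estimates can treat Z and X at once.\<close>

definition reflection :: "nat \<Rightarrow> (qstate \<Rightarrow> qstate) \<Rightarrow> bool" where
  "reflection n A \<longleftrightarrow> (\<forall>\<phi> \<psi>. inn n \<phi> (A \<psi>) = inn n (A \<phi>) \<psi>) \<and> (\<forall>\<psi>. nrm n (A \<psi>) = nrm n \<psi>)"

lemma opZ_opZ [simp]: "opZ k (opZ k \<psi>) = \<psi>"
  by (simp add: opZ_def fun_eq_iff)

lemma opX_opX [simp]: "opX k (opX k \<psi>) = \<psi>"
  by (simp add: opX_def fun_eq_iff)

lemma reflection_opZ: "reflection n (opZ k)"
proof -
  have *: "inn n \<phi> (opZ k \<psi>) = inn n (opZ k \<phi>) \<psi>" for \<phi> \<psi>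
    by (simp add: inn_def opZ_def mult_ac)
  show ?thesis
    unfolding reflection_def
    by (intro conjI allI * nrm_eq_of_inn) (simp add: *[symmetric])
qed

lemma reflection_opX:
  assumes "k < n"
  shows "reflection n (opX k)"
proof -
  have *: "inn n \<phi> (opX k \<psi>) = inn n (opX k \<phi>) \<psi>" for \<phi> \<psi>
    unfolding inn_def opX_def using sum_flip[OF assms, of "\<lambda>x. cnj (\<phi> x) * \<psi> (flip k x)"] by simp
  show ?thesis
    unfolding reflection_def
    by (intro conjI allI * nrm_eq_of_inn) (simp add: *[symmetric])
qed

text \<open>The trace of the projection \<open>U U\<^sup>*\<close> equals the dimension, so it is the identity.\<close>
lemma isometry_imp_coisometry:
  fixes U :: "'a \<Rightarrow> 'a \<Rightarrow> complex"
  assumes fin: "finite B"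
    and iso: "\<And>z w. z \<in> B \<Longrightarrow> w \<in> B \<Longrightarrow> (\<Sum>x\<in>B. cnj (U x z) * U x w) = (if z = w then 1 else 0)"
    and x: "x \<in> B" and y: "y \<in> B"
  shows "(\<Sum>z\<in>B. U x z * cnj (U y z)) = (if x = y then 1 else 0)"
proof -
  define P where "P = (\<lambda>x y. \<Sum>z\<in>B. U x z * cnj (U y z))"
  let ?d = "\<lambda>x y. if x = y then 1 else (0::complex)"
  have cP: "cnj (P x y) = P y x" for x y
    by (simp add: P_def mult.commute)
  have tr: "(\<Sum>x\<in>B. P x x) = of_nat (card B)"
  proof -
    have "(\<Sum>x\<in>B. P x x) = (\<Sum>z\<in>B. \<Sum>x\<in>B. cnj (U x z) * U x z)"
      unfolding P_def by (subst sum.swap) (simp add: mult.commute)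
    then show ?thesis by (simp add: iso)
  qed
  \<comment> \<open>\<open>P\<close> is idempotent: the sum over \<open>y\<close> produces an entry
    of the adjoint of \<open>U\<close> times \<open>U\<close>.\<close>
  have PP: "(\<Sum>x\<in>B. \<Sum>y\<in>B. P x y * P y x) = of_nat (card B)"
  proof -
    have "(\<Sum>y\<in>B. P x y * P y x) = P x x" for x
    proof -
      have "(\<Sum>y\<in>B. P x y * P y x) = (\<Sum>y\<in>B. \<Sum>z\<in>B. \<Sum>w\<in>B. U x z * cnj (U x w) * (cnj (U y z) * U y w))"
        unfolding P_def sum_product by (simp add: mult_ac)
      also have "\<dots> = (\<Sum>z\<in>B. \<Sum>y\<in>B. \<Sum>w\<in>B. U x z * cnj (U x w) * (cnj (U y z) * U y w))"
        by (rule sum.swap)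
      also have "\<dots> = (\<Sum>z\<in>B. \<Sum>w\<in>B. \<Sum>y\<in>B. U x z * cnj (U x w) * (cnj (U y z) * U y w))"
        by (rule sum.cong[OF refl], rule sum.swap)
      also have "\<dots> = (\<Sum>z\<in>B. \<Sum>w\<in>B. U x z * cnj (U x w) * ?d z w)"
        by (intro sum.cong refl) (simp add: sum_distrib_left[symmetric] iso)
      also have "\<dots> = P x x"
        unfolding P_def using fin by (simp add: if_distrib cong: if_cong)
      finally show ?thesis .
    qed
    then show ?thesis by (simp add: tr)
  qed
  \<comment> \<open>The squared Hilbert-Schmidt norm of P - I expands into four traces, all equal to
    the dimension, which cancel.\<close>
  have "(\<Sum>x\<in>B. \<Sum>y\<in>B. (P x y - ?d x y) * cnj (P x y - ?d x y)) =
     (\<Sum>x\<in>B. \<Sum>y\<in>B. P x y * P y x) - (\<Sum>x\<in>B. \<Sum>y\<in>B. P x y * ?d x y)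
     - (\<Sum>x\<in>B. \<Sum>y\<in>B. ?d x y * P y x) + (\<Sum>x\<in>B. \<Sum>y\<in>B. ?d x y)"
    unfolding sum_subtractf[symmetric] sum.distrib[symmetric]
    by (intro sum.cong refl) (auto simp: cP algebra_simps)
  also have "\<dots> = 0"
    using fin by (simp add: PP tr if_distrib if_distribR cong: if_cong)
  finally have "(\<Sum>x\<in>B. \<Sum>y\<in>B. complex_of_real ((cmod (P x y - ?d x y))\<^sup>2)) = 0"
    by (simp only: complex_norm_square)
  then have "(\<Sum>x\<in>B. \<Sum>y\<in>B. (cmod (P x y - ?d x y))\<^sup>2) = 0"
    unfolding of_real_sum[symmetric] by (simp only: of_real_eq_0_iff)
  then have "(cmod (P x y - ?d x y))\<^sup>2 = 0"
    using fin x y by (simp add: sum_nonneg_eq_0_iff sum_nonneg)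
  then show ?thesis by (simp add: P_def)
qed

section \<open>Evolution in the Heisenberg picture\<close>


definition neigh :: "(nat \<times> nat) set \<Rightarrow> nat \<Rightarrow> nat set" where
  "neigh E i = {j. (i, j) \<in> E \<or> (j, i) \<in> E}"

text \<open>The number of edges cut by \<open>x\<close>, which is the eigenvalue of
  \<open>- costH n E\<close> at that basis state; complex so that it can multiply
  amplitudes.\<close>

definition cutv :: "(nat \<times> nat) set \<Rightarrow> nat set \<Rightarrow> complex" where
  "cutv E x = (\<Sum>(i,j)\<in>E. (1 - zs i x * zs j x) / 2)"

lemma finite_is_graph: "is_graph n E \<Longrightarrow> finite E"
  by (rule finite_subset[of _ "{..<n} \<times> {..<n}"]) (auto simp: is_graph_def)

lemma cnj_cutv [simp]: "cnj (cutv E x) = cutv E x"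
  by (simp add: cutv_def case_prod_beta)

lemma is_graph_bounds: "is_graph n E \<Longrightarrow> (i, j) \<in> E \<Longrightarrow> i < j \<and> i < n \<and> j < n"
  by (auto simp: is_graph_def)

lemma neigh_less: "is_graph n E \<Longrightarrow> j \<in> neigh E i \<Longrightarrow> j < n \<and> j \<noteq> i"
  by (auto simp: neigh_def dest: is_graph_bounds)

lemma finite_neigh: "is_graph n E \<Longrightarrow> finite (neigh E i)"
  by (rule finite_subset[of _ "{..<n}"]) (auto dest: neigh_less)

text \<open>Links the storage of an edge as one ordered pair with the symmetric neighbourhoods: an
  edge at \<open>i\<close> is determined by its other end.\<close>

lemma sum_incident_edges:
  assumes g: "is_graph n E"
  shows "(\<Sum>(a,b)\<in>{(a,b)\<in>E. a = i \<or> b = i}. f a b) = (\<Sum>j\<in>neigh E i. f (min i j) (max i j))"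
proof (rule sum.reindex_bij_witness[of _ "\<lambda>j. (min i j, max i j)" "\<lambda>(a,b). if a = i then b else a"], goal_cases)
  case (1 e) then show ?case using is_graph_bounds[OF g] by (fastforce simp: min_def max_def split: if_splits)
next
  case (2 e) then show ?case by (auto simp: neigh_def)
next
  case (3 j) then show ?case using neigh_less[OF g] by (auto simp: min_def max_def)
next
  case (4 j) then show ?case using is_graph_bounds[OF g] by (auto simp: neigh_def min_def max_def; fastforce)
next
  case (5 e) then show ?case using is_graph_bounds[OF g] by (fastforce simp: min_def max_def split: if_splits)
qed

lemma card_neigh: "is_graph n E \<Longrightarrow> card (neigh E i) = degree E i"
  using sum_incident_edges[of n E "\<lambda>_ _. 1::nat" i] by (simp add: degree_def)

text \<open>Only edges at \<open>i\<close> change status, and such an edge then contributes (1 + z_i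
  z_j)/2 instead of (1 - z_i z_j)/2. The right-hand side is what survives in the commutator of the
  cost with X_i.\<close>

lemma cutv_flip:
  assumes g: "is_graph n E"
  shows "cutv E (flip i x) - cutv E x = (\<Sum>j\<in>neigh E i. zs j x * zs i x)"
proof -
  have fin: "finite E" using finite_is_graph[OF g] .
  have "cutv E (flip i x) - cutv E x = (\<Sum>(a,b)\<in>E. (zs a x * zs b x - zs a (flip i x) * zs b (flip i x)) / 2)"
    unfolding cutv_def sum_subtractf[symmetric] by (intro sum.cong refl) (auto simp: field_simps)
  also have "\<dots> = (\<Sum>(a,b)\<in>E. if a = i \<or> b = i then zs a x * zs b x else 0)"
    by (intro sum.cong refl) (auto simp: zs_flip dest: is_graph_bounds[OF g])
  also have "\<dots> = (\<Sum>e\<in>E. if fst e = i \<or> snd e = i then zs (fst e) x * zs (snd e) x else 0)"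
    by (simp add: case_prod_beta)
  also have "\<dots> = (\<Sum>(a,b)\<in>{(a,b)\<in>E. a = i \<or> b = i}. zs a x * zs b x)"
    unfolding sum.inter_filter[OF fin, symmetric] by (intro sum.cong) auto
  also have "\<dots> = (\<Sum>j\<in>neigh E i. zs (min i j) x * zs (max i j) x)"
    by (rule sum_incident_edges[OF g])
  also have "\<dots> = (\<Sum>j\<in>neigh E i. zs j x * zs i x)"
    by (intro sum.cong refl) (auto simp: min_def max_def)
  finally show ?thesis .
qed

lemma costH_apply:
  assumes "is_graph n E" "x \<in> basis n"
  shows "(\<Sum>z\<in>basis n. costH n E x z * \<psi> z) = - cutv E x * \<psi> x"
proof -
  have *: "costH n E x z = (if x = z then - cutv E x else 0)" if z: "z \<in> basis n" for z
  proof -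
    have "mmul n (pauliZ i) (pauliZ j) x z = (if x = z then zs i x * zs j x else 0)" for i j
    proof -
      have "mmul n (pauliZ i) (pauliZ j) x z = (\<Sum>w\<in>basis n. if w = x then pauliZ i x x * pauliZ j x z else 0)"
        unfolding mmul_def by (intro sum.cong refl) (simp add: pauliZ_def)
      then show ?thesis using assms(2) by (simp add: pauliZ_def zs_def)
    qed
    then show ?thesis
      by (auto simp: costH_def cutv_def idop_def sum_divide_distrib case_prod_beta sum_distrib_left sum_negf[symmetric])
  qed
  have "(\<Sum>z\<in>basis n. costH n E x z * \<psi> z) = (\<Sum>z\<in>basis n. if z = x then - cutv E x * \<psi> x else 0)"
    by (intro sum.cong refl) (simp add: *)
  then show ?thesis using assms(2) by simp
qed

lemma mixH_apply:
  assumes "x \<in> basis n"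
  shows "(\<Sum>z\<in>basis n. mixH n x z * \<psi> z) = - (\<Sum>k<n. \<psi> (flip k x))"
proof -
  have "(\<Sum>z\<in>basis n. mixH n x z * \<psi> z) = - (\<Sum>k<n. \<Sum>z\<in>basis n. pauliX k x z * \<psi> z)"
    unfolding mixH_def by (subst sum.swap) (simp add: sum_distrib_right sum_negf)
  also have "(\<Sum>k<n. \<Sum>z\<in>basis n. pauliX k x z * \<psi> z) = (\<Sum>k<n. \<psi> (flip k x))"
  proof (rule sum.cong[OF refl])
    fix k assume "k \<in> {..<n}"
    then have k: "k < n" by simp
    have "(\<Sum>z\<in>basis n. pauliX k x z * \<psi> z) = (\<Sum>z\<in>basis n. if z = flip k x then \<psi> (flip k x) else 0)"
      by (intro sum.cong refl) (auto simp: pauliX_def flip_def)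
    then show "(\<Sum>z\<in>basis n. pauliX k x z * \<psi> z) = \<psi> (flip k x)" using assms k by simp
  qed
  finally show ?thesis .
qed

section \<open>The evolution on a fixed graph, in integral form\<close>

locale annealing =
  fixes n :: nat and E :: "(nat \<times> nat) set" and u :: "real \<Rightarrow> real" and T :: real and U :: "real \<Rightarrow> qop"
  assumes graph: "is_graph n E"
    and T_pos: "0 < T"
    and u_bounds: "\<And>t. t \<in> {0..T} \<Longrightarrow> 0 \<le> u t \<and> u t \<le> 1"
    and propagator: "is_propagator n (annealH n E u) T U"
begin

definition ev :: "real \<Rightarrow> qstate \<Rightarrow> qstate" where
  "ev t \<psi> = apply_op n (U t) \<psi>"

definition ham :: "real \<Rightarrow> qstate \<Rightarrow> qstate" where
  "ham s \<psi> = (\<lambda>x. - of_real (1 - u s) * (\<Sum>k<n. \<psi> (flip k x)) - of_real (u s) * cutv E x * \<psi> x)"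

lemma ham_ev:
  assumes "x \<in> basis n"
  shows "(\<Sum>y\<in>basis n. mmul n (annealH n E u s) (U s) x y * \<psi> y) = ham s (ev s \<psi>) x"
proof -
  have "(\<Sum>y\<in>basis n. mmul n (annealH n E u s) (U s) x y * \<psi> y)
      = (\<Sum>z\<in>basis n. annealH n E u s x z * ev s \<psi> z)"
    unfolding mmul_def ev_def apply_op_def sum_distrib_left sum_distrib_right
    by (subst sum.swap) (simp add: mult_ac)
  also have "\<dots> = of_real (1 - u s) * (\<Sum>z\<in>basis n. mixH n x z * ev s \<psi> z)
      + of_real (u s) * (\<Sum>z\<in>basis n. costH n E x z * ev s \<psi> z)"
    unfolding annealH_def sum_distrib_left sum.distrib[symmetric]
    by (intro sum.cong refl) (simp add: algebra_simps)
  also have "\<dots> = ham s (ev s \<psi>) x"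
    unfolding mixH_apply[OF assms] costH_apply[OF graph assms] ham_def by (simp add: algebra_simps)
  finally show ?thesis .
qed

lemma U_0:
  assumes "x \<in> basis n" "y \<in> basis n"
  shows "U 0 x y = idop x y"
proof -
  have "((\<lambda>s. mmul n (annealH n E u s) (U s) x y) has_integral (\<i> * (U 0 x y - idop x y))) {0..0}"
    by (rule propagator[unfolded is_propagator_def, rule_format]) (use assms T_pos in auto)
  moreover have "((\<lambda>s. mmul n (annealH n E u s) (U s) x y) has_integral 0) {0..0}"
    by (simp add: has_integral_refl(2))
  ultimately have "\<i> * (U 0 x y - idop x y) = 0"
    by (rule has_integral_unique)
  then show ?thesis by simp
qed

lemma ev_0: "x \<in> basis n \<Longrightarrow> ev 0 \<psi> x = \<psi> x"
  by (simp add: ev_def apply_op_def U_0 idop_def if_distrib if_distribR cong: if_cong)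

lemma ev_integral:
  assumes x: "x \<in> basis n" and t: "t \<in> {0..T}"
  shows "((\<lambda>s. - \<i> * ham s (ev s \<psi>) x) has_integral (ev t \<psi> x - ev 0 \<psi> x)) {0..t}"
proof -
  have "((\<lambda>s. \<Sum>y\<in>basis n. mmul n (annealH n E u s) (U s) x y * \<psi> y) has_integral
      (\<Sum>y\<in>basis n. (\<i> * (U t x y - idop x y)) * \<psi> y)) {0..t}"
    using propagator x t unfolding is_propagator_def
    by (intro has_integral_sum has_integral_mult_left) auto
  then have "((\<lambda>s. - \<i> * ham s (ev s \<psi>) x) has_integral
      - \<i> * (\<Sum>y\<in>basis n. (\<i> * (U t x y - idop x y)) * \<psi> y)) {0..t}"
    unfolding ham_ev[OF x] by (rule has_integral_mult_right)
  also have "- \<i> * (\<Sum>y\<in>basis n. (\<i> * (U t x y - idop x y)) * \<psi> y) = ev t \<psi> x - ev 0 \<psi> x"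
    unfolding sum_distrib_left ev_def apply_op_def sum_subtractf[symmetric]
    by (intro sum.cong refl) (simp add: U_0 x algebra_simps)
  finally show ?thesis .
qed

text \<open>Amplitudes are continuous as indefinite integrals, hence bounded on a compact interval.
  Such bounds feed the product rule.\<close>

lemma ev_bounded:
  assumes "x \<in> basis n"
  shows "\<exists>K. \<forall>t\<in>{0..T}. cmod (ev t \<psi> x) \<le> K"
proof -
  have "continuous_on {0..T} (\<lambda>t. ev t \<psi> x)"
    using ev_integral[OF assms] by (rule continuous_on_indefinite_integral)
  then have "bounded ((\<lambda>t. ev t \<psi> x) ` {0..T})"
    by (intro compact_imp_bounded compact_continuous_image) auto
  then show ?thesis unfolding bounded_iff by auto
qed

lemma ham_ev_bounded:
  assumes x: "x \<in> basis n"
  shows "\<exists>K. \<forall>t\<in>{0..T}. cmod (ham t (ev t \<psi>) x) \<le> K"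
proof -
  have "\<forall>y\<in>basis n. \<exists>K. \<forall>t\<in>{0..T}. cmod (ev t \<psi> y) \<le> K"
    using ev_bounded by blast
  from bchoice[OF this] obtain K
    where K: "\<And>y t. y \<in> basis n \<Longrightarrow> t \<in> {0..T} \<Longrightarrow> cmod (ev t \<psi> y) \<le> K y"
    by blast
  have "cmod (ham t (ev t \<psi>) x) \<le> (\<Sum>k<n. K (flip k x)) + cmod (cutv E x) * K x" if t: "t \<in> {0..T}" for t
  proof -
    have "cmod (ham t (ev t \<psi>) x) \<le> \<bar>1 - u t\<bar> * cmod (\<Sum>k<n. ev t \<psi> (flip k x)) + \<bar>u t\<bar> * (cmod (cutv E x) * cmod (ev t \<psi> x))"
      unfolding ham_def by (rule order_trans[OF norm_triangle_ineq4])
        (simp add: norm_mult mult.assoc del: of_real_diff)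
    also have "\<dots> \<le> 1 * (\<Sum>k<n. K (flip k x)) + 1 * (cmod (cutv E x) * K x)"
      using u_bounds[OF t] x K[OF _ t]
      by (intro add_mono mult_mono order_trans[OF norm_sum] sum_mono) auto
    finally show ?thesis by simp
  qed
  then show ?thesis by blast
qed

lemma ham_self_adjoint: "inn n (ham s \<phi>) \<psi> = inn n \<phi> (ham s \<psi>)"
proof -
  have 1: "(\<Sum>x\<in>basis n. cnj (\<Sum>k<n. \<phi> (flip k x)) * \<psi> x) = (\<Sum>x\<in>basis n. cnj (\<phi> x) * (\<Sum>k<n. \<psi> (flip k x)))"
  proof -
    have "(\<Sum>x\<in>basis n. cnj (\<Sum>k<n. \<phi> (flip k x)) * \<psi> x) = (\<Sum>k<n. \<Sum>x\<in>basis n. cnj (\<phi> (flip k x)) * \<psi> x)"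
      by (simp add: sum_distrib_right) (rule sum.swap)
    also have "\<dots> = (\<Sum>k<n. \<Sum>x\<in>basis n. cnj (\<phi> x) * \<psi> (flip k x))"
    proof (rule sum.cong[OF refl])
      fix k assume "k \<in> {..<n}"
      then show "(\<Sum>x\<in>basis n. cnj (\<phi> (flip k x)) * \<psi> x) = (\<Sum>x\<in>basis n. cnj (\<phi> x) * \<psi> (flip k x))"
        using sum_flip[of k n "\<lambda>x. cnj (\<phi> x) * \<psi> (flip k x)"] by simp
    qed
    also have "\<dots> = (\<Sum>x\<in>basis n. cnj (\<phi> x) * (\<Sum>k<n. \<psi> (flip k x)))"
      unfolding sum_distrib_left by (rule sum.swap)
    finally show ?thesis .
  qed
  define S where "S = (\<lambda>\<phi> x. \<Sum>k<n. \<phi> (flip k x) :: complex)"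
  have S: "(\<Sum>k<n. \<phi> (flip k x)) = S \<phi> x" for \<phi> x
    by (simp add: S_def)
  have "inn n (ham s \<phi>) \<psi> = - of_real (1 - u s) * (\<Sum>x\<in>basis n. cnj (S \<phi> x) * \<psi> x)
      - (\<Sum>x\<in>basis n. of_real (u s) * cutv E x * cnj (\<phi> x) * \<psi> x)"
    unfolding inn_def ham_def S sum_distrib_left sum_subtractf[symmetric]
    by (intro sum.cong refl) (simp add: algebra_simps)
  moreover have "inn n \<phi> (ham s \<psi>) = - of_real (1 - u s) * (\<Sum>x\<in>basis n. cnj (\<phi> x) * S \<psi> x)
      - (\<Sum>x\<in>basis n. of_real (u s) * cutv E x * cnj (\<phi> x) * \<psi> x)"
    unfolding inn_def ham_def S sum_distrib_left sum_subtractf[symmetric]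
    by (intro sum.cong refl) (simp add: algebra_simps)
  ultimately show ?thesis using 1 by (simp add: S_def)
qed

text \<open>The integrated equation d/dt (U^* Q U) = i U^* [H, Q] U, with \<open>R\<close> as the
  commutator. Operators that multiply by a weight after a substitution of basis states cover the
  identity, Z_i, X_i and the global flip; for them each summand of the inner product is a product of
  two single amplitudes, to which the product rule applies.\<close>

lemma heisenberg:
  assumes g: "\<And>x. x \<in> basis n \<Longrightarrow> g x \<in> basis n"
    and Q: "\<And>\<psi>. Q \<psi> = (\<lambda>x. w x * \<psi> (g x))"
    and comm: "\<And>s x \<psi>. s \<in> {0..T} \<Longrightarrow> x \<in> basis n \<Longrightarrow> ham s (Q \<psi>) x - Q (ham s \<psi>) x = R s \<psi> x"
    and t: "t \<in> {0..T}"
  shows "((\<lambda>s. \<i> * inn n (ev s \<phi>) (R s (ev s \<psi>))) has_integral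
      (inn n (ev t \<phi>) (Q (ev t \<psi>)) - inn n (ev 0 \<phi>) (Q (ev 0 \<psi>)))) {0..t}"
proof -
  have "((\<lambda>s. (\<i> * cnj (ham s (ev s \<phi>) x)) * Q (ev s \<psi>) x + cnj (ev s \<phi> x) * (w x * (- \<i> * ham s (ev s \<psi>) (g x))))
      has_integral (cnj (ev t \<phi> x) * Q (ev t \<psi>) x - cnj (ev 0 \<phi> x) * Q (ev 0 \<psi>) x)) {0..t}"
    if x: "x \<in> basis n" for x
  proof -
    obtain K1 where K1: "\<And>t. t \<in> {0..T} \<Longrightarrow> cmod (ham t (ev t \<phi>) x) \<le> K1"
      using ham_ev_bounded[OF x] by blast
    obtain K2 where K2: "\<And>t. t \<in> {0..T} \<Longrightarrow> cmod (ham t (ev t \<psi>) (g x)) \<le> K2"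
      using ham_ev_bounded[OF g[OF x]] by blast
    show ?thesis
    proof (rule has_integral_product_rule[OF _ _ _ _ t, where K = "max K1 (cmod (w x) * K2)"])
      fix t assume t: "t \<in> {0..T}"
      have "((\<lambda>s. cnj (- \<i> * ham s (ev s \<phi>) x)) has_integral cnj (ev t \<phi> x - ev 0 \<phi> x)) {0..t}"
        by (rule has_integral_linear[OF ev_integral[OF x t] bounded_linear_cnj, unfolded o_def])
      then show "((\<lambda>s. \<i> * cnj (ham s (ev s \<phi>) x)) has_integral cnj (ev t \<phi> x) - cnj (ev 0 \<phi> x)) {0..t}"
        by simp
      show "((\<lambda>s. w x * (- \<i> * ham s (ev s \<psi>) (g x))) has_integral Q (ev t \<psi>) x - Q (ev 0 \<psi>) x) {0..t}"
        unfolding Q right_diff_distrib[symmetric] by (intro has_integral_mult_right ev_integral g x t)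
      show "cmod (\<i> * cnj (ham t (ev t \<phi>) x)) \<le> max K1 (cmod (w x) * K2)"
        using K1[OF t] by (simp add: norm_mult)
      show "cmod (w x * (- \<i> * ham t (ev t \<psi>) (g x))) \<le> max K1 (cmod (w x) * K2)"
        using mult_left_mono[OF K2[OF t], of "cmod (w x)"] by (simp add: norm_mult)
    qed
  qed
  then have "((\<lambda>s. \<Sum>x\<in>basis n. (\<i> * cnj (ham s (ev s \<phi>) x)) * Q (ev s \<psi>) x + cnj (ev s \<phi> x) * (w x * (- \<i> * ham s (ev s \<psi>) (g x))))
      has_integral (\<Sum>x\<in>basis n. cnj (ev t \<phi> x) * Q (ev t \<psi>) x - cnj (ev 0 \<phi> x) * Q (ev 0 \<psi>) x)) {0..t}"
    by (intro has_integral_sum) auto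
  also have "(\<Sum>x\<in>basis n. cnj (ev t \<phi> x) * Q (ev t \<psi>) x - cnj (ev 0 \<phi> x) * Q (ev 0 \<psi>) x)
      = inn n (ev t \<phi>) (Q (ev t \<psi>)) - inn n (ev 0 \<phi>) (Q (ev 0 \<psi>))"
    by (simp add: inn_def sum_subtractf)
  finally have int: "((\<lambda>s. \<Sum>x\<in>basis n. (\<i> * cnj (ham s (ev s \<phi>) x)) * Q (ev s \<psi>) x + cnj (ev s \<phi> x) * (w x * (- \<i> * ham s (ev s \<psi>) (g x))))
      has_integral (inn n (ev t \<phi>) (Q (ev t \<psi>)) - inn n (ev 0 \<phi>) (Q (ev 0 \<psi>)))) {0..t}" .
  \<comment> \<open>Self-adjointness moves the Hamiltonian from the left factor to the right one,
    which leaves the commutator.\<close>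
  have "(\<Sum>x\<in>basis n. (\<i> * cnj (ham s (ev s \<phi>) x)) * Q (ev s \<psi>) x + cnj (ev s \<phi> x) * (w x * (- \<i> * ham s (ev s \<psi>) (g x))))
      = \<i> * inn n (ev s \<phi>) (R s (ev s \<psi>))" if s: "s \<in> {0..t}" for s
  proof -
    have "(\<Sum>x\<in>basis n. (\<i> * cnj (ham s (ev s \<phi>) x)) * Q (ev s \<psi>) x + cnj (ev s \<phi> x) * (w x * (- \<i> * ham s (ev s \<psi>) (g x))))
      = \<i> * (inn n (ham s (ev s \<phi>)) (Q (ev s \<psi>)) - inn n (ev s \<phi>) (Q (ham s (ev s \<psi>))))"
      unfolding inn_def right_diff_distrib sum_distrib_left sum_subtractf[symmetric]
      by (intro sum.cong refl) (simp add: Q)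
    also have "\<dots> = \<i> * inn n (ev s \<phi>) (\<lambda>x. ham s (Q (ev s \<psi>)) x - Q (ham s (ev s \<psi>)) x)"
      by (simp add: ham_self_adjoint inn_diff_right)
    also have "inn n (ev s \<phi>) (\<lambda>x. ham s (Q (ev s \<psi>)) x - Q (ham s (ev s \<psi>)) x) = inn n (ev s \<phi>) (R s (ev s \<psi>))"
      using s t by (intro inn_cong comm) auto
    finally show ?thesis .
  qed
  from has_integral_eq[OF this int] show ?thesis .
qed

end

section \<open>Lieb-Robinson bound\<close>


primrec gball :: "(nat \<times> nat) set \<Rightarrow> nat \<Rightarrow> nat \<Rightarrow> nat set" where
  "gball E 0 s = {s}"
| "gball E (Suc r) s = gball E r s \<union> (\<Union>v\<in>gball E r s. neigh E v)"

context annealing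
begin

text \<open>Among the terms of the Hamiltonian only X_i fails to commute with Z_i, and it
  anticommutes with it; hence the factor 2.\<close>

lemma ham_opZ:
  assumes i: "i < n"
  shows "ham s (opZ i \<psi>) x - opZ i (ham s \<psi>) x = of_real (2 * (1 - u s)) * opZ i (opX i \<psi>) x"
proof -
  have "(\<Sum>k<n. zs i (flip k x) * \<psi> (flip k x)) = (\<Sum>k<n. zs i x * \<psi> (flip k x) - (if k = i then 2 * zs i x * \<psi> (flip i x) else 0))"
    by (intro sum.cong refl) (auto simp: zs_flip)
  also have "\<dots> = zs i x * (\<Sum>k<n. \<psi> (flip k x)) - 2 * zs i x * \<psi> (flip i x)"
    using i by (simp add: sum_subtractf sum_distrib_left)
  finally have *: "(\<Sum>k<n. zs i (flip k x) * \<psi> (flip k x)) = zs i x * (\<Sum>k<n. \<psi> (flip k x)) - 2 * zs i x * \<psi> (flip i x)" .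
  show ?thesis
    unfolding ham_def opZ_def opX_def * by (simp add: algebra_simps)
qed

text \<open>X_i commutes with the mixing part, and conjugation by X_i changes the cost by the sum in
  \<open>cutv_flip\<close>. The neighbours entering here are what lets influence spread by one graph
  step.\<close>

lemma ham_opX:
  "ham s (opX i \<psi>) x - opX i (ham s \<psi>) x = of_real (u s) * (\<Sum>j\<in>neigh E i. opZ j (opZ i (opX i \<psi>)) x)"
proof -
  have *: "(\<Sum>j\<in>neigh E i. opZ j (opZ i (opX i \<psi>)) x) = (cutv E (flip i x) - cutv E x) * \<psi> (flip i x)"
    unfolding cutv_flip[OF graph] opZ_def opX_def sum_distrib_right by (simp add: mult.assoc)
  show ?thesis
    unfolding * unfolding ham_def opX_def by (simp add: flip_commute[of i] algebra_simps)
qed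

text \<open>The instance of \<open>heisenberg\<close> in which \<open>Q\<close> is the identity and
  the commutator is zero.\<close>

lemma ev_isometry:
  assumes t: "t \<in> {0..T}"
  shows "inn n (ev t \<phi>) (ev t \<psi>) = inn n \<phi> \<psi>"
proof -
  have "((\<lambda>s. \<i> * inn n (ev s \<phi>) (\<lambda>x. 0)) has_integral
      (inn n (ev t \<phi>) (ev t \<psi>) - inn n (ev 0 \<phi>) (ev 0 \<psi>))) {0..t}"
    by (rule heisenberg[of "\<lambda>x. x" "\<lambda>\<psi>. \<psi>" "\<lambda>_. 1"]) (use t in auto)
  then have "((\<lambda>s. 0) has_integral (inn n (ev t \<phi>) (ev t \<psi>) - inn n (ev 0 \<phi>) (ev 0 \<psi>))) {0..t}"
    by (simp add: inn_def)
  from has_integral_unique[OF this has_integral_0]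
  have "inn n (ev t \<phi>) (ev t \<psi>) = inn n (ev 0 \<phi>) (ev 0 \<psi>)" by simp
  also have "\<dots> = inn n \<phi> \<psi>" by (intro inn_cong ev_0)
  finally show ?thesis .
qed

lemma nrm_ev: "t \<in> {0..T} \<Longrightarrow> nrm n (ev t \<psi>) = nrm n \<psi>"
  by (intro nrm_eq_of_inn ev_isometry)

text \<open>An isometry in finite dimension is onto, the adjoint providing the preimage. This
  replaces explicit use of U^* later on: a vector U^* Q U \<psi> is introduced as a preimage of Q U
  \<psi>.\<close>

lemma ev_surj:
  assumes t: "t \<in> {0..T}"
  shows "\<exists>\<psi>. \<forall>x\<in>basis n. ev t \<psi> x = \<phi> x"
proof (intro exI ballI)
  let ?\<delta> = "\<lambda>z y. if y = z then 1 else (0::complex)"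
  have delta: "inn n (?\<delta> z) (?\<delta> w) = ?\<delta> w z" if "z \<in> basis n" for z w
  proof -
    have "inn n (?\<delta> z) (?\<delta> w) = (\<Sum>x\<in>basis n. if x = z then ?\<delta> w z else 0)"
      unfolding inn_def by (intro sum.cong refl) auto
    then show ?thesis using that by simp
  qed
  have ev_delta: "ev t (?\<delta> z) x = U t x z" if "z \<in> basis n" for z x
  proof -
    have "ev t (?\<delta> z) x = (\<Sum>y\<in>basis n. if y = z then U t x z else 0)"
      unfolding ev_def apply_op_def by (intro sum.cong refl) auto
    then show ?thesis using that by simp
  qed
  have iso: "(\<Sum>x\<in>basis n. cnj (U t x z) * U t x w) = (if z = w then 1 else 0)"
    if "z \<in> basis n" "w \<in> basis n" for z w
    using ev_isometry[OF t, of "?\<delta> z" "?\<delta> w", unfolded delta[OF that(1)]]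
    unfolding inn_def ev_delta[OF that(1)] ev_delta[OF that(2)] by simp
  fix x assume x: "x \<in> basis n"
  let ?\<psi> = "\<lambda>y. \<Sum>w\<in>basis n. cnj (U t w y) * \<phi> w"
  have "ev t ?\<psi> x = (\<Sum>w\<in>basis n. (\<Sum>y\<in>basis n. U t x y * cnj (U t w y)) * \<phi> w)"
    unfolding ev_def apply_op_def sum_distrib_left sum_distrib_right
    by (subst sum.swap) (simp add: mult.assoc)
  also have "\<dots> = (\<Sum>w\<in>basis n. if w = x then \<phi> x else 0)"
  proof (rule sum.cong[OF refl])
    fix w assume "w \<in> basis n"
    from isometry_imp_coisometry[OF finite_basis iso x this]
    show "(\<Sum>y\<in>basis n. U t x y * cnj (U t w y)) * \<phi> w = (if w = x then \<phi> x else 0)" by auto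
  qed
  also have "\<dots> = \<phi> x" using x by simp
  finally show "ev t ?\<psi> x = \<phi> x" .
qed

text \<open>The matrix element of \<open>[U(t)\<^sup>* Q U(t), X\<^sub>k]\<close> between \<open>\<phi>\<close> and \<open>\<psi>\<close>.\<close>
definition comm :: "nat \<Rightarrow> (qstate \<Rightarrow> qstate) \<Rightarrow> real \<Rightarrow> qstate \<Rightarrow> qstate \<Rightarrow> complex" where
  "comm k Q t \<phi> \<psi> = inn n (ev t \<phi>) (Q (ev t (opX k \<psi>))) - inn n (ev t (opX k \<phi>)) (Q (ev t \<psi>))"

text \<open>A bound on the operator norm of the commutator, phrased through matrix elements so that
  no adjoint of the evolution has to be formed.\<close>

definition comm_le :: "nat \<Rightarrow> (qstate \<Rightarrow> qstate) \<Rightarrow> real \<Rightarrow> real \<Rightarrow> bool" where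
  "comm_le k Q t c \<longleftrightarrow> (\<forall>\<phi> \<psi>. cmod (comm k Q t \<phi> \<psi>) \<le> c * (nrm n \<phi> * nrm n \<psi>))"

lemma comm_le_trivial:
  assumes k: "k < n" and A: "reflection n A" and t: "t \<in> {0..T}"
  shows "comm_le k A t 2"
  unfolding comm_le_def
proof (intro allI)
  fix \<phi> \<psi>
  have nX: "nrm n (opX k \<xi>) = nrm n \<xi>" and nA: "nrm n (A \<xi>) = nrm n \<xi>" for \<xi>
    using reflection_opX[OF k] A by (auto simp: reflection_def)
  have "cmod (comm k A t \<phi> \<psi>) \<le> nrm n (ev t \<phi>) * nrm n (A (ev t (opX k \<psi>))) + nrm n (ev t (opX k \<phi>)) * nrm n (A (ev t \<psi>))"
    unfolding comm_def by (rule order_trans[OF norm_triangle_ineq4 add_mono[OF inn_cauchy_schwarz inn_cauchy_schwarz]])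
  then show "cmod (comm k A t \<phi> \<psi>) \<le> 2 * (nrm n \<phi> * nrm n \<psi>)"
    by (simp add: nX nA nrm_ev[OF t])
qed

text \<open>The Leibniz rule [A B, X] = [A, X] B + A [B, X] for evolved operators. The vectors \<xi>
  = U^* B U \<psi> and \<eta> = U^* A U \<phi> absorb the idle factor without changing
  norms.\<close>

lemma comm_le_mult:
  assumes k: "k < n" and A: "reflection n A" and B: "\<And>\<psi>. nrm n (B \<psi>) = nrm n \<psi>" and t: "t \<in> {0..T}"
    and a: "comm_le k A t a" and b: "comm_le k B t b"
  shows "comm_le k (\<lambda>\<psi>. A (B \<psi>)) t (a + b)"
  unfolding comm_le_def
proof (intro allI)
  fix \<phi> \<psi>
  have saX: "inn n \<phi> (opX k \<psi>) = inn n (opX k \<phi>) \<psi>" for \<phi> \<psi>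
    using reflection_opX[OF k] by (auto simp: reflection_def)
  have saA: "inn n \<phi> (A \<psi>) = inn n (A \<phi>) \<psi>" and nA: "nrm n (A \<psi>) = nrm n \<psi>" for \<phi> \<psi>
    using A by (auto simp: reflection_def)
  obtain \<xi> where \<xi>: "\<And>x. x \<in> basis n \<Longrightarrow> ev t \<xi> x = B (ev t \<psi>) x"
    using ev_surj[OF t] by metis
  obtain \<eta> where \<eta>: "\<And>x. x \<in> basis n \<Longrightarrow> ev t \<eta> x = A (ev t \<phi>) x"
    using ev_surj[OF t] by metis
  have n\<xi>: "nrm n \<xi> = nrm n \<psi>"
    using nrm_cong[of n "ev t \<xi>" "B (ev t \<psi>)"] \<xi> by (simp add: B nrm_ev[OF t])
  have n\<eta>: "nrm n \<eta> = nrm n \<phi>"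
    using nrm_cong[of n "ev t \<eta>" "A (ev t \<phi>)"] \<eta> by (simp add: nA nrm_ev[OF t])
  have 1: "inn n \<zeta> (A (ev t \<xi>)) = inn n \<zeta> (A (B (ev t \<psi>)))" for \<zeta>
    unfolding saA by (intro inn_cong \<xi> refl)
  have 2: "inn n (ev t \<phi>) (A \<zeta>) = inn n (ev t \<eta>) \<zeta>" for \<zeta>
    unfolding saA by (intro inn_cong \<eta>[symmetric] refl)
  \<comment> \<open>Both sides are the middle term A X_k B, which the two commutators contribute
    with opposite signs.\<close>
  have 3: "inn n (ev t \<eta>) (ev t (opX k \<xi>)) = inn n (ev t (opX k \<eta>)) (B (ev t \<psi>))"
  proof -
    have "inn n (ev t \<eta>) (ev t (opX k \<xi>)) = inn n (ev t (opX k \<eta>)) (ev t \<xi>)"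
      by (simp add: ev_isometry[OF t] saX)
    also have "\<dots> = inn n (ev t (opX k \<eta>)) (B (ev t \<psi>))" by (intro inn_cong \<xi> refl)
    finally show ?thesis .
  qed
  have "comm k (\<lambda>\<psi>. A (B \<psi>)) t \<phi> \<psi> = comm k A t \<phi> \<xi> + comm k B t \<eta> \<psi>"
    unfolding comm_def 1 2 3 by simp
  also have "cmod \<dots> \<le> a * (nrm n \<phi> * nrm n \<xi>) + b * (nrm n \<eta> * nrm n \<psi>)"
    using a b unfolding comm_le_def by (intro order_trans[OF norm_triangle_ineq add_mono]) auto
  also have "\<dots> = (a + b) * (nrm n \<phi> * nrm n \<psi>)" by (simp add: n\<xi> n\<eta> algebra_simps)
  finally show "cmod (comm k (\<lambda>\<psi>. A (B \<psi>)) t \<phi> \<psi>) \<le> (a + b) * (nrm n \<phi> * nrm n \<psi>)" .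
qed

text \<open>At time zero \<open>Q\<close> and X_k commute, so the commutator at time
  \<open>t\<close> is the time integral of the commutators of X_k with the evolved
  \<open>R s\<close>, and norm bounds can be integrated.\<close>

lemma comm_le_integral:
  assumes k: "k < n"
    and g: "\<And>x. x \<in> basis n \<Longrightarrow> g x \<in> basis n"
    and Q: "\<And>\<psi>. Q \<psi> = (\<lambda>x. w x * \<psi> (g x))"
    and com: "\<And>s x \<psi>. s \<in> {0..T} \<Longrightarrow> x \<in> basis n \<Longrightarrow> ham s (Q \<psi>) x - Q (ham s \<psi>) x = R s \<psi> x"
    and R: "\<And>s. s \<in> {0..T} \<Longrightarrow> comm_le k (R s) s (c s)"
    and Q0: "\<And>x \<psi>. x \<in> basis n \<Longrightarrow> Q (opX k \<psi>) x = opX k (Q \<psi>) x"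
    and c: "(c has_integral C) {0..t}"
    and t: "t \<in> {0..T}"
  shows "comm_le k Q t C"
  unfolding comm_le_def
proof (intro allI)
  fix \<phi> \<psi>
  have T0: "0 \<in> {0..T}" using t by auto
  have saX: "inn n \<phi> (opX k \<psi>) = inn n (opX k \<phi>) \<psi>" for \<phi> \<psi>
    using reflection_opX[OF k] by (auto simp: reflection_def)
  have e0: "x \<in> basis n \<Longrightarrow> Q (ev 0 \<psi>) x = Q \<psi> x" for x \<psi>
    unfolding Q by (simp add: ev_0 g)
  have com0: "comm k Q 0 \<phi> \<psi> = 0"
  proof -
    have "inn n (ev 0 \<phi>) (Q (ev 0 (opX k \<psi>))) = inn n \<phi> (opX k (Q \<psi>))"
      by (intro inn_cong) (simp_all add: ev_0 e0 Q0)
    moreover have "inn n (ev 0 (opX k \<phi>)) (Q (ev 0 \<psi>)) = inn n (opX k \<phi>) (Q \<psi>)"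
      by (intro inn_cong) (simp_all add: ev_0 e0)
    ultimately show ?thesis by (simp add: comm_def saX)
  qed
  have "((\<lambda>s. \<i> * inn n (ev s \<phi>) (R s (ev s (opX k \<psi>))) - \<i> * inn n (ev s (opX k \<phi>)) (R s (ev s \<psi>)))
     has_integral ((inn n (ev t \<phi>) (Q (ev t (opX k \<psi>))) - inn n (ev 0 \<phi>) (Q (ev 0 (opX k \<psi>))))
       - (inn n (ev t (opX k \<phi>)) (Q (ev t \<psi>)) - inn n (ev 0 (opX k \<phi>)) (Q (ev 0 \<psi>))))) {0..t}"
    by (intro has_integral_diff heisenberg[OF g Q com t])
  then have i: "((\<lambda>s. \<i> * comm k (R s) s \<phi> \<psi>) has_integral comm k Q t \<phi> \<psi>) {0..t}"
    using com0 unfolding comm_def by (simp add: algebra_simps)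
  have ci: "((\<lambda>s. c s * (nrm n \<phi> * nrm n \<psi>)) has_integral C * (nrm n \<phi> * nrm n \<psi>)) {0..t}"
    by (rule has_integral_mult_left[OF c])
  have "cmod (integral {0..t} (\<lambda>s. \<i> * comm k (R s) s \<phi> \<psi>)) \<le> integral {0..t} (\<lambda>s. c s * (nrm n \<phi> * nrm n \<psi>))"
  proof (rule integral_norm_bound_integral)
    fix s assume "s \<in> {0..t}"
    then show "cmod (\<i> * comm k (R s) s \<phi> \<psi>) \<le> c s * (nrm n \<phi> * nrm n \<psi>)"
      using R[of s] t unfolding comm_le_def by (simp add: norm_mult)
  qed (use i ci in \<open>auto simp: has_integral_iff\<close>)
  then show "cmod (comm k Q t \<phi> \<psi>) \<le> C * (nrm n \<phi> * nrm n \<psi>)"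
    unfolding integral_unique[OF i] integral_unique[OF ci] .
qed

lemma comm_le_scale:
  assumes "comm_le k Q t c" and "0 \<le> a"
  shows "comm_le k (\<lambda>\<psi> x. of_real a * Q \<psi> x) t (a * c)"
  unfolding comm_le_def
proof (intro allI)
  fix \<phi> \<psi>
  have "comm k (\<lambda>\<psi> x. of_real a * Q \<psi> x) t \<phi> \<psi> = of_real a * comm k Q t \<phi> \<psi>"
    by (simp add: comm_def inn_scale_right right_diff_distrib)
  then show "cmod (comm k (\<lambda>\<psi> x. of_real a * Q \<psi> x) t \<phi> \<psi>) \<le> a * c * (nrm n \<phi> * nrm n \<psi>)"
    using assms mult_left_mono[of "cmod (comm k Q t \<phi> \<psi>)" "c * (nrm n \<phi> * nrm n \<psi>)" a]
    by (simp add: comm_le_def norm_mult mult.assoc)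
qed

lemma comm_le_sum:
  assumes "\<And>j. j \<in> J \<Longrightarrow> comm_le k (Q j) t (c j)"
  shows "comm_le k (\<lambda>\<psi> x. \<Sum>j\<in>J. Q j \<psi> x) t (\<Sum>j\<in>J. c j)"
  unfolding comm_le_def
proof (intro allI)
  fix \<phi> \<psi>
  have "comm k (\<lambda>\<psi> x. \<Sum>j\<in>J. Q j \<psi> x) t \<phi> \<psi> = (\<Sum>j\<in>J. comm k (Q j) t \<phi> \<psi>)"
    by (simp add: comm_def inn_sum_right sum_subtractf)
  also have "cmod \<dots> \<le> (\<Sum>j\<in>J. c j * (nrm n \<phi> * nrm n \<psi>))"
    using assms by (intro order_trans[OF norm_sum sum_mono]) (auto simp: comm_le_def)
  finally show "cmod (comm k (\<lambda>\<psi> x. \<Sum>j\<in>J. Q j \<psi> x) t \<phi> \<psi>) \<le> (\<Sum>j\<in>J. c j) * (nrm n \<phi> * nrm n \<psi>)"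
    by (simp add: sum_distrib_right)
qed

lemma comm_le_mono: "comm_le k Q t c \<Longrightarrow> c \<le> c' \<Longrightarrow> comm_le k Q t c'"
  unfolding comm_le_def by (meson mult_right_mono nrm_nonneg mult_nonneg_nonneg order_trans)

text \<open>Turns one term of an exponential series into the next; this is the integration in the
  induction step of the Lieb-Robinson bound.\<close>

lemma has_integral_power_fact:
  fixes a t :: real
  assumes "0 \<le> t"
  shows "((\<lambda>s. a * (2 * (a * s) ^ m / fact m)) has_integral 2 * (a * t) ^ Suc m / fact (Suc m)) {0..t}"
proof -
  have "((\<lambda>s. 2 * (a * s) ^ Suc m / fact (Suc m)) has_vector_derivative a * (2 * (a * s) ^ m / fact m)) (at s within {0..t})" for s
  proof -
    have "((\<lambda>s. 2 * (a * s) ^ Suc m / fact (Suc m)) has_field_derivative 2 * (of_nat (Suc m) * (a * s) ^ m * a) / fact (Suc m)) (at s within {0..t})"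
      by (rule derivative_eq_intros refl | simp)+
    moreover have "2 * (of_nat (Suc m) * (a * s) ^ m * a) / fact (Suc m) = a * (2 * (a * s) ^ m / fact m)"
      by (simp add: fact_Suc divide_simps del: of_nat_Suc)
    ultimately show ?thesis by (simp only: has_real_derivative_iff_has_vector_derivative)
  qed
  from fundamental_theorem_of_calculus[OF assms this] show ?thesis by simp
qed

text \<open>The hypothesis \<open>far\<close> says that \<open>i\<close> has distance at least
  \<open>m\<close> from \<open>k\<close>. Z and X need a joint induction because their equations of
  motion are coupled. By the Leibniz rule, [H, Z_i] costs 2 * 2 copies of the previous bound and
  [H, X_i] costs 3 for each of at most \<open>D\<close> neighbours; since 4 \<le> 3 D, the rate 3 D
  serves for both.\<close>

theorem lieb_robinson:
  assumes k: "k < n" and D: "2 \<le> D" "\<And>i. i < n \<Longrightarrow> card (neigh E i) \<le> D"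
    and i: "i < n" and far: "\<And>m'. m' < m \<Longrightarrow> i \<notin> gball E m' k" and t: "t \<in> {0..T}"
  shows "comm_le k (opZ i) t (2 * (3 * real D * t) ^ m / fact m)"
    and "comm_le k (opX i) t (2 * (3 * real D * t) ^ m / fact m)"
proof -
  have "comm_le k (opZ i) t (2 * (3 * real D * t) ^ m / fact m)
      \<and> comm_le k (opX i) t (2 * (3 * real D * t) ^ m / fact m)"
    using i far t
  proof (induction m arbitrary: i t)
    case 0
    then show ?case
      using comm_le_trivial[OF k reflection_opZ] comm_le_trivial[OF k reflection_opX] by simp
  next
    case (Suc m)
    define c where "c = (\<lambda>s. 2 * (3 * real D * s) ^ m / fact m)"
    have c0: "0 \<le> c s" if "s \<in> {0..T}" for s using that by (simp add: c_def)
    \<comment> \<open>Distance at least one makes the commutator with X_k vanish at time zero, so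
      the integral form applies.\<close>
    have ik: "i \<noteq> k" using Suc.prems(2)[of 0] by simp
    have IHi: "comm_le k (opZ i) s (c s)" "comm_le k (opX i) s (c s)" if "s \<in> {0..T}" for s
      using Suc.IH[of i s] Suc.prems that by (auto simp: c_def)
    \<comment> \<open>A neighbour is at most one step closer to \<open>k\<close>: if it lay in the
      ball of radius m' < m, then \<open>i\<close> would lie in the ball of radius m' + 1.\<close>
    have IHj: "comm_le k (opZ j) s (c s)" if s: "s \<in> {0..T}" and j: "j \<in> neigh E i" for s j
    proof -
      have "j \<notin> gball E m' k" if "m' < m" for m'
      proof
        assume "j \<in> gball E m' k"
        moreover have "i \<in> neigh E j" using j by (auto simp: neigh_def)
        ultimately have "i \<in> gball E (Suc m') k" by auto
        then show False using Suc.prems(2)[of "Suc m'"] that by simp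
      qed
      then show ?thesis using Suc.IH[of j s] neigh_less[OF graph j] s by (auto simp: c_def)
    qed
    have nX: "nrm n (opX i \<psi>) = nrm n \<psi>" and nZ: "nrm n (opZ j \<psi>) = nrm n \<psi>" for j \<psi>
      using reflection_opX[OF Suc.prems(1)] reflection_opZ[of n j] by (auto simp: reflection_def)
    have ZX: "comm_le k (\<lambda>\<psi>. opZ i (opX i \<psi>)) s (c s + c s)" if "s \<in> {0..T}" for s
      by (rule comm_le_mult[OF k reflection_opZ nX that IHi[OF that]])
    have ZZX: "comm_le k (\<lambda>\<psi>. opZ j (opZ i (opX i \<psi>))) s (c s + (c s + c s))"
      if "s \<in> {0..T}" "j \<in> neigh E i" for s j
      by (rule comm_le_mult[OF k reflection_opZ _ that(1) IHj[OF that] ZX[OF that(1)]]) (simp add: nX nZ)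
    have int: "((\<lambda>s. 3 * real D * c s) has_integral 2 * (3 * real D * t) ^ Suc m / fact (Suc m)) {0..t}"
      unfolding c_def by (rule has_integral_power_fact) (use Suc.prems in auto)
    show ?case
    proof
      show "comm_le k (opZ i) t (2 * (3 * real D * t) ^ Suc m / fact (Suc m))"
      proof (rule comm_le_integral[OF k _ _ ham_opZ[OF Suc.prems(1)] _ _ int Suc.prems(3)])
        fix s assume s: "s \<in> {0..T}"
        have "2 * (1 - u s) * (c s + c s) \<le> 2 * 1 * (c s + c s)"
          using u_bounds[OF s] c0[OF s] by (intro mult_mono) auto
        also have "\<dots> \<le> 3 * real D * c s"
          using mult_right_mono[of 4 "3 * real D" "c s"] D(1) c0[OF s] by simp
        finally show "comm_le k (\<lambda>\<psi> x. complex_of_real (2 * (1 - u s)) * opZ i (opX i \<psi>) x) s (3 * real D * c s)"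
          using u_bounds[OF s] by (intro comm_le_mono[OF comm_le_scale[OF ZX[OF s]]]) auto
      qed (auto simp: opZ_def opX_def zs_flip ik)
      show "comm_le k (opX i) t (2 * (3 * real D * t) ^ Suc m / fact (Suc m))"
      proof (rule comm_le_integral[OF k _ _ ham_opX _ _ int Suc.prems(3), where w = "\<lambda>_. 1"])
        fix s assume s: "s \<in> {0..T}"
        have "u s * (\<Sum>j\<in>neigh E i. c s + (c s + c s)) \<le> 1 * (real D * (c s + (c s + c s)))"
          using u_bounds[OF s] c0[OF s] D(2)[OF Suc.prems(1)]
          by (intro mult_mono) (auto intro!: mult_right_mono sum_nonneg simp del: distrib_left_numeral)
        also have "\<dots> = 3 * real D * c s" by simp
        finally show "comm_le k (\<lambda>\<psi> x. complex_of_real (u s) * (\<Sum>j\<in>neigh E i. opZ j (opZ i (opX i \<psi>)) x)) s (3 * real D * c s)"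
          using u_bounds[OF s] by (intro comm_le_mono[OF comm_le_scale[OF comm_le_sum[OF ZZX[OF s]]]]) auto
      qed (use Suc.prems(1) in \<open>auto simp: opX_def flip_commute\<close>)
    qed
  qed
  then show "comm_le k (opZ i) t (2 * (3 * real D * t) ^ m / fact m)"
    and "comm_le k (opX i) t (2 * (3 * real D * t) ^ m / fact m)" by auto
qed

end

section \<open>Fourier expansion of evolved spins\<close>


text \<open>The Walsh-Hadamard transform: the component of \<open>a\<close> along the joint
  eigenvector of all X_k with eigenvalue -1 exactly for k in \<open>S\<close>.\<close>

definition walsh :: "nat \<Rightarrow> qstate \<Rightarrow> nat set \<Rightarrow> complex" where
  "walsh n a S = (\<Sum>x\<in>basis n. (\<Prod>k\<in>S. zs k x) * a x) / of_real (sqrt (2 ^ n))"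

text \<open>Summing over all \<open>S\<close> factorises into the product of 1 + z_k(x) z_k(y), and
  a vertex on which \<open>x\<close> and \<open>y\<close> differ gives a zero factor.\<close>

lemma walsh_orthogonal:
  assumes "x \<in> basis n" "y \<in> basis n"
  shows "(\<Sum>S\<in>basis n. (\<Prod>k\<in>S. zs k x) * (\<Prod>k\<in>S. zs k y)) = (if x = y then 2 ^ n else 0)"
proof -
  have "(\<Sum>S\<in>basis n. (\<Prod>k\<in>S. zs k x) * (\<Prod>k\<in>S. zs k y)) = (\<Prod>k<n. zs k x * zs k y + 1)"
    unfolding basis_def by (subst prod_add) (auto simp: prod.distrib)
  also have "\<dots> = (if x = y then 2 ^ n else 0)"
  proof (cases "x = y")
    case False
    then obtain k where "k \<in> x \<longleftrightarrow> k \<notin> y" by blast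
    moreover from this have "k < n" using assms by (auto simp: basis_def)
    ultimately show ?thesis using False by (intro trans[OF prod_zero]) (auto simp: zs_def)
  qed simp
  finally show ?thesis .
qed

lemma walsh_parseval: "(\<Sum>S\<in>basis n. cnj (walsh n a S) * walsh n b S) = inn n a b"
proof -
  have sq: "complex_of_real (sqrt (2 ^ n)) * of_real (sqrt (2 ^ n)) = 2 ^ n"
    unfolding of_real_mult[symmetric] by simp
  have "(\<Sum>S\<in>basis n. cnj (walsh n a S) * walsh n b S) =
     (\<Sum>S\<in>basis n. \<Sum>x\<in>basis n. \<Sum>y\<in>basis n. cnj (a x) * b y * ((\<Prod>k\<in>S. zs k x) * (\<Prod>k\<in>S. zs k y)) / 2 ^ n)"
  proof (rule sum.cong[OF refl])
    fix S
    have "cnj (walsh n a S) * walsh n b S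
        = (\<Sum>x\<in>basis n. (\<Prod>k\<in>S. zs k x) * cnj (a x)) * (\<Sum>y\<in>basis n. (\<Prod>k\<in>S. zs k y) * b y) / 2 ^ n"
      unfolding walsh_def by (simp add: sq)
    then show "cnj (walsh n a S) * walsh n b S
        = (\<Sum>x\<in>basis n. \<Sum>y\<in>basis n. cnj (a x) * b y * ((\<Prod>k\<in>S. zs k x) * (\<Prod>k\<in>S. zs k y)) / 2 ^ n)"
      unfolding sum_product sum_divide_distrib by (simp add: mult_ac)
  qed
  also have "\<dots> = (\<Sum>x\<in>basis n. \<Sum>S\<in>basis n. \<Sum>y\<in>basis n. cnj (a x) * b y * ((\<Prod>k\<in>S. zs k x) * (\<Prod>k\<in>S. zs k y)) / 2 ^ n)"
    by (rule sum.swap)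
  also have "\<dots> = (\<Sum>x\<in>basis n. \<Sum>y\<in>basis n. \<Sum>S\<in>basis n. cnj (a x) * b y * ((\<Prod>k\<in>S. zs k x) * (\<Prod>k\<in>S. zs k y)) / 2 ^ n)"
    by (rule sum.cong[OF refl], rule sum.swap)
  also have "\<dots> = (\<Sum>x\<in>basis n. \<Sum>y\<in>basis n. if y = x then cnj (a x) * b x else 0)"
  proof (rule sum.cong[OF refl], rule sum.cong[OF refl])
    fix x y assume "x \<in> basis n" "y \<in> basis n"
    have "(\<Sum>S\<in>basis n. cnj (a x) * b y * ((\<Prod>k\<in>S. zs k x) * (\<Prod>k\<in>S. zs k y)) / 2 ^ n)
        = cnj (a x) * b y * (\<Sum>S\<in>basis n. (\<Prod>k\<in>S. zs k x) * (\<Prod>k\<in>S. zs k y)) / 2 ^ n"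
      by (simp add: sum_distrib_left sum_divide_distrib)
    also have "\<dots> = (if y = x then cnj (a x) * b x else 0)"
      unfolding walsh_orthogonal[OF \<open>x \<in> basis n\<close> \<open>y \<in> basis n\<close>] by auto
    finally show "(\<Sum>S\<in>basis n. cnj (a x) * b y * ((\<Prod>k\<in>S. zs k x) * (\<Prod>k\<in>S. zs k y)) / 2 ^ n)
        = (if y = x then cnj (a x) * b x else 0)" .
  qed
  also have "\<dots> = inn n a b"
    unfolding inn_def by (intro sum.cong refl) simp
  finally show ?thesis .
qed

lemma walsh_norm: "(\<Sum>S\<in>basis n. (cmod (walsh n a S))\<^sup>2) = (nrm n a)\<^sup>2"
proof -
  have "complex_of_real (\<Sum>S\<in>basis n. (cmod (walsh n a S))\<^sup>2) = of_real ((nrm n a)\<^sup>2)"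
    unfolding of_real_sum complex_norm_square inn_self[symmetric] walsh_parseval[symmetric]
    by (simp add: mult.commute)
  then show ?thesis by (simp only: of_real_eq_iff)
qed

lemma walsh_diff: "walsh n (\<lambda>x. a x - b x) S = walsh n a S - walsh n b S"
  by (simp add: walsh_def right_diff_distrib sum_subtractf diff_divide_distrib)

text \<open>Flipping \<open>k\<close> changes the sign of a character exactly when \<open>k\<close>
  is one of its factors, so X_k is diagonal after the transform.\<close>

lemma walsh_opX:
  assumes "k < n" "S \<in> basis n"
  shows "walsh n (opX k a) S = (if k \<in> S then - walsh n a S else walsh n a S)"
proof -
  have fS: "finite S" using assms(2) by (auto simp: basis_def intro: finite_subset)
  have *: "(\<Prod>l\<in>S. zs l (flip k x)) = (if k \<in> S then -1 else 1) * (\<Prod>l\<in>S. zs l x)" for x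
  proof (cases "k \<in> S")
    case True
    have "(\<Prod>l\<in>S. zs l (flip k x)) = zs k (flip k x) * (\<Prod>l\<in>S - {k}. zs l (flip k x))"
      by (rule prod.remove[OF fS True])
    also have "(\<Prod>l\<in>S - {k}. zs l (flip k x)) = (\<Prod>l\<in>S - {k}. zs l x)"
      by (intro prod.cong) (auto simp: zs_flip)
    also have "zs k (flip k x) * \<dots> = - (\<Prod>l\<in>S. zs l x)"
      by (simp add: zs_flip prod.remove[OF fS True])
    finally show ?thesis using True by simp
  next
    case False
    then have "(\<Prod>l\<in>S. zs l (flip k x)) = (\<Prod>l\<in>S. zs l x)"
      by (intro prod.cong) (auto simp: zs_flip)
    then show ?thesis using False by simp
  qed
  have "(\<Sum>x\<in>basis n. (\<Prod>l\<in>S. zs l x) * opX k a x) = (\<Sum>x\<in>basis n. (\<Prod>l\<in>S. zs l (flip k x)) * a x)"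
    using sum_flip[OF assms(1), of "\<lambda>x. (\<Prod>l\<in>S. zs l (flip k x)) * a x"] by (simp add: opX_def)
  then show ?thesis
    unfolding walsh_def * by (simp add: sum_negf)
qed

lemma walsh_empty: "walsh n a {} = inn n (plus_state n) a"
  by (simp add: walsh_def inn_def plus_state_def sum_divide_distrib)

section \<open>The initial state\<close>

lemma inn_plus_state: "inn n (plus_state n) (plus_state n) = 1"
proof -
  have "inn n (plus_state n) (plus_state n) = (\<Sum>x\<in>basis n. complex_of_real (1 / 2 ^ n))"
  proof (unfold inn_def, rule sum.cong[OF refl])
    fix x assume "x \<in> basis n"
    moreover have "1 / sqrt (2 ^ n) * (1 / sqrt (2 ^ n)) = 1 / (2::real) ^ n" by simp
    ultimately show "cnj (plus_state n x) * plus_state n x = complex_of_real (1 / 2 ^ n)"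
      by (simp only: plus_state_def if_True complex_cnj_complex_of_real of_real_mult[symmetric])
  qed
  then show ?thesis by (simp add: card_basis)
qed

lemma nrm_plus_state: "nrm n (plus_state n) = 1"
proof -
  have "complex_of_real ((nrm n (plus_state n))\<^sup>2) = of_real 1"
    by (metis inn_plus_state inn_self of_real_1)
  then have "(nrm n (plus_state n))\<^sup>2 = 1" by (simp only: of_real_eq_iff)
  then show ?thesis using nrm_nonneg[of n "plus_state n"] by (auto simp: power2_eq_1_iff)
qed

lemma opX_plus_state: "k < n \<Longrightarrow> opX k (plus_state n) = plus_state n"
  by (simp add: opX_def plus_state_def fun_eq_iff)

section \<open>Global spin flip symmetry\<close>

lemma sum_compl_basis: "(\<Sum>x\<in>basis n. f ({..<n} - x)) = (\<Sum>x\<in>basis n. f x)"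
  by (rule sum.reindex_bij_witness[of _ "\<lambda>x. {..<n} - x" "\<lambda>x. {..<n} - x"]) (auto simp: basis_def)

lemma zs_compl: "i < n \<Longrightarrow> zs i ({..<n} - x) = - zs i x"
  by (simp add: zs_def)

lemma flip_compl: "k < n \<Longrightarrow> flip k ({..<n} - x) = {..<n} - flip k x"
  by (auto simp: flip_def)

context annealing
begin

lemma cutv_compl: "cutv E ({..<n} - x) = cutv E x"
  unfolding cutv_def by (intro sum.cong refl) (auto simp: zs_compl dest: is_graph_bounds[OF graph])

text \<open>The global spin flip commutes with the evolution and fixes the initial state.\<close>
lemma ev_plus_state_compl:
  assumes t: "t \<in> {0..T}" and x: "x \<in> basis n"
  shows "ev t (plus_state n) ({..<n} - x) = ev t (plus_state n) x"
proof -
  let ?\<psi> = "plus_state n" and ?P = "\<lambda>\<psi> x. \<psi> ({..<n} - x) :: complex"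
  have c: "{..<n} - x \<in> basis n" for x by (auto simp: basis_def)
  have P0: "?P ?\<psi> x = ?\<psi> x" if "x \<in> basis n" for x using that by (simp add: plus_state_def c)
  have *: "inn n (ev t \<phi>) (?P (ev t ?\<psi>)) = inn n (ev t \<phi>) (ev t ?\<psi>)" for \<phi>
  proof -
    have "((\<lambda>s. \<i> * inn n (ev s \<phi>) (\<lambda>x. 0)) has_integral
        (inn n (ev t \<phi>) (?P (ev t ?\<psi>)) - inn n (ev 0 \<phi>) (?P (ev 0 ?\<psi>)))) {0..t}"
    proof (rule heisenberg[of "\<lambda>x. {..<n} - x" ?P "\<lambda>_. 1", OF c])
      fix s x \<psi> assume "x \<in> basis n"
      show "ham s (?P \<psi>) x - ?P (ham s \<psi>) x = 0"
        unfolding ham_def by (simp add: cutv_compl flip_compl)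
    qed (use t in auto)
    then have "((\<lambda>s. 0) has_integral (inn n (ev t \<phi>) (?P (ev t ?\<psi>)) - inn n (ev 0 \<phi>) (?P (ev 0 ?\<psi>)))) {0..t}"
      by (simp add: inn_def)
    from has_integral_unique[OF this has_integral_0]
    have "inn n (ev t \<phi>) (?P (ev t ?\<psi>)) = inn n (ev 0 \<phi>) (?P (ev 0 ?\<psi>))" by simp
    also have "\<dots> = inn n \<phi> ?\<psi>"
      by (rule inn_cong) (simp_all add: ev_0 c P0)
    also have "\<dots> = inn n (ev t \<phi>) (ev t ?\<psi>)" using ev_isometry[OF t] by simp
    finally show ?thesis .
  qed
  \<comment> \<open>A preimage of the basis vector at \<open>x\<close> turns equality of matrix
    elements into equality of amplitudes.\<close>
  obtain \<phi> where \<phi>: "\<And>y. y \<in> basis n \<Longrightarrow> ev t \<phi> y = (if y = x then 1 else 0)"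
    using ev_surj[OF t, of "\<lambda>y. if y = x then 1 else 0"] by blast
  have eval: "inn n (ev t \<phi>) \<xi> = \<xi> x" for \<xi>
  proof -
    have "inn n (ev t \<phi>) \<xi> = (\<Sum>y\<in>basis n. if y = x then \<xi> x else 0)"
      unfolding inn_def by (intro sum.cong refl) (simp add: \<phi>)
    then show ?thesis using x by simp
  qed
  from *[of \<phi>] show ?thesis unfolding eval .
qed

text \<open>The spin is odd under complementation while the evolved state is even, so the
  expectation equals its own negative.\<close>

lemma inn_opZ_plus_state:
  assumes i: "i < n" and t: "t \<in> {0..T}"
  shows "inn n (ev t (plus_state n)) (opZ i (ev t (plus_state n))) = 0"
proof -
  let ?f = "\<lambda>x. cnj (ev t (plus_state n) x) * (zs i x * ev t (plus_state n) x)"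
  have "(\<Sum>x\<in>basis n. ?f x) = (\<Sum>x\<in>basis n. ?f ({..<n} - x))" by (rule sum_compl_basis[symmetric])
  also have "\<dots> = (\<Sum>x\<in>basis n. - ?f x)"
    by (intro sum.cong refl) (simp add: ev_plus_state_compl[OF t] zs_compl[OF i])
  also have "\<dots> = - (\<Sum>x\<in>basis n. ?f x)" by (rule sum_negf)
  finally show ?thesis by (simp add: inn_def opZ_def)
qed

lemma neg_expect_costH:
  "neg_expect n (costH n E) \<phi> = (\<Sum>(i,j)\<in>E. ((nrm n \<phi>)\<^sup>2 - Re (inn n (opZ i \<phi>) (opZ j \<phi>))) / 2)"
proof -
  have "(\<Sum>x\<in>basis n. \<Sum>y\<in>basis n. cnj (\<phi> x) * costH n E x y * \<phi> y) = (\<Sum>x\<in>basis n. cnj (\<phi> x) * (- cutv E x * \<phi> x))"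
    by (rule sum.cong[OF refl]) (simp only: costH_apply[OF graph, symmetric] sum_distrib_left mult.assoc)
  also have "\<dots> = - (\<Sum>x\<in>basis n. \<Sum>(i,j)\<in>E. (cnj (\<phi> x) * \<phi> x - cnj (zs i x * \<phi> x) * (zs j x * \<phi> x)) / 2)"
    unfolding cutv_def sum_negf[symmetric] sum_distrib_left sum_distrib_right
    by (intro sum.cong refl) (auto simp: field_simps)
  also have "(\<Sum>x\<in>basis n. \<Sum>(i,j)\<in>E. (cnj (\<phi> x) * \<phi> x - cnj (zs i x * \<phi> x) * (zs j x * \<phi> x)) / 2)
     = (\<Sum>(i,j)\<in>E. (inn n \<phi> \<phi> - inn n (opZ i \<phi>) (opZ j \<phi>)) / 2)"
    by (subst sum.swap) (auto intro!: sum.cong simp: inn_def opZ_def sum_subtractf sum_divide_distrib diff_divide_distrib)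
  finally show ?thesis
    unfolding neg_expect_def by (simp add: inn_self case_prod_beta del: of_real_power)
qed

theorem fourier_light_cone:
  assumes D: "2 \<le> D" "\<And>i. i < n \<Longrightarrow> card (neigh E i) \<le> D"
  shows "\<exists>a :: nat \<Rightarrow> nat set \<Rightarrow> complex.
    (\<forall>i<n. (\<Sum>S\<in>basis n. (cmod (a i S))\<^sup>2) = 1) \<and>
    (\<forall>i<n. a i {} = 0) \<and>
    (\<forall>i<n. \<forall>k<n. \<forall>m. (\<forall>m'<m. i \<notin> gball E m' k) \<longrightarrow>
      (\<Sum>S\<in>{S\<in>basis n. k \<in> S}. (cmod (a i S))\<^sup>2) \<le> ((3 * real D * T) ^ m / fact m)\<^sup>2) \<and>
    neg_expect n (costH n E) (apply_op n (U T) (plus_state n))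
      = (\<Sum>(i,j)\<in>E. (1 - Re (\<Sum>S\<in>basis n. cnj (a i S) * a j S)) / 2)"
proof -
  have t: "T \<in> {0..T}" using T_pos by simp
  let ?\<psi> = "plus_state n"
  have nZ: "nrm n (opZ i \<psi>) = nrm n \<psi>" for i \<psi>
    using reflection_opZ[of n i] by (auto simp: reflection_def)
  have "\<forall>i. \<exists>b. \<forall>x\<in>basis n. ev T b x = opZ i (ev T ?\<psi>) x"
    using ev_surj[OF t] by blast
  then obtain b where b: "\<And>i x. x \<in> basis n \<Longrightarrow> ev T (b i) x = opZ i (ev T ?\<psi>) x"
    by metis
  have bi: "inn n \<phi> (b i) = inn n (ev T \<phi>) (opZ i (ev T ?\<psi>))" for \<phi> i
    by (rule trans[OF ev_isometry[OF t, symmetric]]) (intro inn_cong b refl)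
  have nb: "nrm n (b i) = 1" for i
    using nrm_cong[of n "ev T (b i)" "opZ i (ev T ?\<psi>)"] b
    by (simp add: nrm_ev[OF t] nZ nrm_plus_state)
  show ?thesis
  proof (intro exI[of _ "\<lambda>i. walsh n (b i)"] conjI allI impI)
    show "(\<Sum>S\<in>basis n. (cmod (walsh n (b i) S))\<^sup>2) = 1" for i
      by (simp add: walsh_norm nb)
    show "walsh n (b i) {} = 0" if "i < n" for i
      by (simp add: walsh_empty bi inn_opZ_plus_state[OF that t])
    show "neg_expect n (costH n E) (apply_op n (U T) ?\<psi>)
      = (\<Sum>(i,j)\<in>E. (1 - Re (\<Sum>S\<in>basis n. cnj (walsh n (b i) S) * walsh n (b j) S)) / 2)"
    proof -
      have "inn n (b i) (b j) = inn n (opZ i (ev T ?\<psi>)) (opZ j (ev T ?\<psi>))" for i j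
        by (rule trans[OF ev_isometry[OF t, symmetric]]) (intro inn_cong b)
      then show ?thesis
        unfolding ev_def[symmetric] neg_expect_costH walsh_parseval nrm_ev[OF t] nrm_plus_state by simp
    qed
    fix i k m assume i: "i < n" and k: "k < n" and far: "\<forall>m'<m. i \<notin> gball E m' k"
    define \<epsilon> where "\<epsilon> = 2 * (3 * real D * T) ^ m / fact m"
    define d where "d = (\<lambda>x. b i x - opX k (b i) x)"
    have saX: "inn n \<phi> (opX k \<psi>) = inn n (opX k \<phi>) \<psi>" for \<phi> \<psi>
      using reflection_opX[OF k] by (auto simp: reflection_def)
    have inn_d: "inn n \<phi> d = comm k (opZ i) T \<phi> ?\<psi>" for \<phi>
      unfolding d_def inn_diff_right saX bi comm_def opX_plus_state[OF k] ..
    \<comment> \<open>Testing the matrix-element bound against \<open>d\<close> itself turns it into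
      a bound on the norm of \<open>d\<close>.\<close>
    have "(nrm n d)\<^sup>2 = cmod (inn n d d)" unfolding inn_self norm_of_real by simp
    also have "\<dots> \<le> \<epsilon> * nrm n d"
      using lieb_robinson(1)[OF k D i far[rule_format] t] unfolding inn_d comm_le_def \<epsilon>_def
      by (metis mult.right_neutral nrm_plus_state)
    finally have "(nrm n d)\<^sup>2 \<le> \<epsilon> * nrm n d" .
    have nd: "nrm n d \<le> \<epsilon>"
    proof (cases "nrm n d = 0")
      case True
      then show ?thesis using T_pos by (simp add: \<epsilon>_def)
    next
      case False
      then have "0 < nrm n d" using nrm_nonneg[of n d] by linarith
      then show ?thesis
        using \<open>(nrm n d)\<^sup>2 \<le> \<epsilon> * nrm n d\<close> by (simp add: power2_eq_square)
    qed
    have "4 * (\<Sum>S\<in>{S\<in>basis n. k \<in> S}. (cmod (walsh n (b i) S))\<^sup>2) = (\<Sum>S\<in>{S\<in>basis n. k \<in> S}. (cmod (walsh n d S))\<^sup>2)"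
      unfolding sum_distrib_left
    proof (rule sum.cong[OF refl])
      fix S assume "S \<in> {S \<in> basis n. k \<in> S}"
      then have "walsh n d S = 2 * walsh n (b i) S" unfolding d_def walsh_diff by (simp add: walsh_opX[OF k])
      then show "4 * (cmod (walsh n (b i) S))\<^sup>2 = (cmod (walsh n d S))\<^sup>2" by (simp add: norm_mult power_mult_distrib)
    qed
    also have "\<dots> \<le> (\<Sum>S\<in>basis n. (cmod (walsh n d S))\<^sup>2)"
      by (intro sum_mono2) auto
    also have "\<dots> \<le> \<epsilon>\<^sup>2" unfolding walsh_norm by (intro power_mono nd) simp
    finally show "(\<Sum>S\<in>{S\<in>basis n. k \<in> S}. (cmod (walsh n (b i) S))\<^sup>2) \<le> ((3 * real D * T) ^ m / fact m)\<^sup>2"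
      unfolding \<epsilon>_def by (simp add: power_mult_distrib power_divide)
  qed
qed

end

section \<open>Tree-like neighbourhoods\<close>


text \<open>The graph distance from \<open>s\<close>. It is unspecified for unreachable vertices, so
  its properties are stated for members of some ball.\<close>

definition lev :: "(nat \<times> nat) set \<Rightarrow> nat \<Rightarrow> nat \<Rightarrow> nat" where
  "lev E s v = (LEAST m. v \<in> gball E m s)"

section \<open>Balls in the graph metric\<close>

lemma neigh_sym: "v \<in> neigh E w \<longleftrightarrow> w \<in> neigh E v"
  by (auto simp: neigh_def)

lemma gball_mono: "m \<le> r \<Longrightarrow> gball E m s \<subseteq> gball E r s"
  by (induction r) (auto simp: le_Suc_eq)

lemma gball_neigh: "v \<in> gball E r s \<Longrightarrow> w \<in> neigh E v \<Longrightarrow> w \<in> gball E (Suc r) s"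
  by auto

text \<open>Grows the ball from its centre instead of at its rim, as the induction for
  \<open>gball_sym\<close> requires.\<close>

lemma gball_Suc': "gball E (Suc r) s = gball E r s \<union> (\<Union>v\<in>neigh E s. gball E r v)"
proof (induction r)
  case (Suc r)
  have "gball E (Suc (Suc r)) s = gball E (Suc r) s \<union> (\<Union>v\<in>gball E (Suc r) s. neigh E v)"
    by simp
  also have "\<dots> = gball E r s \<union> (\<Union>v\<in>neigh E s. gball E r v) \<union> (\<Union>v\<in>gball E r s \<union> (\<Union>v\<in>neigh E s. gball E r v). neigh E v)"
    unfolding Suc.IH ..
  also have "\<dots> = gball E (Suc r) s \<union> (\<Union>v\<in>neigh E s. gball E (Suc r) v)"
    by auto
  finally show ?case .
qed auto

lemma gball_sym: "v \<in> gball E r s \<longleftrightarrow> s \<in> gball E r v"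
proof (induction r arbitrary: s v)
  case (Suc r)
  have "v \<in> gball E (Suc r) s \<longleftrightarrow> v \<in> gball E r s \<or> (\<exists>w\<in>neigh E s. v \<in> gball E r w)"
    unfolding gball_Suc' by blast
  also have "\<dots> \<longleftrightarrow> s \<in> gball E r v \<or> (\<exists>w\<in>gball E r v. s \<in> neigh E w)"
    using Suc.IH neigh_sym by blast
  finally show ?case by auto
qed auto

lemma gball_less: "is_graph n E \<Longrightarrow> s < n \<Longrightarrow> v \<in> gball E r s \<Longrightarrow> v < n"
  by (induction r arbitrary: v) (auto dest: neigh_less)

lemma card_gball_le:
  assumes g: "is_graph n E" and D: "\<And>i. i < n \<Longrightarrow> card (neigh E i) \<le> D" and s: "s < n"
  shows "finite (gball E r s) \<and> card (gball E r s) \<le> (D + 1) ^ r"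
proof (induction r)
  case (Suc r)
  have "card (\<Union>v\<in>gball E r s. neigh E v) \<le> (\<Sum>v\<in>gball E r s. card (neigh E v))"
    by (rule card_UN_le) (use Suc in simp)
  also have "\<dots> \<le> (\<Sum>v\<in>gball E r s. D)"
    using gball_less[OF g s] by (intro sum_mono D) auto
  finally have "card (\<Union>v\<in>gball E r s. neigh E v) \<le> card (gball E r s) * D" by simp
  then have "card (gball E (Suc r) s) \<le> card (gball E r s) + card (gball E r s) * D"
    using card_Un_le[of "gball E r s" "\<Union>v\<in>gball E r s. neigh E v"] by simp
  also have "\<dots> \<le> (D + 1) ^ Suc r" using Suc mult_right_mono[of "card (gball E r s)" "(D+1)^r" "D+1"] by (simp add: algebra_simps)
  finally show ?case using Suc finite_neigh[OF g] by simp
qed simp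

lemma lev_le: "v \<in> gball E r s \<Longrightarrow> lev E s v \<le> r"
  unfolding lev_def by (rule Least_le)

lemma in_gball_lev: "v \<in> gball E r s \<Longrightarrow> v \<in> gball E (lev E s v) s"
  unfolding lev_def by (rule LeastI)

text \<open>A path whose last vertex is joined back to an earlier one: a cycle through
  \<open>p ! j\<close> with a stick leading to it from \<open>hd p\<close>. The inequality leaves at
  least three vertices on the cycle, so the closing edge is not an edge of the path.\<close>

definition lollipop :: "(nat \<times> nat) set \<Rightarrow> nat list \<Rightarrow> nat \<Rightarrow> bool" where
  "lollipop E p j \<longleftrightarrow> distinct p \<and> successively (\<lambda>v w. w \<in> neigh E v) p \<and> j + 2 < length p
     \<and> p ! j \<in> neigh E (last p)"

text \<open>The stick measures the way from \<open>s\<close> to a cycle, so short cycles near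
  \<open>s\<close> are excluded. As the head of the path is \<open>s\<close>, the vertices violating
  this can be counted by lollipops.\<close>

definition treelike :: "(nat \<times> nat) set \<Rightarrow> nat \<Rightarrow> nat \<Rightarrow> bool" where
  "treelike E L s \<longleftrightarrow> \<not> (\<exists>p j. length p \<le> L \<and> hd p = s \<and> lollipop E p j)"

text \<open>The vertices of the path carry different levels, so the distinctness demanded by
  \<open>lollipop\<close> comes for free.\<close>

lemma shortest_path:
  assumes "v \<in> gball E r s"
  obtains q where "q 0 = s" "q (lev E s v) = v"
    "\<And>i. i < lev E s v \<Longrightarrow> q (Suc i) \<in> neigh E (q i)"
    "\<And>i. i \<le> lev E s v \<Longrightarrow> lev E s (q i) = i"
proof -
  have "\<exists>q. q 0 = s \<and> q m = v \<and> (\<forall>i<m. q (Suc i) \<in> neigh E (q i)) \<and> (\<forall>i\<le>m. lev E s (q i) = i)"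
    if "v \<in> gball E m s" "lev E s v = m" for m v
    using that
  proof (induction m arbitrary: v)
    case 0
    then show ?case by (intro exI[of _ "\<lambda>_. s"]) auto
  next
    case (Suc m)
    have "v \<notin> gball E m s" using lev_le[of v E m s] Suc.prems by auto
    then obtain w where w: "w \<in> gball E m s" "v \<in> neigh E w" using Suc.prems by auto
    have "lev E s w = m"
    proof (rule antisym)
      show "lev E s w \<le> m" using lev_le[OF w(1)] .
      have "v \<in> gball E (Suc (lev E s w)) s" using gball_neigh[OF in_gball_lev[OF w(1)] w(2)] .
      then show "m \<le> lev E s w" using lev_le[of v E "Suc (lev E s w)" s] Suc.prems by simp
    qed
    then obtain q where q: "q 0 = s" "q m = w" "\<forall>i<m. q (Suc i) \<in> neigh E (q i)" "\<forall>i\<le>m. lev E s (q i) = i"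
      using Suc.IH[OF w(1)] by blast
    show ?case
      by (rule exI[of _ "q(Suc m := v)"]) (use q w Suc.prems in \<open>auto simp: less_Suc_eq le_Suc_eq\<close>)
  qed
  then show ?thesis using that in_gball_lev[OF assms] by blast
qed

text \<open>Two such neighbours would give a lollipop: along a shortest path to \<open>u\<close>, on
  to \<open>v\<close> and \<open>u'\<close>, and back along a shortest path until just before it
  meets the first one, where the closing edge leads. It has at most (r + 1) + 1 + r vertices, whence
  2 * r + 2. Comparing levels by \<le> treats edges inside a level as well.\<close>

lemma treelike_unique_parent:
  assumes tree: "treelike E (2 * r + 2) s"
    and v: "v \<in> gball E r s" and u: "u \<in> gball E r s" "u \<in> neigh E v" "lev E s u \<le> lev E s v"
    and u': "u' \<in> gball E r s" "u' \<in> neigh E v" "lev E s u' \<le> lev E s v"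
    and irr: "v \<notin> neigh E v"
  shows "u = u'"
proof (rule ccontr)
  assume ne: "u \<noteq> u'"
  define a where "a = lev E s u"
  define b where "b = lev E s u'"
  have a: "a \<le> r" using lev_le[OF u(1)] a_def by simp
  have b: "b \<le> r" using lev_le[OF u'(1)] b_def by simp
  obtain q where q: "q 0 = s" "q a = u" "\<And>i. i < a \<Longrightarrow> q (Suc i) \<in> neigh E (q i)" "\<And>i. i \<le> a \<Longrightarrow> lev E s (q i) = i"
    using shortest_path[OF u(1)] unfolding a_def by blast
  obtain q' where q': "q' 0 = s" "q' b = u'" "\<And>i. i < b \<Longrightarrow> q' (Suc i) \<in> neigh E (q' i)" "\<And>i. i \<le> b \<Longrightarrow> lev E s (q' i) = i"
    using shortest_path[OF u'(1)] unfolding b_def by blast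
  \<comment> \<open>If \<open>v\<close> were on the path, its level could only be that of
    \<open>u\<close>, which forces \<open>v = u\<close> and a loop at \<open>v\<close>.\<close>
  have vq: "v \<noteq> q i" if "i \<le> a" for i
    using q(4)[OF that] that u(2,3) irr q(2) unfolding a_def by (metis le_antisym)
  have vq': "v \<noteq> q' i" if "i \<le> b" for i
    using q'(4)[OF that] that u'(2,3) irr q'(2) unfolding b_def by (metis le_antisym)
  have iq: "inj_on q {..a}" using q(4) by (metis atMost_iff inj_onI)
  have iq': "inj_on q' {..b}" using q'(4) by (metis atMost_iff inj_onI)
  let ?P = "map q [0..<Suc a]"
  have sP: "successively (\<lambda>v w. w \<in> neigh E v) ?P"
    unfolding successively_map successively_conv_nth using q(3) by (auto simp del: upt_Suc)
  have dP: "distinct ?P"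
    using iq by (auto simp: distinct_map atLeast0LessThan lessThan_Suc_atMost simp del: upt_Suc)
  have Pnth: "?P ! i = q i" if "i \<le> a" for i using that by (simp del: upt_Suc)
  have lP: "length ?P = Suc a" by simp
  have lastP: "last ?P = u" using q(2) by simp
  have hdP: "hd ?P = s" using q(1) by (simp add: hd_map del: upt_Suc)
  have setP: "set ?P = q ` {..a}" by (auto simp: atLeast0LessThan lessThan_Suc_atMost simp del: upt_Suc)
  have PnN: "?P \<noteq> []" by simp
  have nu: "v \<in> neigh E u" using u(2) neigh_sym by blast
  show False
  proof (cases "u' \<in> q ` {..a}")
    \<comment> \<open>The first path already contains \<open>u'\<close>, so prolonging it by
      \<open>v\<close> closes a cycle there.\<close>
    case True
    then obtain j where j: "j \<le> a" "u' = q j" by auto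
    then have ja: "j < a" using ne q(2) by (metis le_neq_implies_less)
    have "lollipop E (?P @ [v]) j"
      unfolding lollipop_def
    proof (intro conjI)
      show "distinct (?P @ [v])" using dP vq unfolding distinct_append setP by auto
      show "successively (\<lambda>v w. w \<in> neigh E v) (?P @ [v])"
        using sP lastP nu by (auto simp: successively_append_iff)
      show "j + 2 < length (?P @ [v])" using ja by simp
      show "(?P @ [v]) ! j \<in> neigh E (last (?P @ [v]))"
        using Pnth[of j] j u'(2) by (simp add: nth_append del: upt_Suc)
    qed
    moreover have "length (?P @ [v]) \<le> 2 * r + 2" using a by simp
    moreover have "hd (?P @ [v]) = s" using hdP by (simp add: hd_append del: upt_Suc)
    ultimately show False using tree unfolding treelike_def by blast
  next
    case False
    \<comment> \<open>The indices at which the second path meets the first. Index 0 is among them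
      since both start at \<open>s\<close>; beyond the largest one the paths are disjoint.\<close>
    define J where "J = {j. j \<le> b \<and> q' j \<in> q ` {..a}}"
    have "finite J" by (rule finite_subset[of _ "{..b}"]) (auto simp: J_def)
    moreover have "0 \<in> J" using q(1) q'(1) by (auto simp: J_def intro!: image_eqI[of _ _ 0])
    ultimately have MJ: "Max J \<in> J" and mJ: "\<And>j. j \<in> J \<Longrightarrow> j \<le> Max J"
      by (auto intro: Max_in)
    define m where "m = Max J"
    have mb: "m < b"
      using MJ False q'(2) unfolding m_def J_def by (metis (mono_tags, lifting) le_neq_implies_less mem_Collect_eq)
    obtain l where l: "l \<le> a" "q' m = q l" using MJ unfolding m_def J_def by auto
    have new: "q' j \<notin> q ` {..a}" if "m < j" "j \<le> b" for j
    proof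
      assume "q' j \<in> q ` {..a}"
      then have "j \<in> J" using that by (simp add: J_def)
      then show False using mJ[of j] that(1) by (simp add: m_def)
    qed
    let ?R = "map q' [Suc m..<Suc b]"
    have setR: "set ?R = q' ` {Suc m..b}" by (auto simp: atLeastLessThanSuc_atLeastAtMost simp del: upt_Suc)
    have RnN: "?R \<noteq> []" using mb by simp
    have lR: "last ?R = u'" using mb q'(2) by simp
    have hR: "hd ?R = q' (Suc m)" using mb by (simp add: hd_map del: upt_Suc)
    have sR: "successively (\<lambda>v w. w \<in> neigh E v) ?R"
      unfolding successively_map successively_conv_nth using q'(3) by (auto simp del: upt_Suc)
    have dR: "distinct ?R"
      using iq' unfolding distinct_map by (auto intro: inj_on_subset simp: atLeastLessThanSuc_atLeastAtMost simp del: upt_Suc)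
    let ?L = "?P @ v # rev ?R"
    have "lollipop E ?L l"
      unfolding lollipop_def
    proof (intro conjI)
      have "v \<notin> q ` {..a}" using vq by blast
      moreover have "v \<notin> q' ` {Suc m..b}" using vq' by force
      moreover have "q ` {..a} \<inter> q' ` {Suc m..b} = {}"
      proof -
        have "q' j \<notin> q ` {..a}" if "j \<in> {Suc m..b}" for j using new[of j] that by auto
        then have "x \<notin> q ` {..a}" if "x \<in> q' ` {Suc m..b}" for x using that by (metis imageE)
        then show ?thesis by blast
      qed
      ultimately show "distinct ?L"
        using dP dR unfolding distinct_append distinct.simps list.set set_rev setP setR distinct_rev by blast
      have "successively (\<lambda>v w. w \<in> neigh E v) (rev ?R)"
        using sR neigh_sym unfolding successively_rev by (metis (no_types, lifting) successively_mono)
      moreover have "hd (rev ?R) = u'" using lR RnN by (simp add: hd_rev del: upt_Suc)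
      ultimately show "successively (\<lambda>v w. w \<in> neigh E v) ?L"
        using sP lastP nu u'(2) by (auto simp: successively_append_iff successively_Cons simp del: upt_Suc)
      show "l + 2 < length ?L" using l mb by (simp del: upt_Suc)
      have "last ?L = q' (Suc m)" using hR RnN by (simp add: last_rev del: upt_Suc)
      moreover have "?L ! l = q l" using Pnth[OF l(1)] l by (simp add: nth_append del: upt_Suc)
      ultimately show "?L ! l \<in> neigh E (last ?L)"
        using q'(3)[OF mb] l(2) neigh_sym by metis
    qed
    moreover have "length ?L \<le> 2 * r + 2" using a b mb by (simp del: upt_Suc)
    moreover have "hd ?L = s" using hdP by (simp add: hd_append del: upt_Suc)
    ultimately show False using tree unfolding treelike_def by blast
  qed
qed


section \<open>Weighted edge sums and the cut bound\<close>

lemma sum_edge_ends: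
  assumes g: "is_graph n E"
  shows "(\<Sum>(i,j)\<in>E. f i + f j) = (\<Sum>v<n. real (card (neigh E v)) * f v)"
proof -
  have fin: "finite E" using finite_is_graph[OF g] .
  have "(\<Sum>v<n. real (card (neigh E v)) * f v) = (\<Sum>v<n. \<Sum>(a,b)\<in>{(a,b)\<in>E. a = v \<or> b = v}. f v)"
    by (simp add: card_neigh[OF g] degree_def)
  also have "\<dots> = (\<Sum>v<n. \<Sum>e\<in>E. if fst e = v \<or> snd e = v then f v else 0)"
    unfolding sum.inter_filter[OF fin, symmetric] by (intro sum.cong) auto
  also have "\<dots> = (\<Sum>e\<in>E. \<Sum>v<n. if fst e = v \<or> snd e = v then f v else 0)"
    by (rule sum.swap)
  also have "\<dots> = (\<Sum>(i,j)\<in>E. f i + f j)"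
  proof (rule sum.cong[OF refl], clarify)
    fix i j assume "(i, j) \<in> E"
    then have ij: "i < n" "j < n" "i \<noteq> j" using is_graph_bounds[OF g] by fastforce+
    have "(\<Sum>v<n. if i = v \<or> j = v then f v else 0) = (\<Sum>v<n. (if v = i then f v else 0) + (if v = j then f v else 0))"
      using ij by (intro sum.cong) auto
    also have "\<dots> = f i + f j" using ij by (simp add: sum.distrib)
    finally show "(\<Sum>v<n. if fst (i, j) = v \<or> snd (i, j) = v then f v else 0) = f i + f j" by simp
  qed
  finally show ?thesis by simp
qed

lemma sum_edge_ends_le:
  assumes g: "is_graph n E" and D: "\<And>i. i < n \<Longrightarrow> card (neigh E i) \<le> D"
    and f: "\<And>v. v < n \<Longrightarrow> 0 \<le> f v"
  shows "(\<Sum>(i,j)\<in>E. f i + f j) \<le> real D * (\<Sum>v<n. f v)"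
  unfolding sum_edge_ends[OF g] sum_distrib_left
  by (intro sum_mono mult_right_mono) (use D f in auto)

lemma re_cnj_mult_ge: "- Re (cnj a * b) \<le> ((cmod a)\<^sup>2 + (cmod b)\<^sup>2) / 2"
proof -
  have "- Re (cnj a * b) \<le> cmod (cnj a * b)" using abs_Re_le_cmod[of "cnj a * b"] by linarith
  also have "\<dots> = cmod a * cmod b" by (simp add: norm_mult)
  also have "\<dots> \<le> ((cmod a)\<^sup>2 + (cmod b)\<^sup>2) / 2"
    using sum_squares_bound[of "cmod a" "cmod b"] by simp
  finally show ?thesis .
qed

text \<open>On a tree every edge joins a vertex to its unique parent; weighting the child by \<open>sqrt D\<close>
  and the parent by \<open>1 / sqrt D\<close> in AM-GM balances one parent edge against \<open>D\<close> child edges.\<close>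
lemma treelike_edge_sum:
  fixes f :: "nat \<Rightarrow> complex"
  assumes g: "is_graph n E" and D: "0 < D" "\<And>i. i < n \<Longrightarrow> card (neigh E i) \<le> D"
    and tree: "treelike E (2 * r + 2) s"
    and supp: "\<And>v. v < n \<Longrightarrow> v \<notin> gball E r s \<Longrightarrow> f v = 0"
  shows "- (\<Sum>(i,j)\<in>E. Re (cnj (f i) * f j)) \<le> sqrt D * (\<Sum>v<n. (cmod (f v))\<^sup>2)"
proof -
  let ?B = "gball E r s"
  define E' where "E' = {(i,j)\<in>E. i \<in> ?B \<and> j \<in> ?B}"
  \<comment> \<open>Ties are broken by storage order; the uniqueness of parents is available for
    equal levels too.\<close>
  define child where "child = (\<lambda>(i,j). if lev E s i \<le> lev E s j then j else i)"
  define parent where "parent = (\<lambda>(i,j). if lev E s i \<le> lev E s j then i else j)"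
  have fin: "finite E" "finite E'" using finite_is_graph[OF g] unfolding E'_def
    by (auto intro: finite_subset[of _ E])
  have sub: "E' \<subseteq> E" by (auto simp: E'_def)
  \<comment> \<open>A child determines its parent, hence its edge, so every vertex is charged as a
    child at most once.\<close>
  have inj: "inj_on child E'"
  proof (rule inj_onI)
    fix e e' assume e: "e \<in> E'" "e' \<in> E'" and c: "child e = child e'"
    have *: "parent e \<in> ?B \<and> child e \<in> ?B \<and> parent e \<in> neigh E (child e) \<and> lev E s (parent e) \<le> lev E s (child e)
        \<and> e = (min (child e) (parent e), max (child e) (parent e))" if "e \<in> E'" for e
      using that is_graph_bounds[OF g, of "fst e" "snd e"]
      by (cases e) (auto simp: E'_def parent_def child_def neigh_def min_def max_def)
    have "parent e = parent e'"
      by (rule treelike_unique_parent[OF tree, of "child e"]) (use *[OF e(1)] *[OF e(2)] c neigh_less[OF g] in auto)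
    then show "e = e'" using *[OF e(1)] *[OF e(2)] c by metis
  qed
  have cn: "child ` E' \<subseteq> {..<n}"
    using is_graph_bounds[OF g] by (fastforce simp: child_def E'_def)
  have sD: "0 < sqrt (real D)" using D by simp
  have "- (\<Sum>(i,j)\<in>E. Re (cnj (f i) * f j)) = - (\<Sum>(i,j)\<in>E'. Re (cnj (f i) * f j))"
  proof -
    have "(\<Sum>(i,j)\<in>E'. Re (cnj (f i) * f j)) = (\<Sum>(i,j)\<in>E. Re (cnj (f i) * f j))"
    proof (rule sum.mono_neutral_left[OF fin(1) sub], clarify)
      fix i j assume ij: "(i, j) \<in> E" "(i, j) \<notin> E'"
      then have "f i = 0 \<or> f j = 0" using supp is_graph_bounds[OF g ij(1)] by (auto simp: E'_def)
      then show "Re (cnj (f i) * f j) = 0" by auto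
    qed
    then show ?thesis by simp
  qed
  also have "\<dots> \<le> (\<Sum>e\<in>E'. sqrt D / 2 * (cmod (f (child e)))\<^sup>2 + 1 / (2 * sqrt D) * (cmod (f (parent e)))\<^sup>2)"
    unfolding sum_negf[symmetric]
  proof (rule sum_mono)
    fix e assume "e \<in> E'"
    obtain i j where e: "e = (i, j)" by fastforce
    have "- Re (cnj (f i) * f j) \<le> cmod (f (child e)) * cmod (f (parent e))"
      using abs_Re_le_cmod[of "cnj (f i) * f j"] by (auto simp: e child_def parent_def norm_mult mult.commute)
    also have "\<dots> \<le> sqrt D / 2 * (cmod (f (child e)))\<^sup>2 + 1 / (2 * sqrt D) * (cmod (f (parent e)))\<^sup>2"
    proof -
      let ?x = "cmod (f (child e))" and ?y = "cmod (f (parent e))"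
      have "0 \<le> (sqrt D * ?x - ?y)\<^sup>2 / (2 * sqrt D)" by (intro divide_nonneg_pos) (use sD in auto)
      also have "\<dots> = sqrt D / 2 * ?x\<^sup>2 + 1 / (2 * sqrt D) * ?y\<^sup>2 - ?x * ?y"
        using sD by (simp add: power2_eq_square field_simps)
      finally show ?thesis by simp
    qed
    finally show "- (case e of (i, j) \<Rightarrow> Re (cnj (f i) * f j)) \<le> sqrt D / 2 * (cmod (f (child e)))\<^sup>2 + 1 / (2 * sqrt D) * (cmod (f (parent e)))\<^sup>2"
      by (simp add: e)
  qed
  also have "\<dots> = sqrt D / 2 * (\<Sum>e\<in>E'. (cmod (f (child e)))\<^sup>2) + 1 / (2 * sqrt D) * (\<Sum>e\<in>E'. (cmod (f (parent e)))\<^sup>2)"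
    by (simp add: sum.distrib sum_distrib_left)
  also have "\<dots> \<le> sqrt D / 2 * (\<Sum>v<n. (cmod (f v))\<^sup>2) + 1 / (2 * sqrt D) * (real D * (\<Sum>v<n. (cmod (f v))\<^sup>2))"
  proof (intro add_mono mult_left_mono)
    have "(\<Sum>e\<in>E'. (cmod (f (child e)))\<^sup>2) = (\<Sum>v\<in>child ` E'. (cmod (f v))\<^sup>2)"
      using inj by (simp add: sum.reindex)
    also have "\<dots> \<le> (\<Sum>v<n. (cmod (f v))\<^sup>2)" using cn by (intro sum_mono2) auto
    finally show "(\<Sum>e\<in>E'. (cmod (f (child e)))\<^sup>2) \<le> (\<Sum>v<n. (cmod (f v))\<^sup>2)" .
    \<comment> \<open>A vertex may be the parent in up to \<open>D\<close> edges; charging both ends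
      of every edge is enough.\<close>
    have "(\<Sum>e\<in>E'. (cmod (f (parent e)))\<^sup>2) \<le> (\<Sum>(i,j)\<in>E'. (cmod (f i))\<^sup>2 + (cmod (f j))\<^sup>2)"
      by (intro sum_mono) (auto simp: parent_def)
    also have "\<dots> \<le> (\<Sum>(i,j)\<in>E. (cmod (f i))\<^sup>2 + (cmod (f j))\<^sup>2)"
      using fin sub by (intro sum_mono2) auto
    also have "\<dots> \<le> real D * (\<Sum>v<n. (cmod (f v))\<^sup>2)"
      by (rule sum_edge_ends_le[OF g D(2)]) auto
    finally show "(\<Sum>e\<in>E'. (cmod (f (parent e)))\<^sup>2) \<le> real D * (\<Sum>v<n. (cmod (f v))\<^sup>2)" .
  qed (use sD in auto)
  also have "\<dots> = sqrt D * (\<Sum>v<n. (cmod (f v))\<^sup>2)"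
  proof -
    have *: "1 / (2 * sqrt D) * real D = sqrt D / 2"
      using sD real_sqrt_mult_self[of D] by (simp add: field_simps)
    show ?thesis unfolding mult.assoc[of "1 / (2 * sqrt D)", symmetric] * by simp
  qed
  finally show ?thesis .
qed

text \<open>Each \<open>a i\<close> is cut down to \<open>b i\<close>, its part on sets inside the
  ball around \<open>i\<close>; the rest \<open>c i\<close> has norm at most sqrt(n \<delta>) and
  enters each edge twice. For fixed \<open>S\<close> the \<open>b\<close>-part vanishes if
  \<open>S\<close> is empty, is supported in a tree if \<open>S\<close> has a treelike vertex, and
  otherwise lives on \<open>bad\<close>, where the trivial estimate by the degree suffices.
  Summation over \<open>S\<close> uses that \<open>b i\<close> has norm at most one.\<close>

lemma cut_bound_of_light_cone:
  fixes a :: "nat \<Rightarrow> nat set \<Rightarrow> complex"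
  assumes g: "is_graph n E" and D: "0 < D" "\<And>i. i < n \<Longrightarrow> card (neigh E i) \<le> D"
    and norm: "\<And>i. i < n \<Longrightarrow> (\<Sum>S\<in>basis n. (cmod (a i S))\<^sup>2) = 1"
    and empty: "\<And>i. i < n \<Longrightarrow> a i {} = 0"
    and tail: "\<And>i k. i < n \<Longrightarrow> k < n \<Longrightarrow> i \<notin> gball E r k \<Longrightarrow> (\<Sum>S\<in>{S\<in>basis n. k \<in> S}. (cmod (a i S))\<^sup>2) \<le> \<delta>"
    and \<delta>: "0 \<le> \<delta>"
  defines "bad \<equiv> {i. i < n \<and> (\<exists>s<n. \<not> treelike E (2 * r + 2) s \<and> s \<in> gball E r i)}"
  shows "(\<Sum>(i,j)\<in>E. (1 - Re (\<Sum>S\<in>basis n. cnj (a i S) * a j S)) / 2)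
    \<le> real D / 4 * n + sqrt D / 2 * n + real D / 4 * card bad + real D / 2 * n * sqrt (n * \<delta>)"
proof -
  have fin: "finite E" using finite_is_graph[OF g] .
  have edge: "i < n \<and> j < n" if "(i, j) \<in> E" for i j using is_graph_bounds[OF g that] by auto
  define b where "b = (\<lambda>i S. if S \<subseteq> gball E r i then a i S else 0)"
  define c where "c = (\<lambda>i S. if S \<subseteq> gball E r i then 0 else a i S)"
  have abc: "a i S = b i S + c i S" for i S by (simp add: b_def c_def)
  have na: "nrm n (a i) = 1" if "i < n" for i using norm[OF that] by (simp add: nrm_def L2_set_def)
  have nb2: "(\<Sum>S\<in>basis n. (cmod (b i S))\<^sup>2) \<le> 1" if "i < n" for i
    unfolding norm[OF that, symmetric] by (intro sum_mono) (auto simp: b_def)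
  have nb: "nrm n (b i) \<le> 1" if "i < n" for i
    using nb2[OF that] by (simp add: nrm_def L2_set_def)
  have nc: "nrm n (c i) \<le> sqrt (n * \<delta>)" if i: "i < n" for i
  proof -
    \<comment> \<open>A union bound: a set not inside the ball contains some vertex \<open>k\<close>
      outside it.\<close>
    have "(\<Sum>S\<in>basis n. (cmod (c i S))\<^sup>2) \<le> (\<Sum>S\<in>basis n. \<Sum>k<n. if k \<in> S \<and> k \<notin> gball E r i then (cmod (a i S))\<^sup>2 else 0)"
    proof (rule sum_mono)
      fix S assume S: "S \<in> basis n"
      show "(cmod (c i S))\<^sup>2 \<le> (\<Sum>k<n. if k \<in> S \<and> k \<notin> gball E r i then (cmod (a i S))\<^sup>2 else 0)"
      proof (cases "S \<subseteq> gball E r i")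
        case True
        then show ?thesis by (simp add: c_def sum_nonneg)
      next
        case False
        then obtain k where k: "k \<in> S" "k \<notin> gball E r i" by blast
        then have "k < n" using S by (auto simp: basis_def)
        have "(cmod (c i S))\<^sup>2 = (if k \<in> S \<and> k \<notin> gball E r i then (cmod (a i S))\<^sup>2 else 0)"
          using k False by (simp add: c_def)
        also have "\<dots> \<le> (\<Sum>k<n. if k \<in> S \<and> k \<notin> gball E r i then (cmod (a i S))\<^sup>2 else 0)"
          by (rule member_le_sum) (use \<open>k < n\<close> in auto)
        finally show ?thesis .
      qed
    qed
    also have "\<dots> = (\<Sum>k<n. \<Sum>S\<in>basis n. if k \<in> S \<and> k \<notin> gball E r i then (cmod (a i S))\<^sup>2 else 0)"
      by (rule sum.swap)
    also have "\<dots> \<le> (\<Sum>k<n. \<delta>)"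
    proof (rule sum_mono)
      fix k assume "k \<in> {..<n}"
      then have k: "k < n" by simp
      show "(\<Sum>S\<in>basis n. if k \<in> S \<and> k \<notin> gball E r i then (cmod (a i S))\<^sup>2 else 0) \<le> \<delta>"
      proof (cases "k \<in> gball E r i")
        case False
        then have "i \<notin> gball E r k" using gball_sym by blast
        from tail[OF i k this] show ?thesis using False by (simp add: sum.inter_filter)
      qed (simp add: \<delta>)
    qed
    finally show ?thesis by (simp add: nrm_def L2_set_def)
  qed
  have approx: "- Re (inn n (a i) (a j)) \<le> - Re (inn n (b i) (b j)) + 2 * sqrt (n * \<delta>)" if "(i, j) \<in> E" for i j
  proof -
    have ij: "i < n" "j < n" using edge[OF that] by auto
    have "inn n (a i) (a j) = inn n (b i) (b j) + inn n (c i) (a j) + inn n (b i) (c j)"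
      unfolding inn_def sum.distrib[symmetric] by (intro sum.cong refl) (simp add: abc algebra_simps)
    moreover have "cmod (inn n (c i) (a j)) \<le> sqrt (n * \<delta>)"
      using inn_cauchy_schwarz[of n "c i" "a j"] nc[OF ij(1)] na[OF ij(2)] by simp
    moreover have "cmod (inn n (b i) (c j)) \<le> 1 * sqrt (n * \<delta>)"
      using order_trans[OF inn_cauchy_schwarz mult_mono[OF nb[OF ij(1)] nc[OF ij(2)]]] by simp
    ultimately show ?thesis
      using abs_Re_le_cmod[of "inn n (c i) (a j)"] abs_Re_le_cmod[of "inn n (b i) (c j)"] by simp
  qed
  have layer: "- (\<Sum>(i,j)\<in>E. Re (cnj (b i S) * b j S)) \<le> sqrt D * (\<Sum>i<n. (cmod (b i S))\<^sup>2) + real D / 2 * (\<Sum>i\<in>bad. (cmod (b i S))\<^sup>2)"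
    if S: "S \<in> basis n" for S
  proof -
    have nn: "0 \<le> sqrt D * (\<Sum>i<n. (cmod (b i S))\<^sup>2)" "0 \<le> real D / 2 * (\<Sum>i\<in>bad. (cmod (b i S))\<^sup>2)"
      by (auto intro!: mult_nonneg_nonneg sum_nonneg)
    consider "S = {}" | s where "s \<in> S" "treelike E (2 * r + 2) s"
      | "S \<noteq> {}" "\<And>s. s \<in> S \<Longrightarrow> \<not> treelike E (2 * r + 2) s" by blast
    then show ?thesis
    proof cases
      case 1
      then have "Re (cnj (b i S) * b j S) = 0" if "(i, j) \<in> E" for i j
        using empty edge[OF that] by (simp add: b_def)
      then have "(\<Sum>(i,j)\<in>E. Re (cnj (b i S) * b j S)) = 0" by (intro sum.neutral) auto
      then show ?thesis using nn by simp
    next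
      case 2
      \<comment> \<open>If \<open>S\<close> lies in the ball around \<open>v\<close>, then so does
        \<open>s\<close>, and by symmetry \<open>v\<close> lies in the ball around
        \<open>s\<close>.\<close>
      have "b v S = 0" if "v \<notin> gball E r s" for v
        using that 2(1) gball_sym[of v E r s] by (auto simp: b_def)
      from treelike_edge_sum[OF g D 2(2), of "\<lambda>v. b v S"] this show ?thesis using nn by force
    next
      case 3
      have z: "b i S = 0" if "i < n" "i \<notin> bad" for i
      proof (rule ccontr)
        assume "b i S \<noteq> 0"
        then have "S \<subseteq> gball E r i" by (auto simp: b_def split: if_splits)
        moreover obtain s where "s \<in> S" using 3(1) by blast
        moreover have "s < n" using S \<open>s \<in> S\<close> by (auto simp: basis_def)
        ultimately have "i \<in> bad" unfolding bad_def using 3(2) that(1) by blast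
        then show False using that by simp
      qed
      have "- (\<Sum>(i,j)\<in>E. Re (cnj (b i S) * b j S)) \<le> (\<Sum>(i,j)\<in>E. (cmod (b i S))\<^sup>2 / 2 + (cmod (b j S))\<^sup>2 / 2)"
        unfolding sum_negf[symmetric] using re_cnj_mult_ge by (intro sum_mono) (auto simp: add_divide_distrib)
      also have "\<dots> \<le> real D * (\<Sum>v<n. (cmod (b v S))\<^sup>2 / 2)"
        by (rule sum_edge_ends_le[OF g D(2)]) auto
      also have "(\<Sum>v<n. (cmod (b v S))\<^sup>2 / 2) = (\<Sum>v\<in>bad. (cmod (b v S))\<^sup>2 / 2)"
        using z by (intro sum.mono_neutral_right) (auto simp: bad_def)
      finally show ?thesis using nn by (simp add: sum_divide_distrib[symmetric])
    qed
  qed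
  have swap: "(\<Sum>(i,j)\<in>E. Re (inn n (b i) (b j))) = (\<Sum>S\<in>basis n. \<Sum>(i,j)\<in>E. Re (cnj (b i S) * b j S))"
    unfolding inn_def case_prod_beta Re_sum by (rule sum.swap)
  have "- (\<Sum>(i,j)\<in>E. Re (inn n (b i) (b j))) \<le> (\<Sum>S\<in>basis n. sqrt D * (\<Sum>i<n. (cmod (b i S))\<^sup>2) + real D / 2 * (\<Sum>i\<in>bad. (cmod (b i S))\<^sup>2))"
    unfolding swap sum_negf[symmetric] using layer by (intro sum_mono) (simp add: sum_negf)
  also have "\<dots> = sqrt D * (\<Sum>i<n. \<Sum>S\<in>basis n. (cmod (b i S))\<^sup>2) + real D / 2 * (\<Sum>i\<in>bad. \<Sum>S\<in>basis n. (cmod (b i S))\<^sup>2)"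
    unfolding sum.distrib sum_distrib_left[symmetric] by (simp only: sum.swap[of _ _ "basis n"])
  also have "\<dots> \<le> sqrt D * (\<Sum>i<n. 1) + real D / 2 * (\<Sum>i\<in>bad. 1)"
    using nb2 by (intro add_mono mult_left_mono sum_mono) (auto simp: bad_def)
  finally have B: "- (\<Sum>(i,j)\<in>E. Re (inn n (b i) (b j))) \<le> sqrt D * n + real D / 2 * card bad" by simp
  have cE: "real (card E) \<le> real D / 2 * n"
    using sum_edge_ends_le[OF g D(2), of "\<lambda>_. 1 / 2"] by simp
  have "(\<Sum>(i,j)\<in>E. (1 - Re (\<Sum>S\<in>basis n. cnj (a i S) * a j S)) / 2) = (\<Sum>(i,j)\<in>E. (1 - Re (inn n (a i) (a j))) / 2)"
    by (simp add: inn_def)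
  also have "\<dots> \<le> (\<Sum>(i,j)\<in>E. (1 + 2 * sqrt (n * \<delta>)) / 2 - Re (inn n (b i) (b j)) / 2)"
    using approx by (intro sum_mono) (fastforce simp: field_simps)
  also have "\<dots> = (1 + 2 * sqrt (n * \<delta>)) / 2 * card E + - (\<Sum>(i,j)\<in>E. Re (inn n (b i) (b j))) / 2"
    by (simp add: case_prod_beta sum_subtractf sum_divide_distrib)
  also have "\<dots> \<le> (1 + 2 * sqrt (n * \<delta>)) / 2 * (real D / 2 * n) + (sqrt D * n + real D / 2 * card bad) / 2"
    using cE B \<delta> by (intro add_mono mult_left_mono divide_right_mono) auto
  finally show ?thesis by (simp add: field_simps)
qed

section \<open>Short cycles in random regular bipartite graphs\<close>


text \<open>Normal form of an unordered pair, which spares the switchings a case split on the order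
  of their vertices.\<close>

definition edge :: "nat \<Rightarrow> nat \<Rightarrow> nat \<times> nat" where
  "edge i j = (min i j, max i j)"

lemma edge_eq_iff: "edge i j = edge k l \<longleftrightarrow> i = k \<and> j = l \<or> i = l \<and> j = k"
  by (auto simp: edge_def min_def max_def)

lemma edge_commute: "edge i j = edge j i"
  by (simp add: edge_eq_iff)

lemma neigh_iff_edge: "is_graph n E \<Longrightarrow> j \<in> neigh E i \<longleftrightarrow> edge i j \<in> E"
  using is_graph_bounds[of n E i j] is_graph_bounds[of n E j i]
  by (auto simp: neigh_def edge_def min_def max_def)

lemma edge_of_mem: "is_graph n E \<Longrightarrow> (i, j) \<in> E \<Longrightarrow> edge i j = (i, j)"
  using is_graph_bounds[of n E i j] by (simp add: edge_def)

lemma mem_edge: "is_graph n E \<Longrightarrow> e \<in> E \<Longrightarrow> e = edge (fst e) (snd e)"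
  using edge_of_mem[of n E "fst e" "snd e"] by simp

lemma finite_reg_bip_graphs [simp]: "finite (reg_bip_graphs n d)"
proof (rule finite_subset)
  show "reg_bip_graphs n d \<subseteq> Pow ({..<n} \<times> {..<n})"
    by (auto simp: reg_bip_graphs_def is_graph_def)
qed simp

lemma reg_bip_graphs_iff:
  "E \<in> reg_bip_graphs n d \<longleftrightarrow> is_graph n E \<and> (\<forall>v<n. card (neigh E v) = d)
     \<and> (\<exists>A. \<forall>v w. w \<in> neigh E v \<longrightarrow> (v \<in> A \<longleftrightarrow> w \<notin> A))"
proof -
  have "(\<forall>(i,j)\<in>E. i \<in> A \<longleftrightarrow> j \<notin> A) \<longleftrightarrow> (\<forall>v w. w \<in> neigh E v \<longrightarrow> (v \<in> A \<longleftrightarrow> w \<notin> A))" for A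
    unfolding neigh_def by blast
  then show ?thesis
    by (auto simp: reg_bip_graphs_def regular_def bipartite_def card_neigh)
qed

lemma card_edges_regular:
  assumes "is_graph n E" "\<And>v. v < n \<Longrightarrow> card (neigh E v) = d"
  shows "2 * card E = n * d"
proof -
  have "real (2 * card E) = real (n * d)"
    using sum_edge_ends[OF assms(1), of "\<lambda>_. 1"] assms(2) by (simp add: case_prod_beta)
  then show ?thesis by (simp only: of_nat_eq_iff)
qed

text \<open>The classical switching of two edges a-b and c-e into a-e and c-b; it respects a
  two-colouring when \<open>a\<close> and \<open>c\<close> lie on the same side.\<close>

definition switch :: "nat \<Rightarrow> nat \<Rightarrow> nat \<Rightarrow> nat \<Rightarrow> (nat \<times> nat) set \<Rightarrow> (nat \<times> nat) set" where
  "switch a b c e E = (E - {edge a b, edge c e}) \<union> {edge a e, edge c b}"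

text \<open>The two non-adjacencies make both added edges new, so all degrees are kept. The last
  conclusion undoes the switching from its four vertices, which gives injectivity in the double
  counting.\<close>

lemma switch_in_reg_bip_graphs:
  assumes E: "E \<in> reg_bip_graphs n d"
    and A: "\<And>v w. w \<in> neigh E v \<Longrightarrow> v \<in> A \<longleftrightarrow> w \<notin> A"
    and ab: "b \<in> neigh E a" and ce: "e \<in> neigh E c" and ac: "a \<in> A \<longleftrightarrow> c \<in> A"
    and nbc: "c \<notin> neigh E b" and nae: "e \<notin> neigh E a"
  shows "switch a b c e E \<in> reg_bip_graphs n d"
    and "e \<in> neigh (switch a b c e E) a" and "c \<in> neigh (switch a b c e E) b"
    and "(switch a b c e E - {edge a e, edge c b}) \<union> {edge a b, edge c e} = E"
proof -
  have g: "is_graph n E" and deg: "\<And>v. v < n \<Longrightarrow> card (neigh E v) = d"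
    using E by (auto simp: reg_bip_graphs_iff)
  let ?E = "switch a b c e E"
  have ba: "a \<in> neigh E b" and ec: "c \<in> neigh E e" using ab ce neigh_sym by auto
  have lt: "a < n" "b < n" "c < n" "e < n" using neigh_less[OF g] ab ba ce ec by auto
  \<comment> \<open>Vertices of opposite colour differ; \<open>a = c\<close> or \<open>b = e\<close>
    would contradict the assumed non-adjacencies.\<close>
  have ne: "a \<noteq> b" "c \<noteq> e" "a \<noteq> e" "c \<noteq> b" "a \<noteq> c" "b \<noteq> e"
    using A[OF ab] A[OF ce] ac nbc ba nae ab by auto
  have g': "is_graph n ?E"
    using g lt ne by (auto simp: switch_def is_graph_def edge_def min_def max_def)
  have nb: "w \<in> neigh ?E v \<longleftrightarrow> edge v w \<in> ?E" for v w by (rule neigh_iff_edge[OF g'])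
  have nbE: "w \<in> neigh E v \<longleftrightarrow> edge v w \<in> E" for v w by (rule neigh_iff_edge[OF g])
  show "e \<in> neigh ?E a" "c \<in> neigh ?E b"
    unfolding nb by (auto simp: switch_def edge_commute)
  show "(?E - {edge a e, edge c b}) \<union> {edge a b, edge c e} = E"
    using ab ce nbc nae by (auto simp: nbE switch_def edge_commute[of c b])
  have na: "neigh ?E a = insert e (neigh E a - {b})"
    unfolding set_eq_iff nb using ne by (auto simp: nbE switch_def edge_eq_iff)
  have nc: "neigh ?E c = insert b (neigh E c - {e})"
    unfolding set_eq_iff nb using ne by (auto simp: nbE switch_def edge_eq_iff)
  have nb': "neigh ?E b = insert c (neigh E b - {a})"
    unfolding set_eq_iff nb using ne by (auto simp: nbE switch_def edge_eq_iff)
  have ne': "neigh ?E e = insert a (neigh E e - {c})"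
    unfolding set_eq_iff nb using ne by (auto simp: nbE switch_def edge_eq_iff)
  have no: "neigh ?E v = neigh E v" if "v \<notin> {a, b, c, e}" for v
    unfolding set_eq_iff nb using that by (auto simp: nbE switch_def edge_eq_iff)
  have swap: "card (insert y (X - {x})) = card X" if "finite X" "x \<in> X" "y \<notin> X" for x y :: nat and X
    using that card_Suc_Diff1[of X x] by simp
  have fin: "finite (neigh E v)" for v by (rule finite_neigh[OF g])
  have "card (neigh ?E v) = d" if v: "v < n" for v
  proof -
    have "card (neigh ?E v) = card (neigh E v)"
    proof (cases "v \<in> {a, b, c, e}")
      case True
      then show ?thesis
        using swap[OF fin ab nae] swap[OF fin ba nbc] swap[OF fin ce, of b] swap[OF fin ec, of a]
          nbc nae neigh_sym[of b E c] neigh_sym[of a E e] na nb' nc ne' by auto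
    qed (simp add: no)
    then show ?thesis using deg[OF v] by simp
  qed
  moreover have "v \<in> A \<longleftrightarrow> w \<notin> A" if "w \<in> neigh ?E v" for v w
    using that A[of w v] A[OF ab] A[OF ce] ac unfolding nb unfolding nbE switch_def
    by (auto simp: edge_eq_iff)
  ultimately show "?E \<in> reg_bip_graphs n d" using g' unfolding reg_bip_graphs_iff by blast
qed

definition num_containing :: "nat \<Rightarrow> nat \<Rightarrow> (nat \<times> nat) set \<Rightarrow> nat" where
  "num_containing n d F = card {E \<in> reg_bip_graphs n d. F \<subseteq> E}"

text \<open>Double counting: each graph containing \<open>(a, b)\<close> admits at least \<open>m\<close> switchings that destroy it
  and keep \<open>F\<close>, and at most \<open>d\<^sup>2\<close> switchings lead back from a given graph.  Only the forward direction
  must respect a two-colouring, so any colouring of the initial graph will do.\<close>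
lemma num_containing_insert:
  assumes F: "finite F" "(a, b) \<notin> F"
    and big: "card F + 2 * d\<^sup>2 + m \<le> card E0" and E0: "\<And>E. E \<in> reg_bip_graphs n d \<Longrightarrow> card E = card E0"
  shows "num_containing n d (insert (a, b) F) * m \<le> num_containing n d F * d\<^sup>2"
proof -
  let ?G = "\<lambda>F. {E \<in> reg_bip_graphs n d. F \<subseteq> E}"
  let ?F = "insert (a, b) F"
  have "\<forall>E\<in>reg_bip_graphs n d. \<exists>A. \<forall>v w. w \<in> neigh E v \<longrightarrow> (v \<in> A \<longleftrightarrow> w \<notin> A)"
    by (auto simp: reg_bip_graphs_iff)
  from bchoice[OF this] obtain A where
    A: "\<And>E v w. E \<in> reg_bip_graphs n d \<Longrightarrow> w \<in> neigh E v \<Longrightarrow> v \<in> A E \<longleftrightarrow> w \<notin> A E" by blast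
  \<comment> \<open>The first end is put on the side of \<open>a\<close>, as a switching requires of
    \<open>c\<close>.\<close>
  define orient where "orient = (\<lambda>E (i, j). if i \<in> A E \<longleftrightarrow> a \<in> A E then (i, j) else (j, i :: nat))"
  \<comment> \<open>Partner edges have to avoid all neighbours of \<open>a\<close> and
    \<open>b\<close>. This rules out at most 2 d vertices with d edges each, among these edges (a,
    b) itself, and secures the non-adjacencies.\<close>
  define near where "near = (\<lambda>E. \<Union>v\<in>neigh E a \<union> neigh E b. {(i, j). (i, j) \<in> E \<and> (i = v \<or> j = v)})"
  define W where "W = (\<lambda>E. orient E ` (E - F - near E))"
  have gE: "is_graph n E" and degE: "\<And>v. v < n \<Longrightarrow> card (neigh E v) = d" if "E \<in> ?G ?F" for E
    using that by (auto simp: reg_bip_graphs_iff)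
  have abE: "b \<in> neigh E a" if "E \<in> ?G ?F" for E
    using that by (auto simp: neigh_def)
  have edge_ab: "edge a b = (a, b)" if "E \<in> ?G ?F" for E
    using edge_of_mem[OF gE[OF that], of a b] that by auto
  have W_card: "m \<le> card (W E)" if E: "E \<in> ?G ?F" for E
  proof -
    have fin: "finite E" by (rule finite_is_graph[OF gE[OF E]])
    have ab: "a < n" "b < n" using E is_graph_bounds[OF gE[OF E], of a b] by auto
    have "card (near E) \<le> (\<Sum>v\<in>neigh E a \<union> neigh E b. card {(i, j). (i, j) \<in> E \<and> (i = v \<or> j = v)})"
      unfolding near_def by (rule card_UN_le) (simp add: finite_neigh[OF gE[OF E]])
    also have "\<dots> = (\<Sum>v\<in>neigh E a \<union> neigh E b. d)"
    proof (rule sum.cong[OF refl])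
      fix v assume "v \<in> neigh E a \<union> neigh E b"
      then have "v < n" using neigh_less[OF gE[OF E]] by auto
      then show "card {(i, j). (i, j) \<in> E \<and> (i = v \<or> j = v)} = d"
        using degE[OF E] card_neigh[OF gE[OF E], of v] by (simp add: degree_def)
    qed
    also have "\<dots> \<le> (d + d) * d"
      using card_Un_le[of "neigh E a" "neigh E b"] degE[OF E] ab by simp
    finally have near: "card (near E) \<le> 2 * d\<^sup>2" by (simp add: power2_eq_square algebra_simps)
    have "finite (near E)" by (rule finite_subset[OF _ fin]) (auto simp: near_def)
    then have "card E - card F - card (near E) \<le> card (E - F - near E)"
      using diff_card_le_card_Diff[OF F(1), of E] diff_card_le_card_Diff[of "near E" "E - F"] by linarith
    moreover have "inj_on (orient E) E"
    proof (rule inj_onI)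
      fix x y assume xy: "x \<in> E" "y \<in> E" "orient E x = orient E y"
      have "edge (fst (orient E z)) (snd (orient E z)) = z" if "z \<in> E" for z
      proof -
        obtain i j where z: "z = (i, j)" by fastforce
        have "edge i j = (i, j)" using mem_edge[OF gE[OF E] that] z by simp
        moreover have "edge j i = edge i j" by (rule edge_commute)
        ultimately show ?thesis by (simp add: orient_def z)
      qed
      then show "x = y" using xy by metis
    qed
    then have "card (W E) = card (E - F - near E)"
      unfolding W_def by (intro card_image) (auto intro: inj_on_subset)
    ultimately show ?thesis using near big E0[of E] E by simp
  qed
  have W_valid: "e \<in> neigh E c \<and> (a \<in> A E \<longleftrightarrow> c \<in> A E) \<and> c \<notin> neigh E b \<and> e \<notin> neigh E a \<and> edge c e \<notin> F"
    if E: "E \<in> ?G ?F" and ce: "(c, e) \<in> W E" for E c e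
  proof -
    obtain i j where ij: "(i, j) \<in> E" "(i, j) \<notin> F" "(i, j) \<notin> near E" "(c, e) = orient E (i, j)"
      using ce unfolding W_def by auto
    have "i \<notin> neigh E a \<union> neigh E b" "j \<notin> neigh E a \<union> neigh E b" using ij(1,3) unfolding near_def by auto
    moreover have "j \<in> neigh E i" "i \<in> neigh E j" using ij(1) by (auto simp: neigh_def)
    moreover have "edge i j = (i, j)" by (rule edge_of_mem[OF gE[OF E] ij(1)])
    moreover have "i \<in> A E \<longleftrightarrow> j \<notin> A E" using A[of E j i] E \<open>j \<in> neigh E i\<close> by auto
    ultimately show ?thesis using ij(2,4) by (auto simp: orient_def edge_commute split: if_splits)
  qed
  \<comment> \<open>After a switching \<open>c\<close> is a neighbour of \<open>b\<close> and
    \<open>e\<close> one of \<open>a\<close>, so \<open>?Y\<close> has at most d^2 codes for each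
    resulting graph.\<close>
  let ?X = "SIGMA E:?G ?F. W E" and ?Y = "SIGMA E:?G F. neigh E b \<times> neigh E a"
  let ?\<phi> = "\<lambda>(E, c, e). (switch a b c e E, c, e)"
  have finG: "finite (?G F)" for F by simp
  have finW: "finite (W E)" if "E \<in> ?G ?F" for E
    unfolding W_def using finite_is_graph[OF gE[OF that]] by auto
  have sw: "switch a b c e E \<in> reg_bip_graphs n d" "e \<in> neigh (switch a b c e E) a" "c \<in> neigh (switch a b c e E) b"
    "(switch a b c e E - {edge a e, edge c b}) \<union> {edge a b, edge c e} = E" "F \<subseteq> switch a b c e E"
    if E: "E \<in> ?G ?F" and ce: "(c, e) \<in> W E" for E c e
  proof -
    have "E \<in> reg_bip_graphs n d" using E by simp
    note * = switch_in_reg_bip_graphs[OF this A[OF this] abE[OF E]]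
    note v = W_valid[OF E ce]
    show "switch a b c e E \<in> reg_bip_graphs n d" "e \<in> neigh (switch a b c e E) a" "c \<in> neigh (switch a b c e E) b"
      "(switch a b c e E - {edge a e, edge c b}) \<union> {edge a b, edge c e} = E"
      using * v by blast+
    show "F \<subseteq> switch a b c e E" using E v F(2) edge_ab[OF E] by (auto simp: switch_def)
  qed
  have img: "?\<phi> ` ?X \<subseteq> ?Y" using sw by force
  have inj: "inj_on ?\<phi> ?X"
  proof (rule inj_onI)
    fix x y assume xy: "x \<in> ?X" "y \<in> ?X" "?\<phi> x = ?\<phi> y"
    obtain E c e where x: "x = (E, c, e)" by (cases x) auto
    obtain E' where y: "y = (E', c, e)" using xy(3) x by (cases y) auto
    have "E = (switch a b c e E - {edge a e, edge c b}) \<union> {edge a b, edge c e}"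
      using sw(4)[of E c e] xy(1) x by simp
    also have "switch a b c e E = switch a b c e E'" using xy(3) x y by simp
    also have "(switch a b c e E' - {edge a e, edge c b}) \<union> {edge a b, edge c e} = E'"
      using sw(4)[of E' c e] xy(2) y by simp
    finally show "x = y" using x y by simp
  qed
  have finYE: "finite (neigh E b \<times> neigh E a)" if "E \<in> ?G F" for E
    using that by (auto simp: reg_bip_graphs_iff intro!: finite_cartesian_product finite_neigh)
  have finY: "finite ?Y" by (rule finite_SigmaI[OF finG finYE])
  have "num_containing n d ?F * m = (\<Sum>E\<in>?G ?F. m)" by (simp add: num_containing_def)
  also have "\<dots> \<le> (\<Sum>E\<in>?G ?F. card (W E))" by (intro sum_mono W_card)
  also have "\<dots> = card ?X" using finW by (subst card_SigmaI) auto
  also have "\<dots> \<le> card ?Y" by (rule card_inj_on_le[OF inj img finY])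
  also have "\<dots> = (\<Sum>E\<in>?G F. card (neigh E b) * card (neigh E a))"
    using finG finYE by (subst card_SigmaI) (auto simp: card_cartesian_product)
  also have "\<dots> \<le> (\<Sum>E\<in>?G F. d\<^sup>2)"
  proof (rule sum_mono)
    fix E assume "E \<in> ?G F"
    then have g: "is_graph n E" and deg: "\<And>v. v < n \<Longrightarrow> card (neigh E v) = d" by (auto simp: reg_bip_graphs_iff)
    have "card (neigh E v) \<le> d" for v
    proof (cases "v < n")
      case False
      then have "neigh E v = {}" using is_graph_bounds[OF g] by (fastforce simp: neigh_def)
      then show ?thesis by simp
    qed (simp add: deg)
    then show "card (neigh E b) * card (neigh E a) \<le> d\<^sup>2" by (simp add: power2_eq_square mult_mono)
  qed
  also have "\<dots> = num_containing n d F * d\<^sup>2" by (simp add: num_containing_def)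
  finally show ?thesis .
qed

text \<open>Edges are inserted one at a time. The hypothesis \<open>big\<close> keeps half of the n
  d / 2 edges available as switching partners, so \<open>num_containing_insert\<close> applies with
  m \<ge> n d / 4 and each edge costs a factor d^2 / (n d / 4) = 4 d / n.\<close>

lemma num_containing_le:
  assumes F: "finite F" and n: "0 < n" and d: "0 < d" and big: "4 * (real (card F) + 2 * (real d)\<^sup>2) \<le> real n * real d"
  shows "real (num_containing n d F) \<le> (4 * real d / real n) ^ card F * real (card (reg_bip_graphs n d))"
  using F big
proof (induction F rule: finite_induct)
  case empty
  then show ?case by (simp add: num_containing_def)
next
  case (insert x F)
  obtain a b where x: "x = (a, b)" by fastforce
  have IH: "real (num_containing n d F) \<le> (4 * real d / real n) ^ card F * real (card (reg_bip_graphs n d))"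
    using insert by simp
  show ?case
  proof (cases "num_containing n d (insert x F) = 0")
    case True
    then show ?thesis by simp
  next
    case False
    \<comment> \<open>A nonzero count supplies a graph, through which the common number n d / 2 of
      edges is expressed.\<close>
    then obtain E0 where "E0 \<in> reg_bip_graphs n d" unfolding num_containing_def by fastforce
    have cE: "2 * card E = n * d" if "E \<in> reg_bip_graphs n d" for E
      using that by (auto simp: reg_bip_graphs_iff intro!: card_edges_regular)
    have c0: "real (card E0) = real n * real d / 2"
      using cE[OF \<open>E0 \<in> _\<close>] by (metis nonzero_mult_div_cancel_left of_nat_mult of_nat_numeral zero_neq_numeral)
    have big: "4 * (1 + real (card F) + 2 * (real d)\<^sup>2) \<le> real n * real d"
      using insert.prems insert.hyps by simp
    have lin: "f + 2 * p \<le> X / 2" "X / 4 \<le> X / 2 - f - 2 * p"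
      if "4 * (1 + f + 2 * p) \<le> X" "0 \<le> f" "0 \<le> p" for f p X :: real
      using that by (simp_all add: field_simps)
    define m where "m = card E0 - card F - 2 * d\<^sup>2"
    have le: "card F + 2 * d\<^sup>2 \<le> card E0"
    proof -
      have "real (card F + 2 * d\<^sup>2) \<le> real (card E0)"
        using lin(1)[OF big] unfolding c0 by simp
      then show ?thesis by (simp only: of_nat_le_iff)
    qed
    then have "real m = real (card E0) - real (card F) - 2 * (real d)\<^sup>2" unfolding m_def by (simp add: of_nat_diff)
    then have m: "real n * real d / 4 \<le> real m"
      using lin(2)[OF big] unfolding c0 by simp
    have "num_containing n d (insert (a, b) F) * m \<le> num_containing n d F * d\<^sup>2"
      by (rule num_containing_insert[where ?E0.0 = E0])
        (use insert.hyps x le cE \<open>E0 \<in> _\<close> in \<open>auto simp: m_def\<close>, metis cE mult_cancel1 zero_neq_numeral)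
    then have "real (num_containing n d (insert x F)) * real m \<le> real (num_containing n d F) * (real d)\<^sup>2"
      unfolding x by (metis of_nat_le_iff of_nat_mult of_nat_power)
    moreover have "real (num_containing n d (insert x F)) * (real n * real d / 4) \<le> real (num_containing n d (insert x F)) * real m"
      using m by (intro mult_left_mono) auto
    ultimately have "real (num_containing n d (insert x F)) * (real n * real d / 4) \<le> real (num_containing n d F) * (real d)\<^sup>2" by linarith
    then have "real (num_containing n d (insert x F)) \<le> 4 * real d / real n * real (num_containing n d F)"
      using n d by (simp add: field_simps power2_eq_square)
    also have "\<dots> \<le> 4 * real d / real n * ((4 * real d / real n) ^ card F * real (card (reg_bip_graphs n d)))"
      using IH by (intro mult_left_mono) auto
    finally show ?thesis using insert.hyps by simp
  qed
qed

section \<open>First-moment count of lollipops\<close>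

definition lollipop_edges :: "nat list \<Rightarrow> nat \<Rightarrow> (nat \<times> nat) set" where
  "lollipop_edges p j = insert (edge (last p) (p ! j)) ((\<lambda>i. edge (p ! i) (p ! Suc i)) ` {..<length p - 1})"

lemma card_lollipop_edges:
  assumes "distinct p" "j + 2 < length p"
  shows "card (lollipop_edges p j) = length p"
proof -
  have nn: "p ! i = p ! k \<longleftrightarrow> i = k" if "i < length p" "k < length p" for i k
    using nth_eq_iff_index_eq[OF assms(1)] that by simp
  have last: "last p = p ! (length p - 1)" using assms(2) by (intro last_conv_nth) auto
  have "inj_on (\<lambda>i. edge (p ! i) (p ! Suc i)) {..<length p - 1}"
    by (rule inj_onI) (auto simp: edge_eq_iff nn)
  then have "card ((\<lambda>i. edge (p ! i) (p ! Suc i)) ` {..<length p - 1}) = length p - 1"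
    by (simp add: card_image)
  moreover have "edge (last p) (p ! j) \<notin> (\<lambda>i. edge (p ! i) (p ! Suc i)) ` {..<length p - 1}"
    unfolding last using assms(2) by (auto simp: edge_eq_iff nn)
  ultimately show ?thesis using assms(2) by (simp add: lollipop_edges_def)
qed

lemma lollipop_edges_subset:
  assumes g: "is_graph n E" and l: "lollipop E p j"
  shows "lollipop_edges p j \<subseteq> E"
  using l unfolding lollipop_def lollipop_edges_def successively_conv_nth
  by (auto simp: neigh_iff_edge[OF g])

text \<open>There are n^l vertex lists of length l and l places for the closing edge, and the edges
  of such a lollipop occur together with frequency at most (4 d / n)^l. A lollipop has as many edges
  as vertices, so the powers of n cancel.\<close>

lemma sum_not_treelike_le:
  assumes n: "0 < n" and d: "0 < d" and big: "4 * (real L + 2 * (real d)\<^sup>2) \<le> real n * real d"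
  shows "(\<Sum>E\<in>reg_bip_graphs n d. real (card {s. s < n \<and> \<not> treelike E L s}))
    \<le> (real L + 1) * real L * (4 * real d) ^ L * real (card (reg_bip_graphs n d))"
proof -
  let ?N = "real (card (reg_bip_graphs n d))"
  let ?lists = "\<lambda>l. {xs. set xs \<subseteq> {..<n} \<and> length xs = l}"
  define P where "P = (SIGMA l:{..L}. ?lists l \<times> {..<l})"
  have finP: "finite P" unfolding P_def by (intro finite_SigmaI finite_cartesian_product) (auto intro: finite_lists_length_eq)
  define lp where "lp = (\<lambda>E. \<lambda>(l::nat, p, j). lollipop E p j)"
  have bad: "real (card {s. s < n \<and> \<not> treelike E L s}) \<le> (\<Sum>x\<in>P. if lp E x then 1 else 0)"
    if E: "E \<in> reg_bip_graphs n d" for E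
  proof -
    have g: "is_graph n E" using E by (simp add: reg_bip_graphs_iff)
    have "{s. s < n \<and> \<not> treelike E L s} \<subseteq> (\<lambda>(l, p, j). hd p) ` {x\<in>P. lp E x}"
    proof clarify
      fix s assume s: "s < n" "\<not> treelike E L s"
      then obtain p j where p: "length p \<le> L" "hd p = s" "lollipop E p j" unfolding treelike_def by blast
      have "set p \<subseteq> {..<n}"
      proof
        fix v assume "v \<in> set p"
        then obtain i where i: "i < length p" "v = p ! i" by (auto simp: in_set_conv_nth)
        show "v \<in> {..<n}"
        proof (cases i)
          case 0
          then show ?thesis using i s p(2) by (metis hd_conv_nth length_greater_0_conv lessThan_iff)
        next
          case (Suc i')
          then have "v \<in> neigh E (p ! i')" using p(3) i unfolding lollipop_def successively_conv_nth by auto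
          then show ?thesis using neigh_less[OF g] by simp
        qed
      qed
      then have "(length p, p, j) \<in> {x\<in>P. lp E x}" using p by (auto simp: P_def lp_def lollipop_def)
      then show "s \<in> (\<lambda>(l, p, j). hd p) ` {x\<in>P. lp E x}" using p(2) by force
    qed
    then have "card {s. s < n \<and> \<not> treelike E L s} \<le> card {x\<in>P. lp E x}"
      using finP by (intro surj_card_le) auto
    then show ?thesis using finP by (simp add: sum.If_cases Int_def)
  qed
  have "(\<Sum>E\<in>reg_bip_graphs n d. real (card {s. s < n \<and> \<not> treelike E L s}))
     \<le> (\<Sum>E\<in>reg_bip_graphs n d. \<Sum>x\<in>P. if lp E x then 1 else 0)"
    by (intro sum_mono bad)
  also have "\<dots> = (\<Sum>x\<in>P. \<Sum>E\<in>reg_bip_graphs n d. if lp E x then 1 else 0)" by (rule sum.swap)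
  also have "\<dots> \<le> (\<Sum>(l, p, j)\<in>P. (4 * real d / real n) ^ l * ?N)"
  proof (rule sum_mono, clarify)
    fix l p j assume x: "(l, p, j) \<in> P"
    then have l: "length p = l" "l \<le> L" by (auto simp: P_def)
    have "(\<Sum>E\<in>reg_bip_graphs n d. if lp E (l, p, j) then 1 else 0 :: real) = real (card {E\<in>reg_bip_graphs n d. lollipop E p j})"
      by (simp add: sum.If_cases Int_def lp_def)
    also have "\<dots> \<le> (4 * real d / real n) ^ l * ?N"
    proof (cases "distinct p \<and> j + 2 < length p")
      case False
      then have "{E\<in>reg_bip_graphs n d. lollipop E p j} = {}" by (auto simp: lollipop_def)
      then show ?thesis by (simp only: card.empty) simp
    next
      case True
      have c: "card (lollipop_edges p j) = l" using card_lollipop_edges True l by simp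
      have "card {E\<in>reg_bip_graphs n d. lollipop E p j} \<le> num_containing n d (lollipop_edges p j)"
        unfolding num_containing_def
      proof (rule card_mono)
        show "{E \<in> reg_bip_graphs n d. lollipop E p j} \<subseteq> {E \<in> reg_bip_graphs n d. lollipop_edges p j \<subseteq> E}"
          using lollipop_edges_subset unfolding reg_bip_graphs_iff by blast
      qed simp
      moreover have "real (num_containing n d (lollipop_edges p j)) \<le> (4 * real d / real n) ^ card (lollipop_edges p j) * ?N"
      proof (rule num_containing_le[OF _ n d])
        show "finite (lollipop_edges p j)" by (simp add: lollipop_edges_def)
        show "4 * (real (card (lollipop_edges p j)) + 2 * (real d)\<^sup>2) \<le> real n * real d"
          unfolding c using l(2) by (intro order_trans[OF _ big]) simp
      qed
      ultimately show ?thesis unfolding c by linarith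
    qed
    finally show "(\<Sum>E\<in>reg_bip_graphs n d. if lp E (l, p, j) then 1 else 0) \<le> (4 * real d / real n) ^ l * ?N" .
  qed
  also have "\<dots> = (\<Sum>l\<le>L. \<Sum>(p, j)\<in>?lists l \<times> {..<l}. (4 * real d / real n) ^ l * ?N)"
    unfolding P_def by (subst sum.Sigma[symmetric]) (auto intro: finite_lists_length_eq)
  also have "\<dots> = (\<Sum>l\<le>L. real l * (4 * real d) ^ l * ?N)"
  proof (rule sum.cong[OF refl])
    fix l
    have "(\<Sum>(p, j)\<in>?lists l \<times> {..<l}. (4 * real d / real n) ^ l * ?N) = real (n ^ l) * real l * ((4 * real d / real n) ^ l * ?N)"
      using card_lists_length_eq[of "{..<n}" l] by (simp add: case_prod_beta card_cartesian_product)
    also have "\<dots> = real l * (4 * real d) ^ l * ?N"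
      using n by (simp add: power_divide field_simps)
    finally show "(\<Sum>(p, j)\<in>?lists l \<times> {..<l}. (4 * real d / real n) ^ l * ?N) = real l * (4 * real d) ^ l * ?N" .
  qed
  also have "\<dots> \<le> (\<Sum>l\<le>L. real L * (4 * real d) ^ L * ?N)"
    using d by (intro sum_mono mult_right_mono mult_mono power_increasing) auto
  also have "\<dots> = (real L + 1) * real L * (4 * real d) ^ L * ?N" by simp
  finally show ?thesis .
qed

section \<open>The average cut\<close>


text \<open>A single term of the exponential series; at x = m it yields the Stirling-type bound m^m
  / m! \<le> e^m.\<close>

lemma power_fact_le_exp: "0 \<le> x \<Longrightarrow> x ^ m / fact m \<le> exp (x::real)"
proof -
  assume x: "0 \<le> x"
  have "(\<Sum>k\<in>{m}. x ^ k /\<^sub>R fact k) \<le> (\<Sum>k. x ^ k /\<^sub>R fact k)"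
    by (rule sum_le_suminf) (use summable_exp_generic[of x] x in auto)
  then show ?thesis by (simp add: exp_def divide_inverse mult.commute)
qed

text \<open>Ball membership is symmetric, so the vertices counted lie in the balls around the
  non-treelike ones.\<close>

lemma card_near_not_treelike_le:
  assumes g: "is_graph n E" and D: "\<And>i. i < n \<Longrightarrow> card (neigh E i) \<le> D"
  shows "card {i. i < n \<and> (\<exists>s<n. \<not> treelike E L s \<and> s \<in> gball E r i)}
    \<le> (D + 1) ^ r * card {s. s < n \<and> \<not> treelike E L s}"
proof -
  let ?B = "{s. s < n \<and> \<not> treelike E L s}"
  have "{i. i < n \<and> (\<exists>s<n. \<not> treelike E L s \<and> s \<in> gball E r i)} \<subseteq> (\<Union>s\<in>?B. gball E r s)"
    using gball_sym by blast
  then have "card {i. i < n \<and> (\<exists>s<n. \<not> treelike E L s \<and> s \<in> gball E r i)} \<le> card (\<Union>s\<in>?B. gball E r s)"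
    using card_gball_le[OF g D] by (intro card_mono finite_UN_I) auto
  also have "\<dots> \<le> (\<Sum>s\<in>?B. card (gball E r s))" by (rule card_UN_le) simp
  also have "\<dots> \<le> (\<Sum>s\<in>?B. (D + 1) ^ r)" using card_gball_le[OF g D] by (intro sum_mono) auto
  finally show ?thesis by (simp add: mult.commute)
qed

text \<open>Gram vectors of length one give each edge at most weight one. This settles the degrees
  below 64.\<close>

lemma neg_expect_le_card:
  assumes "annealing n E u T U" "2 \<le> d" "\<And>i. i < n \<Longrightarrow> card (neigh E i) \<le> d"
  shows "neg_expect n (costH n E) (apply_op n (U T) (plus_state n)) \<le> real d / 2 * n"
proof -
  interpret annealing n E u T U by fact
  obtain a where a: "\<forall>i<n. (\<Sum>S\<in>basis n. (cmod (a i S))\<^sup>2) = 1"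
    and cut: "neg_expect n (costH n E) (apply_op n (U T) (plus_state n))
      = (\<Sum>(i,j)\<in>E. (1 - Re (\<Sum>S\<in>basis n. cnj (a i S) * a j S)) / 2)"
    by (rule exE[OF fourier_light_cone[OF assms(2)]], erule assms(3), elim conjE, rule that)
  have "(\<Sum>(i,j)\<in>E. (1 - Re (\<Sum>S\<in>basis n. cnj (a i S) * a j S)) / 2) \<le> (\<Sum>(i,j)\<in>E. 1 / 2 + 1 / 2)"
  proof (rule sum_mono, clarify)
    fix i j assume "(i, j) \<in> E"
    then have "i < n" "j < n" using is_graph_bounds[OF graph] by fastforce+
    then have "nrm n (a i) = 1" "nrm n (a j) = 1" using a by (auto simp: nrm_def L2_set_def)
    then have "cmod (inn n (a i) (a j)) \<le> 1" using inn_cauchy_schwarz[of n "a i" "a j"] by simp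
    then show "(1 - Re (\<Sum>S\<in>basis n. cnj (a i S) * a j S)) / 2 \<le> 1 / 2 + 1 / 2"
      using abs_Re_le_cmod[of "inn n (a i) (a j)"] unfolding inn_def by (simp add: abs_le_iff)
  qed
  also have "\<dots> \<le> real d * (\<Sum>v<n. 1 / 2)" by (rule sum_edge_ends_le[OF graph assms(3)]) auto
  finally show ?thesis unfolding cut by simp
qed

text \<open>From 1 + 4/\<kappa> \<ge> 5, \<kappa> \<le> 1 and the choice of \<open>r\<close> it
  follows that 3 d T \<le> (15/16) (r+1) / d^4. With (r+1)^(r+1) / (r+1)! \<le> e^(r+1) \<le>
  d^(r+1) the left side is at most d^(-3(r+1)), and d^(5(r+1)) > n.\<close>

lemma light_cone_error_le:
  fixes d n r :: nat and \<kappa> T :: real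
  assumes d: "64 \<le> d" and n: "2 \<le> n" and \<kappa>: "0 < \<kappa>" "\<kappa> < 1" and T: "0 < T"
    and T_le: "T \<le> \<kappa> / (16 * ln (real d) * real d powr (1 + 4 / \<kappa>)) * ln (real n)"
    and r: "ln (real n) < 5 * (real r + 1) * ln (real d)"
  shows "(3 * real d * T) ^ Suc r / fact (Suc r) \<le> real n powr (-(3/5))"
proof -
  have lnd: "0 < ln (real d)" and lnn: "0 < ln (real n)" using d n by auto
  have "real d ^ 5 = real d powr 5" using d by (simp add: powr_numeral)
  also have "\<dots> \<le> real d powr (1 + 4 / \<kappa>)"
    using d \<kappa> by (intro powr_mono) (auto simp: field_simps)
  finally have pw: "real d ^ 5 \<le> real d powr (1 + 4 / \<kappa>)" .
  have "T \<le> 1 / (16 * ln (real d) * real d ^ 5) * (5 * (real r + 1) * ln (real d))"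
  proof (rule order_trans[OF T_le mult_mono])
    show "\<kappa> / (16 * ln (real d) * real d powr (1 + 4 / \<kappa>)) \<le> 1 / (16 * ln (real d) * real d ^ 5)"
      using \<kappa> lnd d pw by (intro frac_le mult_left_mono) auto
  qed (use r lnn lnd in auto)
  also have "\<dots> = 5 * (real r + 1) / (16 * real d ^ 5)" using lnd by simp
  finally have "3 * real d * T \<le> 3 * real d * (5 * (real r + 1) / (16 * real d ^ 5))"
    using d by (intro mult_left_mono) auto
  also have "\<dots> = 15 / 16 * ((real r + 1) / real d ^ 4)"
    using d by (simp add: field_simps power_numeral_reduce)
  also have "\<dots> \<le> 1 * ((real r + 1) / real d ^ 4)"
    by (intro mult_right_mono) auto
  finally have le: "3 * real d * T \<le> real (Suc r) / real d ^ 4" by (simp add: add.commute)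
  have e: "exp (real (Suc r)) \<le> real d ^ Suc r"
  proof -
    have "exp (real (Suc r)) = exp 1 ^ Suc r" by (simp only: exp_of_nat_mult[symmetric] mult_1_right)
    also have "\<dots> \<le> real d ^ Suc r" using exp_le d by (intro power_mono) auto
    finally show ?thesis .
  qed
  have "(3 * real d * T) ^ Suc r / fact (Suc r) \<le> (real (Suc r) / real d ^ 4) ^ Suc r / fact (Suc r)"
    using le d T by (intro divide_right_mono power_mono) auto
  also have "\<dots> = (real (Suc r) ^ Suc r / fact (Suc r)) / (real d ^ 4) ^ Suc r"
    by (simp only: power_divide divide_divide_eq_left mult.commute)
  also have "\<dots> \<le> real d ^ Suc r / (real d ^ 4) ^ Suc r"
    using power_fact_le_exp[of "real (Suc r)" "Suc r"] e
    by (intro divide_right_mono) (auto simp del: power_Suc fact_Suc of_nat_Suc)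
  also have "\<dots> = (1 / real d ^ 3) ^ Suc r"
  proof -
    have "real d / real d ^ 4 = 1 / real d ^ 3" using d by (simp add: field_simps power_numeral_reduce)
    then show ?thesis by (simp only: power_divide[symmetric])
  qed
  also have "\<dots> = exp (- (3 * (real r + 1) * ln (real d)))"
  proof -
    have "1 / real d ^ 3 = exp (- (3 * ln (real d)))"
      using d by (simp add: exp_minus exp_of_nat_mult[of 3, simplified] divide_inverse)
    then have "(1 / real d ^ 3) ^ Suc r = exp (real (Suc r) * - (3 * ln (real d)))"
      by (simp only: exp_of_nat_mult)
    then show ?thesis by (simp add: algebra_simps)
  qed
  also have "\<dots> \<le> exp (- (3/5) * ln (real n))" using r by (subst exp_le_cancel_iff) (simp add: algebra_simps)
  also have "\<dots> = real n powr (-(3/5))" using n by (simp add: powr_def)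
  finally show ?thesis .
qed

text \<open>The growth rates d + 1 and (4 d)^2 multiply to at most d^4 because d \<ge> 32, and
  d^(5r) \<le> n. The surplus 2 in the exponent together with d / 4 gives 4 d^3, and r \<le> ln n
  turns the polynomial in \<open>r\<close> into logarithms.\<close>

lemma treelike_error_le:
  fixes d n r :: nat
  assumes d: "64 \<le> d" and n: "2 \<le> n" and r: "5 * real r * ln (real d) \<le> ln (real n)"
  shows "real d / 4 * ((real d + 1) ^ r * ((real (2 * r + 2) + 1) * real (2 * r + 2) * (4 * real d) ^ (2 * r + 2)))
    \<le> 4 * real d ^ 3 * (2 * ln (real n) + 3)\<^sup>2 * real n powr (4/5)"
proof -
  have "1 \<le> ln (real d)"
    using d exp_le by (subst ln_ge_iff) auto
  then have "real r * 1 \<le> real r * (5 * ln (real d))" by (intro mult_left_mono) auto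
  then have rn: "real r \<le> ln (real n)" using r by (simp add: mult_ac)
  have d4: "(real d ^ 4) ^ r \<le> real n powr (4/5)"
  proof -
    have "(real d ^ 4) ^ r = exp (real r * (4 * ln (real d)))"
      using d by (simp add: exp_of_nat_mult exp_of_nat_mult[of 4, simplified])
    also have "\<dots> \<le> exp (4/5 * ln (real n))" using r by (subst exp_le_cancel_iff) (simp add: algebra_simps)
    also have "\<dots> = real n powr (4/5)" using n by (simp add: powr_def)
    finally show ?thesis .
  qed
  have "(real d + 1) ^ r * (4 * real d) ^ (2 * r + 2) = (4 * real d)\<^sup>2 * ((real d + 1) * (4 * real d)\<^sup>2) ^ r"
  proof -
    have "(4 * real d) ^ (2 * r + 2) = ((4 * real d)\<^sup>2) ^ r * (4 * real d)\<^sup>2"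
      by (simp only: power_add power_mult)
    then show ?thesis by (simp only: power_mult_distrib[of "real d + 1"] mult_ac)
  qed
  also have "\<dots> \<le> (4 * real d)\<^sup>2 * (real d ^ 4) ^ r"
  proof (intro mult_left_mono power_mono)
    have "(real d + 1) * (4 * real d)\<^sup>2 \<le> (2 * real d) * (4 * real d)\<^sup>2"
      using d by (intro mult_right_mono) auto
    also have "\<dots> = 32 * real d ^ 3" by (simp add: power2_eq_square power3_eq_cube)
    also have "\<dots> \<le> real d * real d ^ 3" using d by (intro mult_right_mono) auto
    finally show "(real d + 1) * (4 * real d)\<^sup>2 \<le> real d ^ 4" by (simp add: power_numeral_reduce)
  qed auto
  also have "\<dots> \<le> (4 * real d)\<^sup>2 * real n powr (4/5)" using d4 by (intro mult_left_mono) auto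
  finally have 1: "(real d + 1) ^ r * (4 * real d) ^ (2 * r + 2) \<le> (4 * real d)\<^sup>2 * real n powr (4/5)" .
  have "(real (2 * r + 2) + 1) * real (2 * r + 2) \<le> (2 * ln (real n) + 3) * (2 * ln (real n) + 3)"
    using rn by (intro mult_mono) auto
  then have 2: "(real (2 * r + 2) + 1) * real (2 * r + 2) \<le> (2 * ln (real n) + 3)\<^sup>2"
    by (simp only: power2_eq_square)
  have "real d / 4 * ((real d + 1) ^ r * ((real (2 * r + 2) + 1) * real (2 * r + 2) * (4 * real d) ^ (2 * r + 2)))
     = real d / 4 * (((real (2 * r + 2) + 1) * real (2 * r + 2)) * ((real d + 1) ^ r * (4 * real d) ^ (2 * r + 2)))"
    by (simp only: mult_ac)
  also have "\<dots> \<le> real d / 4 * ((2 * ln (real n) + 3)\<^sup>2 * ((4 * real d)\<^sup>2 * real n powr (4/5)))"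
    by (intro mult_left_mono mult_mono[OF 2 1]) auto
  also have "\<dots> = 4 * real d ^ 3 * (2 * ln (real n) + 3)\<^sup>2 * real n powr (4/5)"
    by (simp add: power2_eq_square power3_eq_cube)
  finally show ?thesis .
qed

text \<open>The threshold depends on \<open>d\<close> and \<nu> alone, so it can be fixed before
  \<open>T\<close>, the control and the evolutions are given.\<close>

lemma large_n:
  fixes d \<nu> :: real
  assumes "0 < d" "0 < \<nu>"
  obtains N :: nat where "\<And>n. N \<le> n \<Longrightarrow> 2 \<le> n"
    and "\<And>n. N \<le> n \<Longrightarrow> d / 2 * real n powr (-(1/10)) \<le> \<nu>"
    and "\<And>n. N \<le> n \<Longrightarrow> 4 * d ^ 3 * (2 * ln (real n) + 3)\<^sup>2 * real n powr (4/5) \<le> \<nu> * real n"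
    and "\<And>n. N \<le> n \<Longrightarrow> 4 * (2 * ln (real n) + 2 + 2 * d\<^sup>2) \<le> real n * d"
proof -
  have "(\<lambda>n::nat. d / 2 * real n powr (-(1/10))) \<longlonglongrightarrow> 0" by real_asymp
  then have 1: "\<forall>\<^sub>F n::nat in sequentially. d / 2 * real n powr (-(1/10)) < \<nu>"
    using assms by (intro order_tendstoD) auto
  have "(\<lambda>n::nat. 4 * d ^ 3 * ((2 * ln (real n) + 3)\<^sup>2 * real n powr (4/5) / real n)) \<longlonglongrightarrow> 4 * d ^ 3 * 0"
    by (intro tendsto_mult tendsto_const) real_asymp
  then have 2: "\<forall>\<^sub>F n::nat in sequentially. 4 * d ^ 3 * ((2 * ln (real n) + 3)\<^sup>2 * real n powr (4/5) / real n) < \<nu>"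
    using assms by (intro order_tendstoD) auto
  have "(\<lambda>n::nat. 4 * (2 * ln (real n) + 2 + 2 * d\<^sup>2) / real n) \<longlonglongrightarrow> 0" by real_asymp
  then have 3: "\<forall>\<^sub>F n::nat in sequentially. 4 * (2 * ln (real n) + 2 + 2 * d\<^sup>2) / real n < d"
    using assms by (intro order_tendstoD) auto
  have "\<forall>\<^sub>F n in sequentially. 2 \<le> n \<and> d / 2 * real n powr (-(1/10)) \<le> \<nu> \<and>
     4 * d ^ 3 * (2 * ln (real n) + 3)\<^sup>2 * real n powr (4/5) \<le> \<nu> * real n \<and>
     4 * (2 * ln (real n) + 2 + 2 * d\<^sup>2) \<le> real n * d"
    using 1 2 3 eventually_ge_at_top[of "2::nat"]
    by eventually_elim (simp add: field_simps)
  then obtain N where "\<forall>n\<ge>N. 2 \<le> n \<and> d / 2 * real n powr (-(1/10)) \<le> \<nu> \<and>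
     4 * d ^ 3 * (2 * ln (real n) + 3)\<^sup>2 * real n powr (4/5) \<le> \<nu> * real n \<and>
     4 * (2 * ln (real n) + 2 + 2 * d\<^sup>2) \<le> real n * d"
    unfolding eventually_sequentially by blast
  then show ?thesis using that by blast
qed

text \<open>Each error is charged to one \<nu>: the light-cone tail for every single graph, by
  \<open>n1\<close>, and the bad vertices on average over the graphs, by \<open>n2\<close>.\<close>

lemma average_cut_le:
  fixes d n :: nat and \<kappa> \<nu> T :: real
  assumes d: "64 \<le> d" and n: "2 \<le> n" and \<kappa>: "0 < \<kappa>" "\<kappa> < 1" and \<nu>: "0 < \<nu>" and T: "0 < T"
    and T_le: "T \<le> \<kappa> / (16 * ln (real d) * real d powr (1 + 4 / \<kappa>)) * ln (real n)"
    and n1: "real d / 2 * real n powr (-(1/10)) \<le> \<nu>"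
    and n2: "4 * real d ^ 3 * (2 * ln (real n) + 3)\<^sup>2 * real n powr (4/5) \<le> \<nu> * real n"
    and n3: "4 * (2 * ln (real n) + 2 + 2 * (real d)\<^sup>2) \<le> real n * real d"
    and ann: "\<And>E. E \<in> reg_bip_graphs n d \<Longrightarrow> annealing n E u T (Uf E)"
  shows "(\<Sum>E\<in>reg_bip_graphs n d. neg_expect n (costH n E) (apply_op n (Uf E T) (plus_state n)))
    \<le> (real d / 4 + sqrt (real d) / 2 + 2 * \<nu>) * real n * real (card (reg_bip_graphs n d))"
proof -
  let ?G = "reg_bip_graphs n d" and ?N = "real (card (reg_bip_graphs n d))"
  have lnd: "0 < ln (real d)" using d by simp
  \<comment> \<open>The largest radius with d^(5r) \<le> n.\<close>
  define r where "r = nat \<lfloor>ln (real n) / (5 * ln (real d))\<rfloor>"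
  have "0 \<le> ln (real n) / (5 * ln (real d))" using n lnd by simp
  then have "real r \<le> ln (real n) / (5 * ln (real d))" "ln (real n) / (5 * ln (real d)) < real r + 1"
    unfolding r_def by linarith+
  then have r: "5 * real r * ln (real d) \<le> ln (real n)" "ln (real n) < 5 * (real r + 1) * ln (real d)"
    using lnd by (simp_all add: field_simps)
  let ?L = "2 * r + 2"
  define \<tau> where "\<tau> = (3 * real d * T) ^ Suc r / fact (Suc r)"
  have \<tau>0: "0 \<le> \<tau>" using T by (simp add: \<tau>_def)
  have \<tau>: "\<tau> \<le> real n powr (-(3/5))"
    unfolding \<tau>_def by (rule light_cone_error_le[OF d n \<kappa> T T_le r(2)])
  define bad where "bad = (\<lambda>E. {i. i < n \<and> (\<exists>s<n. \<not> treelike E ?L s \<and> s \<in> gball E r i)})"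
  have one: "neg_expect n (costH n E) (apply_op n (Uf E T) (plus_state n))
      \<le> (real d / 4 + sqrt d / 2 + \<nu>) * n + real d / 4 * card (bad E)" if E: "E \<in> ?G" for E
  proof -
    interpret annealing n E u T "Uf E" by (rule ann[OF E])
    have deg: "card (neigh E i) \<le> d" if "i < n" for i using E that by (simp add: reg_bip_graphs_iff)
    have d2: "2 \<le> d" using d by simp
    obtain a where a: "\<forall>i<n. (\<Sum>S\<in>basis n. (cmod (a i S))\<^sup>2) = 1" and a0: "\<forall>i<n. a i {} = 0"
      and tail: "\<forall>i<n. \<forall>k<n. \<forall>m. (\<forall>m'<m. i \<notin> gball E m' k) \<longrightarrow>
        (\<Sum>S\<in>{S\<in>basis n. k \<in> S}. (cmod (a i S))\<^sup>2) \<le> ((3 * real d * T) ^ m / fact m)\<^sup>2"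
      and cut: "neg_expect n (costH n E) (apply_op n (Uf E T) (plus_state n))
        = (\<Sum>(i,j)\<in>E. (1 - Re (\<Sum>S\<in>basis n. cnj (a i S) * a j S)) / 2)"
      by (rule exE[OF fourier_light_cone[OF d2]], erule deg, elim conjE, rule that)
    have "neg_expect n (costH n E) (apply_op n (Uf E T) (plus_state n))
      \<le> real d / 4 * n + sqrt d / 2 * n + real d / 4 * card (bad E) + real d / 2 * n * sqrt (n * \<tau>\<^sup>2)"
      unfolding cut bad_def
    proof (rule cut_bound_of_light_cone[OF graph _ deg a[rule_format] a0[rule_format]])
      fix i k assume ik: "i < n" "k < n" "i \<notin> gball E r k"
      \<comment> \<open>Outside the ball of radius \<open>r\<close> means distance at least
        \<open>Suc r\<close>, the exponent in \<tau>.\<close>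
      have "i \<notin> gball E m' k" if "m' < Suc r" for m'
        using ik(3) gball_mono[of m' r E k] that by auto
      then show "(\<Sum>S\<in>{S\<in>basis n. k \<in> S}. (cmod (a i S))\<^sup>2) \<le> \<tau>\<^sup>2"
        unfolding \<tau>_def by (rule tail[rule_format, OF ik(1,2)])
    qed (use d in auto)
    also have "real d / 2 * n * sqrt (n * \<tau>\<^sup>2) \<le> \<nu> * n"
    proof -
      have "sqrt (n * \<tau>\<^sup>2) = real n powr (1/2) * \<tau>" using \<tau>0 by (simp add: real_sqrt_mult powr_half_sqrt)
      also have "\<dots> \<le> real n powr (1/2) * real n powr (-(3/5))" using \<tau> by (intro mult_left_mono) auto
      also have "\<dots> = real n powr (-(1/10))" by (simp add: powr_add[symmetric])
      finally have "real d / 2 * sqrt (n * \<tau>\<^sup>2) \<le> real d / 2 * real n powr (-(1/10))" by (intro mult_left_mono) auto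
      then have "real d / 2 * sqrt (n * \<tau>\<^sup>2) \<le> \<nu>" using n1 by linarith
      then have "real d / 2 * sqrt (n * \<tau>\<^sup>2) * n \<le> \<nu> * n" by (rule mult_right_mono) simp
      then show ?thesis by (simp only: mult_ac)
    qed
    finally show ?thesis by (simp add: algebra_simps)
  qed
  have "(\<Sum>E\<in>?G. real (card (bad E))) \<le> (\<Sum>E\<in>?G. (real d + 1) ^ r * real (card {s. s < n \<and> \<not> treelike E ?L s}))"
  proof (rule sum_mono)
    fix E assume "E \<in> ?G"
    then have "is_graph n E" "\<And>i. i < n \<Longrightarrow> card (neigh E i) \<le> d" by (auto simp: reg_bip_graphs_iff)
    then have "real (card (bad E)) \<le> real ((d + 1) ^ r * card {s. s < n \<and> \<not> treelike E ?L s})"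
      unfolding bad_def of_nat_le_iff by (rule card_near_not_treelike_le)
    then show "real (card (bad E)) \<le> (real d + 1) ^ r * real (card {s. s < n \<and> \<not> treelike E ?L s})"
      by (simp add: add.commute)
  qed
  also have "\<dots> \<le> (real d + 1) ^ r * ((real ?L + 1) * real ?L * (4 * real d) ^ ?L * ?N)"
    unfolding sum_distrib_left[symmetric]
  proof (intro mult_left_mono sum_not_treelike_le)
    have "1 \<le> ln (real d)" using d exp_le by (subst ln_ge_iff) auto
    then have "real r * 1 \<le> real r * (5 * ln (real d))" by (intro mult_left_mono) auto
    then have "real ?L \<le> 2 * ln (real n) + 2" using r(1) by (simp add: mult_ac)
    then show "4 * (real ?L + 2 * (real d)\<^sup>2) \<le> real n * real d" using n3 by simp
  qed (use d n in auto)
  finally have "real d / 4 * (\<Sum>E\<in>?G. real (card (bad E)))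
     \<le> real d / 4 * ((real d + 1) ^ r * ((real ?L + 1) * real ?L * (4 * real d) ^ ?L * ?N))"
    by (intro mult_left_mono) auto
  also have "\<dots> = real d / 4 * ((real d + 1) ^ r * ((real ?L + 1) * real ?L * (4 * real d) ^ ?L)) * ?N"
    by (simp only: mult.assoc)
  also have "\<dots> \<le> \<nu> * n * ?N"
    using treelike_error_le[OF d n r(1)] n2 by (intro mult_right_mono) auto
  finally have badsum: "real d / 4 * (\<Sum>E\<in>?G. real (card (bad E))) \<le> \<nu> * n * ?N" .
  have "(\<Sum>E\<in>?G. neg_expect n (costH n E) (apply_op n (Uf E T) (plus_state n)))
     \<le> (\<Sum>E\<in>?G. (real d / 4 + sqrt d / 2 + \<nu>) * n + real d / 4 * card (bad E))"
    by (intro sum_mono one)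
  also have "\<dots> = (real d / 4 + sqrt d / 2 + \<nu>) * n * ?N + real d / 4 * (\<Sum>E\<in>?G. real (card (bad E)))"
    by (simp add: sum.distrib sum_distrib_left)
  also have "\<dots> \<le> (real d / 4 + sqrt d / 2 + \<nu>) * n * ?N + \<nu> * n * ?N"
    using badsum by simp
  finally show ?thesis by (simp add: algebra_simps)
qed

theorem theorem6:
  "\<exists>c::real. \<forall>\<Delta>::nat. \<Delta> \<ge> 2 \<longrightarrow>
     (\<forall>\<kappa>::real. 0 < \<kappa> \<and> \<kappa> < 1 \<longrightarrow>
       (\<forall>\<nu>::real. \<nu> > 0 \<longrightarrow>
         (\<exists>N::nat. \<forall>n\<ge>N. reg_bip_graphs n \<Delta> \<noteq> {} \<longrightarrow>
           (\<forall>(T::real) (u::real \<Rightarrow> real) (Uf :: (nat \<times> nat) set \<Rightarrow> real \<Rightarrow> qop).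
              0 < T \<longrightarrow>
              T \<le> \<kappa> / (16 * ln (real \<Delta>) * real \<Delta> powr (1 + 4 / \<kappa>)) * ln (real n) \<longrightarrow>
              (\<forall>t\<in>{0..T}. 0 \<le> u t \<and> u t \<le> 1) \<longrightarrow> u 0 = 0 \<longrightarrow> u T = 1 \<longrightarrow>
              (\<forall>E\<in>reg_bip_graphs n \<Delta>. is_propagator n (annealH n E u) T (Uf E)) \<longrightarrow>
              (\<Sum>E\<in>reg_bip_graphs n \<Delta>.
                  neg_expect n (costH n E) (apply_op n (Uf E T) (plus_state n)))
                / real (card (reg_bip_graphs n \<Delta>))
              \<le> (real \<Delta> / 4 + c * sqrt (real \<Delta>) + 2 * \<nu>) * real n))))"
\<comment> \<open>Large degrees need only 1/2. The value 2 serves d < 64, where sqrt d \<le> 8 gives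
  d / 2 \<le> d / 4 + 2 sqrt d.\<close>
proof (rule exI[of _ 2], intro allI impI)
  fix d :: nat and \<kappa> \<nu> :: real
  assume d: "2 \<le> d" and \<kappa>: "0 < \<kappa> \<and> \<kappa> < 1" and \<nu>: "0 < \<nu>"
  obtain N :: nat where N: "\<And>n. N \<le> n \<Longrightarrow> 2 \<le> n"
    "\<And>n. N \<le> n \<Longrightarrow> real d / 2 * real n powr (-(1/10)) \<le> \<nu>"
    "\<And>n. N \<le> n \<Longrightarrow> 4 * real d ^ 3 * (2 * ln (real n) + 3)\<^sup>2 * real n powr (4/5) \<le> \<nu> * real n"
    "\<And>n. N \<le> n \<Longrightarrow> 4 * (2 * ln (real n) + 2 + 2 * (real d)\<^sup>2) \<le> real n * real d"
    using large_n[of "real d" \<nu>] d \<nu> by auto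
  show "\<exists>N. \<forall>n\<ge>N. reg_bip_graphs n d \<noteq> {} \<longrightarrow>
     (\<forall>T u Uf. 0 < T \<longrightarrow>
        T \<le> \<kappa> / (16 * ln (real d) * real d powr (1 + 4 / \<kappa>)) * ln (real n) \<longrightarrow>
        (\<forall>t\<in>{0..T}. 0 \<le> u t \<and> u t \<le> 1) \<longrightarrow> u 0 = 0 \<longrightarrow> u T = 1 \<longrightarrow>
        (\<forall>E\<in>reg_bip_graphs n d. is_propagator n (annealH n E u) T (Uf E)) \<longrightarrow>
        (\<Sum>E\<in>reg_bip_graphs n d. neg_expect n (costH n E) (apply_op n (Uf E T) (plus_state n)))
          / real (card (reg_bip_graphs n d))
        \<le> (real d / 4 + 2 * sqrt (real d) + 2 * \<nu>) * real n)"
  proof (rule exI[of _ N], intro allI impI)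
    fix n T and u :: "real \<Rightarrow> real" and Uf
    assume n: "N \<le> n" and ne: "reg_bip_graphs n d \<noteq> {}" and T: "0 < T"
      and T_le: "T \<le> \<kappa> / (16 * ln (real d) * real d powr (1 + 4 / \<kappa>)) * ln (real n)"
      and u: "\<forall>t\<in>{0..T}. 0 \<le> u t \<and> u t \<le> 1"
      and evol: "\<forall>E\<in>reg_bip_graphs n d. is_propagator n (annealH n E u) T (Uf E)"
    let ?S = "\<Sum>E\<in>reg_bip_graphs n d. neg_expect n (costH n E) (apply_op n (Uf E T) (plus_state n))"
    let ?N = "real (card (reg_bip_graphs n d))"
    have pos: "0 < ?N" using ne by (simp add: card_gt_0_iff)
    have ann: "annealing n E u T (Uf E)" if "E \<in> reg_bip_graphs n d" for E
      by unfold_locales (use that T u evol in \<open>auto simp: reg_bip_graphs_iff\<close>)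
    have "?S \<le> (real d / 4 + 2 * sqrt (real d) + 2 * \<nu>) * real n * ?N"
    proof (cases "64 \<le> d")
      case True
      have "?S \<le> (real d / 4 + sqrt (real d) / 2 + 2 * \<nu>) * real n * ?N"
        using average_cut_le[OF True N(1)[OF n] _ _ \<nu> T T_le N(2,3,4)[OF n] ann] \<kappa> by simp
      also have "\<dots> \<le> (real d / 4 + 2 * sqrt (real d) + 2 * \<nu>) * real n * ?N"
        by (intro mult_right_mono) auto
      finally show ?thesis .
    next
      case False
      then have "sqrt (real d) \<le> sqrt 64" by (subst real_sqrt_le_iff) simp
      then have "sqrt (real d) \<le> 8" by simp
      then have "sqrt (real d) * sqrt (real d) \<le> 8 * sqrt (real d)" by (intro mult_right_mono) auto
      then have "real d \<le> 8 * sqrt (real d)" by simp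
      then have "real d / 2 \<le> real d / 4 + 2 * sqrt (real d) + 2 * \<nu>" using \<nu> by linarith
      then have le: "real d / 2 * n \<le> (real d / 4 + 2 * sqrt (real d) + 2 * \<nu>) * n"
        by (intro mult_right_mono) auto
      have "?S \<le> (\<Sum>E\<in>reg_bip_graphs n d. (real d / 4 + 2 * sqrt (real d) + 2 * \<nu>) * n)"
      proof (rule sum_mono)
        fix E assume E: "E \<in> reg_bip_graphs n d"
        have "neg_expect n (costH n E) (apply_op n (Uf E T) (plus_state n)) \<le> real d / 2 * n"
          by (rule neg_expect_le_card[OF ann[OF E] d]) (use E in \<open>simp add: reg_bip_graphs_iff\<close>)
        then show "neg_expect n (costH n E) (apply_op n (Uf E T) (plus_state n))
          \<le> (real d / 4 + 2 * sqrt (real d) + 2 * \<nu>) * n" using le by linarith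
      qed
      then show ?thesis by (simp add: mult_ac)
    qed
    then show "?S / ?N \<le> (real d / 4 + 2 * sqrt (real d) + 2 * \<nu>) * real n"
      using pos by (simp add: pos_divide_le_eq)
  qed
qed

end
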